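(* Let $\mathfrak g=sl_{r+1}$, let $\boldsymbol\Lambda=(\Lambda_1,\dots,\Lambda_n)$ be a collection of integral dominant $sl_{r+1}$-weights and $\boldsymbol l=(l_1,\dots,l_r)$ a sequence of non-negative integers such that $\Lambda-\alpha(\boldsymbol l)$ is integral dominant, where $\Lambda=\Lambda_1+\dots+\Lambda_n$ and $\alpha(\boldsymbol l)=l_1\alpha_1+\dots+l_r\alpha_r$. Let $z\in\mathbb C^n$ be a point with distinct coordinates, let $t^0$ be a non-degenerate critical point of the master function $\Phi(\,\cdot\,,z,\boldsymbol\Lambda,\boldsymbol l)$, let $\omega(t^0,z)\in \mathrm{Sing}\,V_{\boldsymbol\Lambda}[\Lambda-\alpha(\boldsymbol l)]$ be the corresponding Bethe vector, and let $S$ be the tensor Shapovalov form on $V_{\boldsymbol\Lambda}$. Then $$S\big(\omega(t^0,z),\,\omega(t^0,z)\big)\;=\;\mathrm{Hess}_t\,\log\Phi(t^0,z,\boldsymbol\Lambda,\boldsymbol l).$$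
   Context: $sl_{r+1}$ (over $\mathbb C$) has Chevalley generators $E_i,H_i,F_i$, $i=1,\dots,r$, Cartan subalgebra $\mathfrak h$, simple roots $\alpha_1,\dots,\alpha_r\in\mathfrak h^*$, and invariant form normalized by $(\alpha_i,\alpha_i)=2$, $(\alpha_i,\alpha_{i\pm1})=-1$, $(\alpha_i,\alpha_j)=0$ if $|i-j|>1$. For $\mu\in\mathfrak h^*$, $V_\mu$ is the irreducible module with highest weight $\mu$ and fixed highest weight vector $v_\mu$. $V_{\boldsymbol\Lambda}=V_{\Lambda_1}\otimes\dots\otimes V_{\Lambda_n}$. For a module $V$, $V[\mu]$ is the weight subspace of weight $\mu$ and $\mathrm{Sing}\,V[\mu]=\{v\in V[\mu]: E_iv=0\ \forall i\}$. Master function: put $l=l_1+\dots+l_r$ and let $c:\{1,\dots,l\}\to\{1,\dots,r\}$ be the unique non-decreasing function with $\#c^{-1}(i)=l_i$. For $t=(t_1,\dots,t_l)$, $z=(z_1,\dots,z_n)$, $$\Phi(t,z,\boldsymbol\Lambda,\boldsymbol l)=\prod_{i<j}(z_i-z_j)^{(\Lambda_i,\Lambda_j)}\prod_{i=1}^l\prod_{s=1}^n(t_i-z_s)^{-(\alpha_{c(i)},\Lambda_s)}\prod_{1\le i<j\le l}(t_i-t_j)^{(\alpha_{c(i)},\alpha_{c(j)})}.$$ A point $t\in\mathbb C^l$ is a critical point of $\Phi(\,\cdot\,,z,\boldsymbol\Lambda,\boldsymbol l)$ if $$-\sum_{s=1}^n\frac{(\alpha_{c(i)},\Lambda_s)}{t_i-z_s}+\sum_{j\ne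 i}\frac{(\alpha_{c(i)},\alpha_{c(j)})}{t_i-t_j}=0,\qquad i=1,\dots,l.$$ Terms with zero numerator (and factors with zero exponent) are omitted; the other denominators are required to be non-zero, so $t_i=z_s$ is allowed only if $(\alpha_{c(i)},\Lambda_s)=0$ and $t_i=t_j$, $i\neq j$, only if $(\alpha_{c(i)},\alpha_{c(j)})=0$. $\mathrm{Hess}_t\log\Phi(t^0,\dots)=\det\big(\partial^2\log\Phi/\partial t_i\partial t_j\big)_{i,j=1}^l$ evaluated at $t^0$; a critical point is non-degenerate if this is non-zero. If $l=0$, $\mathbb C^0$ is a single point, regarded as a non-degenerate critical point with Hessian $1$. Universal weight function and Bethe vectors: let $P(\boldsymbol l,n)$ be the set of sequences $I=(i^1_1,\dots,i^1_{j_1};\dots;i^n_1,\dots,i^n_{j_n})$ in $\{1,\dots,r\}$ (with $j_s\ge 0$) in which each $i$ appears exactly $l_i$ times. For a permutation $\sigma$ of $\{1,\dots,l\}$ put $\sigma_s(i)=\sigma(j_1+\dots+j_{s-1}+i)$, $i=1,\dots,j_s$, and let $\Sigma(I)$ be the set of $\sigma$ with $c(\sigma_s(j))=i^s_j$ for all $s,j$. Put $F_Iv=F_{i^1_1}\cdots F_{i^1_{j_1}}v_{\Lambda_1}\otimes\cdots\otimes F_{i^n_1}\cdots F_{i^n_{j_n}}v_{\Lambda_n}$, $\ \omega_{a_1,\dots,a_j}(z_s)=\frac{1}{(t_{a_1}-t_{a_2})\cdots(t_{a_{j-1}}-t_{a_j})(t_{a_j}-z_s)}$ (equal to $1$ for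 $j=0$), $\omega_{I,\sigma}=\prod_{s=1}^n\omega_{\sigma_s(1),\dots,\sigma_s(j_s)}(z_s)$, and $$\omega(t,z)=\sum_{I\in P(\boldsymbol l,n)}\sum_{\sigma\in\Sigma(I)}\omega_{I,\sigma}\,F_Iv\in V_{\boldsymbol\Lambda}[\Lambda-\alpha(\boldsymbol l)].$$ As a $V_{\boldsymbol\Lambda}$-valued rational function, $\omega$ is regular at $(t,z)$ when $z$ has distinct coordinates and $t$ is a critical point (possible apparent poles cancel); its value there is the Bethe vector corresponding to $t$. It is known that it lies in $\mathrm{Sing}\,V_{\boldsymbol\Lambda}[\Lambda-\alpha(\boldsymbol l)]$. Shapovalov form: let $\tau$ be the anti-involution of $\mathfrak g$ with $E_i\mapsto F_i$, $H_i\mapsto H_i$, $F_i\mapsto E_i$. On $V_{\Lambda_s}$, $S_s$ is the unique symmetric bilinear form with $S_s(v_{\Lambda_s},v_{\Lambda_s})=1$ and $S_s(xu,v)=S_s(u,\tau(x)v)$ for $x\in\mathfrak g$. The tensor Shapovalov form is $S=S_1\otimes\dots\otimes S_n$. *)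

theory Defs
  imports
    "HOL-Analysis.Complex_Transcendental"
    "HOL-Analysis.Function_Topology"
    "HOL-Combinatorics.Permutations"
    "Jordan_Normal_Form.Determinant"
begin

section \<open>The Lie algebra \<open>sl\<^sub>r\<^sub>+\<^sub>1\<close> and its weights\<close>

definition sl :: "nat \<Rightarrow> complex mat set" where
  "sl r = {X \<in> carrier_mat (r + 1) (r + 1). (\<Sum>k<r + 1. X $$ (k, k)) = 0}"

text \<open>Generators are numbered \<open>1, \<dots>, r\<close>, whereas matrix entries are indexed from \<open>0\<close>.\<close>

definition chev_E :: "nat \<Rightarrow> nat \<Rightarrow> complex mat" where
  "chev_E r i = mat (r + 1) (r + 1) (\<lambda>(a, b). if a = i - 1 \<and> b = i then 1 else 0)"

definition chev_F :: "nat \<Rightarrow> nat \<Rightarrow> complex mat" where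
  "chev_F r i = mat (r + 1) (r + 1) (\<lambda>(a, b). if a = i \<and> b = i - 1 then 1 else 0)"

definition chev_H :: "nat \<Rightarrow> nat \<Rightarrow> complex mat" where
  "chev_H r i = chev_E r i * chev_F r i - chev_F r i * chev_E r i"

definition cartan :: "nat \<Rightarrow> complex mat set" where
  "cartan r = {X \<in> sl r. diagonal_mat X}"

text \<open>An element of \<open>\<hh>\<^sup>*\<close> is a function on matrices that is linear on the Cartan
  subalgebra; its values elsewhere are irrelevant.\<close>

type_synonym weight = "complex mat \<Rightarrow> complex"

definition cartan_dual :: "nat \<Rightarrow> weight set" where
  "cartan_dual r = {\<mu>. (\<forall>X\<in>cartan r. \<forall>Y\<in>cartan r. \<mu> (X + Y) = \<mu> X + \<mu> Y)
                      \<and> (\<forall>c. \<forall>X\<in>cartan r. \<mu> (c \<cdot>\<^sub>m X) = c * \<mu> X)}"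

definition simple_root :: "nat \<Rightarrow> weight" where
  "simple_root i X = X $$ (i - 1, i - 1) - X $$ (i, i)"

text \<open>The orthogonal projection to the Cartan subalgebra of the diagonal matrix unit
  at position \<open>k\<close>. In terms of these elements the invariant form on \<open>\<hh>\<^sup>*\<close>, i.e. the dual
  of the trace form, is a sum of products; the lemma \<open>weight_form_simple_root\<close> below shows
  that it has the required normalization.\<close>

definition proj_unit :: "nat \<Rightarrow> nat \<Rightarrow> complex mat" where
  "proj_unit r k = mat (r + 1) (r + 1)
     (\<lambda>(a, b). if a = b then (if a = k then 1 else 0) - 1 / of_nat (r + 1) else 0)"

definition weight_form :: "nat \<Rightarrow> weight \<Rightarrow> weight \<Rightarrow> complex" where
  "weight_form r \<mu> \<nu> = (\<Sum>k<r + 1. \<mu> (proj_unit r k) * \<nu> (proj_unit r k))"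

definition integral_dominant :: "nat \<Rightarrow> weight \<Rightarrow> bool" where
  "integral_dominant r \<mu> \<longleftrightarrow> \<mu> \<in> cartan_dual r \<and> (\<forall>i\<in>{1..r}. \<mu> (chev_H r i) \<in> \<nat>)"

lemma weight_form_simple_root:
  assumes "i \<in> {1..r}" "j \<in> {1..r}"
  shows "weight_form r (simple_root i) (simple_root j) =
    (if i = j then 2 else if i = j + 1 \<or> j = i + 1 then - 1 else 0)"
proof -
  have s: "simple_root m (proj_unit r k) = (if k = m - 1 then 1 else 0) - (if k = m then 1 else 0)"
    if "m \<in> {1..r}" for m k
    using that by (auto simp: simple_root_def proj_unit_def)
  have "weight_form r (simple_root i) (simple_root j) =
     (\<Sum>k<r + 1. (if k = i - 1 then (if i - 1 = j - 1 then 1 else 0) - (if i - 1 = j then 1 else 0) else 0)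
       - (if k = i then (if i = j - 1 then 1 else 0) - (if i = j then 1 else 0) else 0))"
    unfolding weight_form_def s[OF assms(1)] s[OF assms(2)]
    by (intro sum.cong refl) auto
  also have "\<dots> = (if i = j then 2 else if i = j + 1 \<or> j = i + 1 then - 1 else 0)"
    unfolding sum_subtractf by (subst (1 2) sum.delta) (use assms in auto)
  finally show ?thesis .
qed

lemma chev_H_eq:
  assumes "i \<in> {1..r}"
  shows "chev_H r i = mat (r + 1) (r + 1)
    (\<lambda>(a, b). if a = b then (if a = i - 1 then 1 else 0) - (if a = i then 1 else 0) else 0)"
proof (rule eq_matI)
  fix a b assume "a < dim_row (mat (r + 1) (r + 1)
    (\<lambda>(a, b). if a = b then (if a = i - 1 then 1 else 0) - (if a = i then 1 else 0 :: complex) else 0))"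
    "b < dim_col (mat (r + 1) (r + 1)
    (\<lambda>(a, b). if a = b then (if a = i - 1 then 1 else 0) - (if a = i then 1 else 0 :: complex) else 0))"
  then have ab: "a < r + 1" "b < r + 1" by auto
  have c: "dim_row (chev_E r i) = r + 1" "dim_col (chev_E r i) = r + 1"
    "dim_row (chev_F r i) = r + 1" "dim_col (chev_F r i) = r + 1"
    by (simp_all add: chev_E_def chev_F_def)
  have 1: "(chev_E r i * chev_F r i) $$ (a, b) =
      (\<Sum>k\<in>{0..<r + 1}. if k = i then (if a = i - 1 \<and> b = i - 1 then 1 else 0) else 0)"
  proof -
    have "(chev_E r i * chev_F r i) $$ (a, b) =
        (\<Sum>k\<in>{0..<r + 1}. chev_E r i $$ (a, k) * chev_F r i $$ (k, b))"
      using ab c by (subst index_mult_mat(1)) (auto simp: scalar_prod_def intro!: sum.cong)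
    also have "\<dots> = (\<Sum>k\<in>{0..<r + 1}. if k = i then (if a = i - 1 \<and> b = i - 1 then 1 else 0) else 0)"
      using ab assms by (intro sum.cong refl) (auto simp: chev_E_def chev_F_def)
    finally show ?thesis .
  qed
  have 2: "(chev_F r i * chev_E r i) $$ (a, b) =
      (\<Sum>k\<in>{0..<r + 1}. if k = i - 1 then (if a = i \<and> b = i then 1 else 0) else 0)"
  proof -
    have "(chev_F r i * chev_E r i) $$ (a, b) =
        (\<Sum>k\<in>{0..<r + 1}. chev_F r i $$ (a, k) * chev_E r i $$ (k, b))"
      using ab c by (subst index_mult_mat(1)) (auto simp: scalar_prod_def intro!: sum.cong)
    also have "\<dots> = (\<Sum>k\<in>{0..<r + 1}. if k = i - 1 then (if a = i \<and> b = i then 1 else 0) else 0)"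
      using ab assms by (intro sum.cong refl) (auto simp: chev_E_def chev_F_def)
    finally show ?thesis .
  qed
  have d: "dim_row (chev_F r i * chev_E r i) = r + 1" "dim_col (chev_F r i * chev_E r i) = r + 1"
    by (simp_all add: chev_E_def chev_F_def)
  show "chev_H r i $$ (a, b) = mat (r + 1) (r + 1)
    (\<lambda>(a, b). if a = b then (if a = i - 1 then 1 else 0) - (if a = i then 1 else 0 :: complex) else 0) $$ (a, b)"
    unfolding chev_H_def using ab d assms
    by (subst index_minus_mat(1)) (auto simp: 1 2 simp del: sum.op_ivl_Suc index_mult_mat)
qed (auto simp: chev_H_def chev_E_def chev_F_def)

text \<open>The pairing \<open>(\<alpha>\<^sub>i, \<mu>)\<close> agrees with \<open>\<mu>(H\<^sub>i)\<close>.\<close>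

lemma weight_form_simple_root_left:
  assumes "i \<in> {1..r}" "\<mu> \<in> cartan_dual r"
  shows "weight_form r (simple_root i) \<mu> = \<mu> (chev_H r i)"
proof -
  have s: "simple_root i (proj_unit r k) = (if k = i - 1 then 1 else 0) - (if k = i then 1 else 0)" for k
    using assms(1) by (auto simp: simple_root_def proj_unit_def)
  have "weight_form r (simple_root i) \<mu> =
      (\<Sum>k<r + 1. (if k = i - 1 then \<mu> (proj_unit r k) else 0) - (if k = i then \<mu> (proj_unit r k) else 0))"
    unfolding weight_form_def s by (intro sum.cong refl) auto
  also have "\<dots> = \<mu> (proj_unit r (i - 1)) - \<mu> (proj_unit r i)"
    using assms(1) by (simp add: sum_subtractf del: sum.lessThan_Suc) auto
  finally have 1: "weight_form r (simple_root i) \<mu> = \<mu> (proj_unit r (i - 1)) - \<mu> (proj_unit r i)" .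
  have C: "proj_unit r k \<in> cartan r" if "k \<le> r" for k
  proof -
    have "(\<Sum>a<r + 1. (if a = k then 1 else 0) - 1 / of_nat (r + 1)) = (0 :: complex)"
      using that by (simp add: sum_subtractf del: sum.lessThan_Suc of_nat_Suc)
    moreover have "(\<Sum>a<r + 1. proj_unit r k $$ (a, a)) =
        (\<Sum>a<r + 1. (if a = k then 1 else 0) - 1 / of_nat (r + 1))"
      by (intro sum.cong refl) (simp add: proj_unit_def)
    ultimately show ?thesis
      by (auto simp: cartan_def sl_def proj_unit_def diagonal_mat_def)
  qed
  have H: "chev_H r i = proj_unit r (i - 1) + (- 1) \<cdot>\<^sub>m proj_unit r i"
    unfolding chev_H_eq[OF assms(1)] by (rule eq_matI) (auto simp: proj_unit_def)
  have C': "(- 1) \<cdot>\<^sub>m proj_unit r i \<in> cartan r"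
    using C[of i] assms(1)
    by (auto simp: cartan_def sl_def diagonal_mat_def sum_negf eq_neg_iff_add_eq_0
        simp del: sum.lessThan_Suc)
  show ?thesis
    using assms C[of i] C[of "i - 1"] C' unfolding 1 H cartan_dual_def by auto
qed

text \<open>The anti-involution \<open>\<tau>\<close> is transposition.\<close>

definition tau :: "complex mat \<Rightarrow> complex mat" where
  "tau X = transpose_mat X"

lemma tau_chev:
  "tau (chev_E r i) = chev_F r i"
  "tau (chev_F r i) = chev_E r i"
  "tau (chev_H r i) = chev_H r i"
proof -
  show E: "tau (chev_E r i) = chev_F r i" and F: "tau (chev_F r i) = chev_E r i"
    by (auto simp: tau_def chev_E_def chev_F_def intro!: eq_matI)
  have c: "chev_E r i \<in> carrier_mat (r + 1) (r + 1)" "chev_F r i \<in> carrier_mat (r + 1) (r + 1)"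
    by (auto simp: chev_E_def chev_F_def)
  show "tau (chev_H r i) = chev_H r i"
    using E F c unfolding chev_H_def tau_def
    by (subst transpose_minus) (auto simp: transpose_mult[OF c] transpose_mult[OF c(2,1)])
qed

lemma tau_bracket:
  assumes "X \<in> sl r" "Y \<in> sl r"
  shows "tau (X * Y - Y * X) = tau Y * tau X - tau X * tau Y"
proof -
  have c: "X \<in> carrier_mat (r + 1) (r + 1)" "Y \<in> carrier_mat (r + 1) (r + 1)"
    using assms by (auto simp: sl_def)
  show ?thesis
    unfolding tau_def
    by (subst transpose_minus) (use c in \<open>auto simp: transpose_mult[OF c] transpose_mult[OF c(2,1)]\<close>)
qed


section \<open>Highest weight modules and Shapovalov forms\<close>

text \<open>Modules are carried by subspaces \<open>V\<close> of an ambient vector space, so that several modules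
  of different dimensions can share one type.\<close>

locale sl_module = vector_space scaleV
  for scaleV :: "complex \<Rightarrow> 'v::ab_group_add \<Rightarrow> 'v" +
  fixes r :: nat and V :: "'v set" and act :: "complex mat \<Rightarrow> 'v \<Rightarrow> 'v"
  assumes subspace_V: "subspace V"
    and act_closed: "\<lbrakk>X \<in> sl r; u \<in> V\<rbrakk> \<Longrightarrow> act X u \<in> V"
    and act_add: "\<lbrakk>X \<in> sl r; u \<in> V; w \<in> V\<rbrakk> \<Longrightarrow> act X (u + w) = act X u + act X w"
    and act_scale: "\<lbrakk>X \<in> sl r; u \<in> V\<rbrakk> \<Longrightarrow> act X (scaleV a u) = scaleV a (act X u)"
    and add_act: "\<lbrakk>X \<in> sl r; Y \<in> sl r; u \<in> V\<rbrakk> \<Longrightarrow> act (X + Y) u = act X u + act Y u"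
    and smult_act: "\<lbrakk>X \<in> sl r; u \<in> V\<rbrakk> \<Longrightarrow> act (a \<cdot>\<^sub>m X) u = scaleV a (act X u)"
    and bracket_act: "\<lbrakk>X \<in> sl r; Y \<in> sl r; u \<in> V\<rbrakk> \<Longrightarrow>
      act (X * Y - Y * X) u = act X (act Y u) - act Y (act X u)"

locale irreducible_hw_module = sl_module scaleV r V act
  for scaleV :: "complex \<Rightarrow> 'v::ab_group_add \<Rightarrow> 'v" and r V act +
  fixes \<mu> :: weight and v :: 'v
  assumes irreducible: "\<lbrakk>subspace U; U \<subseteq> V; \<And>X u. \<lbrakk>X \<in> sl r; u \<in> U\<rbrakk> \<Longrightarrow> act X u \<in> U\<rbrakk>
      \<Longrightarrow> U = {0} \<or> U = V"
    and hw_vector: "v \<in> V" "v \<noteq> 0"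
    and E_hw_vector: "i \<in> {1..r} \<Longrightarrow> act (chev_E r i) v = 0"
    and H_hw_vector: "X \<in> cartan r \<Longrightarrow> act X v = scaleV (\<mu> X) v"

definition bilinear_form_on ::
    "(complex \<Rightarrow> 'v::ab_group_add \<Rightarrow> 'v) \<Rightarrow> 'v set \<Rightarrow> ('v \<Rightarrow> 'v \<Rightarrow> complex) \<Rightarrow> bool" where
  "bilinear_form_on scaleV V B \<longleftrightarrow>
     (\<forall>x\<in>V. \<forall>y\<in>V. \<forall>u\<in>V. B (x + y) u = B x u + B y u \<and> B u (x + y) = B u x + B u y) \<and>
     (\<forall>a. \<forall>x\<in>V. \<forall>u\<in>V. B (scaleV a x) u = a * B x u \<and> B u (scaleV a x) = a * B u x)"

definition shapovalov_form ::
    "(complex \<Rightarrow> 'v::ab_group_add \<Rightarrow> 'v) \<Rightarrow> nat \<Rightarrow> 'v set \<Rightarrow> (complex mat \<Rightarrow> 'v \<Rightarrow> 'v) \<Rightarrow> 'v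
      \<Rightarrow> ('v \<Rightarrow> 'v \<Rightarrow> complex) \<Rightarrow> bool" where
  "shapovalov_form scaleV r V act v B \<longleftrightarrow>
     bilinear_form_on scaleV V B \<and> (\<forall>x\<in>V. \<forall>y\<in>V. B x y = B y x) \<and> B v v = 1 \<and>
     (\<forall>X\<in>sl r. \<forall>x\<in>V. \<forall>y\<in>V. B (act X x) y = B x (act (tau X) y))"


section \<open>Tensor products\<close>

text \<open>The elements of \<open>V\<^sub>1 \<times> \<dots> \<times> V\<^sub>n\<close> are the functions in \<open>PiE {1..n} V\<close>.\<close>

definition multilinear_on ::
    "(complex \<Rightarrow> 'v::ab_group_add \<Rightarrow> 'v) \<Rightarrow> (complex \<Rightarrow> 'w::ab_group_add \<Rightarrow> 'w) \<Rightarrow> nat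
      \<Rightarrow> (nat \<Rightarrow> 'v set) \<Rightarrow> ((nat \<Rightarrow> 'v) \<Rightarrow> 'w) \<Rightarrow> bool" where
  "multilinear_on scaleV scaleW n V f \<longleftrightarrow>
     (\<forall>u\<in>PiE {1..n} V. \<forall>s\<in>{1..n}.
        (\<forall>x\<in>V s. \<forall>y\<in>V s. f (u(s := x + y)) = f (u(s := x)) + f (u(s := y))) \<and>
        (\<forall>a. \<forall>x\<in>V s. f (u(s := scaleV a x)) = scaleW a (f (u(s := x)))))"

text \<open>\<open>W\<close> with the map \<open>T\<close> is a tensor product of \<open>V 1, \<dots>, V n\<close>. The universal property can only
  be required for targets of a given type; the target \<open>\<complex>\<close> suffices, since linear
  functionals separate points: see \<open>tensor_product_universal\<close> below.\<close>

definition is_tensor_product ::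
    "(complex \<Rightarrow> 'v::ab_group_add \<Rightarrow> 'v) \<Rightarrow> (complex \<Rightarrow> 'w::ab_group_add \<Rightarrow> 'w) \<Rightarrow> nat
      \<Rightarrow> (nat \<Rightarrow> 'v set) \<Rightarrow> 'w set \<Rightarrow> ((nat \<Rightarrow> 'v) \<Rightarrow> 'w) \<Rightarrow> bool" where
  "is_tensor_product scaleV scaleW n V W T \<longleftrightarrow>
     vector_space scaleV \<and> (\<forall>s\<in>{1..n}. module.subspace scaleV (V s)) \<and>
     vector_space scaleW \<and> multilinear_on scaleV scaleW n V T \<and>
     module.span scaleW (T ` PiE {1..n} V) = W \<and>
     (\<forall>\<beta>. multilinear_on scaleV (*) n V \<beta> \<longrightarrow>
        (\<exists>\<phi>. Vector_Spaces.linear scaleW (*) \<phi> \<and> (\<forall>u\<in>PiE {1..n} V. \<phi> (T u) = \<beta> u)))"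

lemma tensor_product_universal:
  fixes scaleU :: "complex \<Rightarrow> 'u::ab_group_add \<Rightarrow> 'u"
  assumes "is_tensor_product scaleV scaleW n V W T"
    and "vector_space scaleU" and f: "multilinear_on scaleV scaleU n V f"
  shows "\<exists>g. Vector_Spaces.linear scaleW scaleU g \<and> (\<forall>u\<in>PiE {1..n} V. g (T u) = f u)"
proof -
  let ?P = "T ` PiE {1..n} V"
  interpret w: vector_space scaleW using assms(1) by (simp add: is_tensor_product_def)
  interpret u: vector_space scaleU by fact
  interpret wu: vector_space_pair scaleW scaleU ..
  interpret c: vector_space "(*) :: complex \<Rightarrow> complex \<Rightarrow> complex"
    by unfold_locales (auto simp: algebra_simps)
  interpret uc: vector_space_pair scaleU "(*) :: complex \<Rightarrow> complex \<Rightarrow> complex" ..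
  interpret wc: vector_space_pair scaleW "(*) :: complex \<Rightarrow> complex \<Rightarrow> complex" ..
  obtain Bs where Bs: "Bs \<subseteq> ?P" "w.independent Bs" "?P \<subseteq> w.span Bs"
    using w.maximal_independent_subset[of ?P] by auto
  define pick where "pick b = (SOME x. x \<in> PiE {1..n} V \<and> T x = b)" for b
  have pick: "pick b \<in> PiE {1..n} V" "T (pick b) = b" if "b \<in> Bs" for b
    using someI_ex[of "\<lambda>x. x \<in> PiE {1..n} V \<and> T x = b"] that Bs(1) unfolding pick_def by auto
  obtain g where g: "Vector_Spaces.linear scaleW scaleU g" "\<And>b. b \<in> Bs \<Longrightarrow> g b = f (pick b)"
    using wu.linear_independent_extend[OF Bs(2), of "\<lambda>b. f (pick b)"] by auto
  have "g (T x) = f x" if x: "x \<in> PiE {1..n} V" for x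
  proof (rule ccontr)
    define d where "d = g (T x) - f x"
    assume "g (T x) \<noteq> f x"
    then have "u.independent {d}" by (simp add: d_def)
    then obtain \<psi> where \<psi>: "Vector_Spaces.linear scaleU (*) \<psi>" "\<psi> d = (1 :: complex)"
      using uc.linear_independent_extend[of "{d}" "\<lambda>_. 1"] by auto
    interpret \<psi>: Vector_Spaces.linear scaleU "(*)" \<psi> by fact
    have "multilinear_on scaleV (*) n V (\<lambda>y. \<psi> (f y))"
      using f unfolding multilinear_on_def by (auto simp: \<psi>.add \<psi>.scale)
    then obtain \<phi> where \<phi>: "Vector_Spaces.linear scaleW (*) \<phi>" "\<forall>y\<in>PiE {1..n} V. \<phi> (T y) = \<psi> (f y)"
      using assms(1) unfolding is_tensor_product_def by blast
    have "Vector_Spaces.linear scaleW (*) (\<lambda>y. \<psi> (g y))"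
      using Vector_Spaces.linear_compose[OF g(1) \<psi>(1)] by (simp add: o_def)
    from wc.linear_eq_on[OF this \<phi>(1), of "T x" Bs] have "\<psi> (g (T x)) = \<phi> (T x)"
      using x Bs(3) g(2) \<phi>(2) pick by (metis imageI subsetD)
    then have "\<psi> d = 0" using \<phi>(2) x by (simp add: d_def \<psi>.diff)
    then show False using \<psi>(2) by simp
  qed
  then show ?thesis using g(1) by blast
qed

definition tensor_form ::
    "(complex \<Rightarrow> 'w::ab_group_add \<Rightarrow> 'w) \<Rightarrow> nat \<Rightarrow> (nat \<Rightarrow> 'v set) \<Rightarrow> 'w set
      \<Rightarrow> ((nat \<Rightarrow> 'v) \<Rightarrow> 'w) \<Rightarrow> (nat \<Rightarrow> 'v \<Rightarrow> 'v \<Rightarrow> complex) \<Rightarrow> ('w \<Rightarrow> 'w \<Rightarrow> complex) \<Rightarrow> bool" where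
  "tensor_form scaleW n V W T B S \<longleftrightarrow>
     bilinear_form_on scaleW W S \<and>
     (\<forall>x\<in>PiE {1..n} V. \<forall>y\<in>PiE {1..n} V. S (T x) (T y) = (\<Prod>s\<in>{1..n}. B s (x s) (y s)))"


section \<open>The master function\<close>

text \<open>Throughout, \<open>l\<close> gives the multiplicities \<open>l 1, \<dots>, l r\<close>, and only the values of \<open>t\<close> at
  \<open>1, \<dots>, total_mult r l\<close> and of \<open>z\<close> at \<open>1, \<dots>, n\<close> matter.\<close>

definition total_mult :: "nat \<Rightarrow> (nat \<Rightarrow> nat) \<Rightarrow> nat" where
  "total_mult r l = (\<Sum>i\<in>{1..r}. l i)"

definition color :: "(nat \<Rightarrow> nat) \<Rightarrow> nat \<Rightarrow> nat" where
  "color l a = (LEAST i. a \<le> (\<Sum>j\<in>{1..i}. l j))"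

text \<open>\<open>color l\<close> is the required function: non-decreasing with fibres of sizes \<open>l i\<close>.\<close>

lemma color_le_iff: "color l a \<le> i \<longleftrightarrow> a \<le> (\<Sum>j\<in>{1..i}. l j)" if "a \<in> {1..total_mult r l}" for a i
proof
  have m: "(\<Sum>j\<in>{1..i}. l j) \<le> (\<Sum>j\<in>{1..k}. l j)" if "i \<le> k" for i k
    using that by (intro sum_mono2) auto
  assume "color l a \<le> i"
  moreover have "a \<le> (\<Sum>j\<in>{1..color l a}. l j)"
    unfolding color_def by (rule LeastI[of _ r]) (use that in \<open>simp add: total_mult_def\<close>)
  ultimately show "a \<le> (\<Sum>j\<in>{1..i}. l j)" using m by (meson le_trans)
next
  assume "a \<le> (\<Sum>j\<in>{1..i}. l j)"
  then show "color l a \<le> i" unfolding color_def by (rule Least_le)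
qed

lemma color_mono_on: "mono_on {1..total_mult r l} (color l)"
proof (rule mono_onI)
  fix a b assume ab: "a \<in> {1..total_mult r l}" "b \<in> {1..total_mult r l}" "a \<le> b"
  then have "b \<le> (\<Sum>j\<in>{1..color l b}. l j)" using color_le_iff by blast
  then show "color l a \<le> color l b" using color_le_iff[OF ab(1)] ab(3) by auto
qed

lemma color_in: "a \<in> {1..total_mult r l} \<Longrightarrow> color l a \<in> {1..r}"
  using color_le_iff[of a r l r] color_le_iff[of a r l 0] by (auto simp: total_mult_def)

lemma card_color_fibre:
  assumes "i \<in> {1..r}"
  shows "card {a \<in> {1..total_mult r l}. color l a = i} = l i"
proof -
  have le: "(\<Sum>j\<in>{1..i}. l j) \<le> total_mult r l"
    unfolding total_mult_def using assms by (intro sum_mono2) auto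
  have eq: "color l a = i \<longleftrightarrow> a \<le> (\<Sum>j\<in>{1..i}. l j) \<and> \<not> a \<le> (\<Sum>j\<in>{1..i - 1}. l j)"
    if "a \<in> {1..total_mult r l}" for a
  proof -
    have "color l a = i \<longleftrightarrow> color l a \<le> i \<and> \<not> color l a \<le> i - 1"
      using assms unfolding atLeastAtMost_iff by linarith
    then show ?thesis using color_le_iff[OF that] by simp
  qed
  have "{a \<in> {1..total_mult r l}. color l a = i} = {(\<Sum>j\<in>{1..i - 1}. l j)<..(\<Sum>j\<in>{1..i}. l j)}"
    (is "?L = ?R")
  proof (intro equalityI subsetI)
    fix a assume "a \<in> ?L" then show "a \<in> ?R" using eq[of a] by simp
  next
    fix a assume "a \<in> ?R"
    then have "a \<in> {1..total_mult r l}" "a \<le> (\<Sum>j\<in>{1..i}. l j)" "\<not> a \<le> (\<Sum>j\<in>{1..i - 1}. l j)"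
      using le by auto
    then show "a \<in> ?L" using eq[of a] by blast
  qed
  moreover have "(\<Sum>j\<in>{1..i}. l j) = (\<Sum>j\<in>{1..i - 1}. l j) + l i"
    using assms by (cases i) auto
  ultimately show ?thesis by simp
qed

abbreviation root_of :: "(nat \<Rightarrow> nat) \<Rightarrow> nat \<Rightarrow> weight" where
  "root_of l a \<equiv> simple_root (color l a)"

text \<open>Factors with exponent zero are omitted (note \<open>0 powr 0 = 0\<close>). For integral weights all
  exponents of factors involving \<open>t\<close> are integers, so the branch chosen by \<open>powr\<close> matters only
  for the factor that is constant in \<open>t\<close>.\<close>

definition factor_pow :: "complex \<Rightarrow> complex \<Rightarrow> complex" where
  "factor_pow x a = (if a = 0 then 1 else x powr a)"

definition master ::
    "nat \<Rightarrow> nat \<Rightarrow> (nat \<Rightarrow> weight) \<Rightarrow> (nat \<Rightarrow> nat) \<Rightarrow> (nat \<Rightarrow> complex) \<Rightarrow> (nat \<Rightarrow> complex) \<Rightarrow> complex" where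
  "master r n \<Lambda> l z t =
     (\<Prod>(i, j)\<in>{(i, j). 1 \<le> i \<and> i < j \<and> j \<le> n}. factor_pow (z i - z j) (weight_form r (\<Lambda> i) (\<Lambda> j))) *
     (\<Prod>i\<in>{1..total_mult r l}. \<Prod>s\<in>{1..n}.
        factor_pow (t i - z s) (- weight_form r (root_of l i) (\<Lambda> s))) *
     (\<Prod>(i, j)\<in>{(i, j). 1 \<le> i \<and> i < j \<and> j \<le> total_mult r l}.
        factor_pow (t i - t j) (weight_form r (root_of l i) (root_of l j)))"

text \<open>Terms with zero numerator vanish also when the denominator is zero, because \<open>0 / 0 = 0\<close>.\<close>

definition critical_point ::
    "nat \<Rightarrow> nat \<Rightarrow> (nat \<Rightarrow> weight) \<Rightarrow> (nat \<Rightarrow> nat) \<Rightarrow> (nat \<Rightarrow> complex) \<Rightarrow> (nat \<Rightarrow> complex) \<Rightarrow> bool" where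
  "critical_point r n \<Lambda> l z t \<longleftrightarrow> (\<forall>i\<in>{1..total_mult r l}.
     (\<forall>s\<in>{1..n}. weight_form r (root_of l i) (\<Lambda> s) \<noteq> 0 \<longrightarrow> t i \<noteq> z s) \<and>
     (\<forall>j\<in>{1..total_mult r l} - {i}. weight_form r (root_of l i) (root_of l j) \<noteq> 0 \<longrightarrow> t i \<noteq> t j) \<and>
     - (\<Sum>s\<in>{1..n}. weight_form r (root_of l i) (\<Lambda> s) / (t i - z s))
     + (\<Sum>j\<in>{1..total_mult r l} - {i}. weight_form r (root_of l i) (root_of l j) / (t i - t j)) = 0)"

definition partial_deriv :: "nat \<Rightarrow> ((nat \<Rightarrow> complex) \<Rightarrow> complex) \<Rightarrow> (nat \<Rightarrow> complex) \<Rightarrow> complex" where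
  "partial_deriv i f t = deriv (\<lambda>x. f (t(i := x))) (t i)"

text \<open>The derivatives of the multivalued function \<open>log \<Phi>\<close> are those of its single-valued
  logarithmic derivatives \<open>(\<partial>\<Phi>/\<partial>t\<^sub>j) / \<Phi>\<close>.\<close>

definition hess_log ::
    "((nat \<Rightarrow> complex) \<Rightarrow> complex) \<Rightarrow> nat \<Rightarrow> (nat \<Rightarrow> complex) \<Rightarrow> complex" where
  "hess_log \<Phi> m t = Determinant.det (mat m m (\<lambda>(i, j).
     partial_deriv (Suc i) (\<lambda>t'. partial_deriv (Suc j) \<Phi> t' / \<Phi> t') t))"

definition nondegenerate_critical_point ::
    "nat \<Rightarrow> nat \<Rightarrow> (nat \<Rightarrow> weight) \<Rightarrow> (nat \<Rightarrow> nat) \<Rightarrow> (nat \<Rightarrow> complex) \<Rightarrow> (nat \<Rightarrow> complex) \<Rightarrow> bool" where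
  "nondegenerate_critical_point r n \<Lambda> l z t \<longleftrightarrow>
     critical_point r n \<Lambda> l z t \<and> hess_log (master r n \<Lambda> l z) (total_mult r l) t \<noteq> 0"


section \<open>The universal weight function and Bethe vectors\<close>

definition word_seqs :: "nat \<Rightarrow> nat \<Rightarrow> (nat \<Rightarrow> nat) \<Rightarrow> (nat \<Rightarrow> nat list) set" where
  "word_seqs r n l = {I \<in> PiE {1..n} (\<lambda>_. lists {1..r}).
     \<forall>i\<in>{1..r}. (\<Sum>s\<in>{1..n}. count_list (I s) i) = l i}"

lemma finite_word_seqs: "finite (word_seqs r n l)"
proof (rule finite_subset)
  let ?A = "{xs. set xs \<subseteq> {1..r} \<and> length xs \<le> total_mult r l}"
  show "finite (PiE {1..n} (\<lambda>_. ?A))"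
    by (intro finite_PiE finite_lists_length_le) auto
  have "length (I s) \<le> total_mult r l" if I: "I \<in> word_seqs r n l" and s: "s \<in> {1..n}" for I s
  proof -
    have "set (I s) \<subseteq> {1..r}" using I s by (auto simp: word_seqs_def PiE_iff lists_eq_set)
    then have "length (I s) = (\<Sum>i\<in>{1..r}. count_list (I s) i)"
      by (simp add: sum_count_set)
    also have "\<dots> \<le> (\<Sum>i\<in>{1..r}. \<Sum>s\<in>{1..n}. count_list (I s) i)"
      using s by (intro sum_mono member_le_sum) auto
    also have "\<dots> = total_mult r l" using I by (simp add: total_mult_def word_seqs_def)
    finally show ?thesis .
  qed
  moreover have "s \<in> {1..n} \<Longrightarrow> set (I s) \<subseteq> {1..r}" "I \<in> extensional {1..n}"
    if "I \<in> word_seqs r n l" for I s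
    using that by (auto simp: word_seqs_def PiE_iff lists_eq_set)
  ultimately have "I \<in> PiE {1..n} (\<lambda>_. ?A)" if "I \<in> word_seqs r n l" for I
    using that unfolding PiE_iff by blast
  then show "word_seqs r n l \<subseteq> PiE {1..n} (\<lambda>_. ?A)" by blast
qed

text \<open>The word \<open>\<sigma>\<^sub>s(1), \<dots>, \<sigma>\<^sub>s(j\<^sub>s)\<close>.\<close>

definition labels :: "(nat \<Rightarrow> nat list) \<Rightarrow> (nat \<Rightarrow> nat) \<Rightarrow> nat \<Rightarrow> nat list" where
  "labels I \<sigma> s = map (\<lambda>j. \<sigma> ((\<Sum>u\<in>{1..<s}. length (I u)) + j)) [1..<length (I s) + 1]"

definition labelings :: "nat \<Rightarrow> nat \<Rightarrow> (nat \<Rightarrow> nat) \<Rightarrow> (nat \<Rightarrow> nat list) \<Rightarrow> (nat \<Rightarrow> nat) set" where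
  "labelings r n l I = {\<sigma>. \<sigma> permutes {1..total_mult r l} \<and>
     (\<forall>s\<in>{1..n}. map (color l) (labels I \<sigma> s) = I s)}"

fun omega_word :: "(nat \<Rightarrow> complex) \<Rightarrow> complex \<Rightarrow> nat list \<Rightarrow> complex" where
  "omega_word t w [] = 1"
| "omega_word t w [a] = 1 / (t a - w)"
| "omega_word t w (a # b # as) = 1 / (t a - t b) * omega_word t w (b # as)"

definition F_vector ::
    "nat \<Rightarrow> nat \<Rightarrow> (nat \<Rightarrow> complex mat \<Rightarrow> 'v \<Rightarrow> 'v) \<Rightarrow> (nat \<Rightarrow> 'v) \<Rightarrow> ((nat \<Rightarrow> 'v) \<Rightarrow> 'w)
      \<Rightarrow> (nat \<Rightarrow> nat list) \<Rightarrow> 'w" where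
  "F_vector r n act v T I =
     T (\<lambda>s\<in>{1..n}. foldr (\<lambda>i. act s (chev_F r i)) (I s) (v s))"

text \<open>Meaningful for \<open>t\<close> in \<open>generic_points\<close>, where no denominator vanishes.\<close>

definition weight_function ::
    "(complex \<Rightarrow> 'w::ab_group_add \<Rightarrow> 'w) \<Rightarrow> nat \<Rightarrow> nat \<Rightarrow> (nat \<Rightarrow> complex mat \<Rightarrow> 'v \<Rightarrow> 'v) \<Rightarrow> (nat \<Rightarrow> 'v)
      \<Rightarrow> ((nat \<Rightarrow> 'v) \<Rightarrow> 'w) \<Rightarrow> (nat \<Rightarrow> nat) \<Rightarrow> (nat \<Rightarrow> complex) \<Rightarrow> (nat \<Rightarrow> complex) \<Rightarrow> 'w" where
  "weight_function scaleW r n act v T l z t =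
     (\<Sum>I\<in>word_seqs r n l. \<Sum>\<sigma>\<in>labelings r n l I.
        scaleW (\<Prod>s\<in>{1..n}. omega_word t (z s) (labels I \<sigma> s)) (F_vector r n act v T I))"

definition generic_points :: "nat \<Rightarrow> nat \<Rightarrow> (nat \<Rightarrow> complex) \<Rightarrow> (nat \<Rightarrow> complex) set" where
  "generic_points m n z = {t. inj_on t {1..m} \<and> (\<forall>a\<in>{1..m}. \<forall>s\<in>{1..n}. t a \<noteq> z s)}"

text \<open>The value at \<open>t\<^sub>0\<close> of the rational function \<open>t \<mapsto> \<omega>(t, z)\<close>, after cancellation of apparent
  poles: the limit along the dense set of generic points, taken weakly, i.e. after
  application of every linear functional. (The product topology is used on points \<open>t\<close>.)\<close>

definition bethe_vector ::
    "(complex \<Rightarrow> 'w::ab_group_add \<Rightarrow> 'w) \<Rightarrow> 'w set \<Rightarrow> nat \<Rightarrow> nat \<Rightarrow> (nat \<Rightarrow> complex mat \<Rightarrow> 'v \<Rightarrow> 'v)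
      \<Rightarrow> (nat \<Rightarrow> 'v) \<Rightarrow> ((nat \<Rightarrow> 'v) \<Rightarrow> 'w) \<Rightarrow> (nat \<Rightarrow> nat) \<Rightarrow> (nat \<Rightarrow> complex) \<Rightarrow> (nat \<Rightarrow> complex) \<Rightarrow> 'w" where
  "bethe_vector scaleW W r n act v T l z t0 = (THE w. w \<in> W \<and>
     (\<forall>\<phi>. Vector_Spaces.linear scaleW (*) \<phi> \<longrightarrow>
        ((\<lambda>t. \<phi> (weight_function scaleW r n act v T l z t)) \<longlongrightarrow> \<phi> w)
          (at t0 within generic_points (total_mult r l) n z)))"

end

theory Submission
  imports Defs "HOL-Combinatorics.Multiset_Permutations"
begin

text \<open>
  Write \<open>G\<^sub>b(t)\<close> for the product, over the labels \<open>i\<close> of a tuple \<open>b\<close> of words, of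
  \<open>(\<alpha>\<^bsub>c(i)\<^esub>, \<Lambda>\<^sub>s)/(t\<^sub>i - z\<^sub>s) - \<Sum> (\<alpha>\<^bsub>c(i)\<^esub>, \<alpha>\<^bsub>c(q)\<^esub>)/(t\<^sub>i - t\<^sub>q)\<close>, where \<open>s\<close> is the slot of \<open>i\<close> and
  \<open>q\<close> runs over the labels after \<open>i\<close> in the same word. Moving the operators \<open>F\<^sub>j\<close> of a word
  \<open>F\<^sub>J v\<close> to the other side of the Shapovalov form and summing over the positions at which a new
  label can be inserted, one gets \<open>S(\<omega>(t), F\<^sub>J v) = \<Sum> G\<^sub>b(t)\<close> over the tuples \<open>b\<close> of colour \<open>J\<close>. There
  are no poles at a critical point here, which yields the existence of the Bethe vector.
  Hence \<open>S(\<omega>(t), \<omega>(u)) = \<Sum>\<^sub>\<pi> \<Sum>\<^sub>b \<omega>\<^sub>b(u \<circ> \<pi>) G\<^sub>b(t)\<close>, where \<open>\<pi>\<close> runs over the permutations of the labels that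
  preserve colours. Expanding \<open>G\<^sub>b\<close> into a sum over maps \<open>p\<close> from the labels to labels and slots, the sum over
  \<open>b\<close> is \<open>\<Prod> 1/(u\<^sub>i - u\<^bsub>p(i)\<^esub>)\<close> if \<open>p\<close> is a forest and zero otherwise, so by the matrix-tree theorem the inner
  sum is the determinant of a weighted Laplacian \<open>N(t, u \<circ> \<pi>)\<close>. At \<open>u = t = t\<^sup>0\<close> the term \<open>\<pi> = id\<close> is the Hessian;
  for \<open>\<pi> \<noteq> id\<close> the vector \<open>t\<^sup>0 - t\<^sup>0 \<circ> \<pi>\<close> is a nonzero element of the kernel, as both
  \<open>t\<^sup>0\<close> and \<open>t\<^sup>0 \<circ> \<pi>\<close> are critical points, so the determinant vanishes.
\<close>

section \<open>Inserting a label into a word\<close>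

text \<open>A critical point need not be generic: t_i = z_s and t_i = t_j may occur where the
  numerator is zero, and there single terms of the weight function have poles. So the identities are
  proved at generic points, and both sides are put in a form in which every denominator carries a
  numerator (\<alpha>, \<Lambda>) or (\<alpha>, \<alpha>), which makes them continuous at
  \<open>t0\<close>. Pairings with words control the vector itself because the form on an
  irreducible module is nondegenerate. Two points t and u are kept apart because S(\<omega>(t), F_J
  v) remembers of the second labeling only its colours J; comparing it with b costs a permutation
  \<pi>, which acts on u alone. An edge of a forest then carries 1/(t_i - t_x) from G_b and 1/(u_i -
  u_x) from the chains. For u = t the product is the square found in the second derivatives of log
  \<Phi>. For \<pi> \<noteq> id the kernel vector is nonzero because labels of one colour have
  (\<alpha>, \<alpha>) = 2, so that their coordinates at a critical point are distinct.\<close>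

definition insert_at :: "nat \<Rightarrow> 'a \<Rightarrow> 'a list \<Rightarrow> 'a list" where
  "insert_at k x xs = take k xs @ x # drop k xs"

definition delete_at :: "nat \<Rightarrow> 'a list \<Rightarrow> 'a list" where
  "delete_at k xs = take k xs @ drop (Suc k) xs"

lemma insert_at_simps [simp]:
  "insert_at 0 x xs = x # xs"
  "insert_at (Suc k) x (y # ys) = y # insert_at k x ys"
  by (simp_all add: insert_at_def)

lemma delete_at_simps [simp]:
  "delete_at 0 (y # ys) = ys"
  "delete_at (Suc k) (y # ys) = y # delete_at k ys"
  by (simp_all add: delete_at_def)

lemma set_insert_at [simp]: "set (insert_at k x xs) = insert x (set xs)"
  by (metis Un_insert_right append_take_drop_id insert_at_def list.simps(15) set_append)

lemma distinct_insert_at [simp]: "distinct (insert_at k x xs) \<longleftrightarrow> x \<notin> set xs \<and> distinct xs"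
  unfolding insert_at_def using append_take_drop_id[of k xs]
  by (metis Un_iff distinct.simps(2) distinct_append distinct_take distinct_drop
    in_set_takeD in_set_dropD disjoint_insert(1) list.simps(15) set_append)

lemma nth_insert_at [simp]: "k \<le> length xs \<Longrightarrow> insert_at k x xs ! k = x"
  by (simp add: insert_at_def nth_append)

lemma length_insert_at [simp]: "length (insert_at k x xs) = Suc (length xs)"
  by (simp add: insert_at_def)

lemma delete_insert_at [simp]: "k \<le> length xs \<Longrightarrow> delete_at k (insert_at k x xs) = xs"
  by (simp add: insert_at_def delete_at_def)

lemma insert_delete_at [simp]: "k < length xs \<Longrightarrow> insert_at k (xs ! k) (delete_at k xs) = xs"
  by (simp add: insert_at_def delete_at_def id_take_nth_drop[symmetric] min_def)

lemma map_delete_at: "map f (delete_at k xs) = delete_at k (map f xs)"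
  by (simp add: delete_at_def take_map drop_map)

lemma distinct_delete_at: "distinct xs \<Longrightarrow> distinct (delete_at k xs)"
  unfolding delete_at_def
  by (metis Suc_n_not_le_n distinct_append distinct_drop distinct_take inf.absorb_iff2 linorder_le_cases
    set_take_disj_set_drop_if_distinct order_less_imp_le lessI)

lemma set_delete_at:
  assumes "distinct xs" "k < length xs"
  shows "set (delete_at k xs) = set xs - {xs ! k}"
proof -
  have "insert_at k (xs ! k) (delete_at k xs) = xs" using assms by simp
  then have "set xs = insert (xs ! k) (set (delete_at k xs))" "xs ! k \<notin> set (delete_at k xs)"
    using assms(1) by (metis set_insert_at, metis distinct_insert_at)
  then show ?thesis by auto
qed

lemma length_delete_at: "k < length xs \<Longrightarrow> Suc (length (delete_at k xs)) = length xs"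
  by (simp add: delete_at_def)

section \<open>Partial fractions for chains of simple poles\<close>

lemma omega_word_Cons:
  "omega_word t w (a # as) = 1 / (t a - (if as = [] then w else t (hd as))) * omega_word t w as"
  by (cases as) auto

lemma omega_word_map: "omega_word t w (map f a) = omega_word (t \<circ> f) w a"
proof (induction a)
  case (Cons i a)
  then show ?case by (cases a) (simp_all add: omega_word_Cons)
qed simp

text \<open>Compare the coefficients of \<open>m\<close> and of each \<open>\<beta> q\<close>: the
  words with \<open>i\<close> inserted anywhere add up to
  \<open>omega_word t w a / (t i - w)\<close>, those with \<open>i\<close> inserted before
  \<open>q\<close> to \<open>omega_word t w a / (t i - t q)\<close>. The combination has the form
  that \<open>act_E_F_word\<close> produces at each position, with \<open>m\<close> from the highest
  weight and \<open>\<beta>\<close> from the letters further right.\<close>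

lemma omega_word_insert_sum:
  fixes m :: complex
  assumes "distinct a" "i \<notin> set a" "inj_on t (insert i (set a))" "w \<notin> t ` insert i (set a)"
  shows "(\<Sum>k\<le>length a. omega_word t w (insert_at k i a) * (m + (\<Sum>q\<in>set (drop k a). \<beta> q)))
    = omega_word t w a * (m / (t i - w) + (\<Sum>q\<in>set a. \<beta> q / (t i - t q)))"
  using assms
proof (induction a)
  case (Cons q a)
  define h where "h = (if a = [] then w else t (hd a))"
  define M where "M = m + (\<Sum>q\<in>set a. \<beta> q)"
  define R where "R = m / (t i - w) + (\<Sum>q\<in>set a. \<beta> q / (t i - t q))"
  define f where "f k = omega_word t w (insert_at k i a) * (m + (\<Sum>q\<in>set (drop k a). \<beta> q))" for k
  let ?o = "omega_word t w a"
  have ne: "t q \<noteq> h" "t i \<noteq> h" "t i \<noteq> t q"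
    using Cons.prems unfolding h_def by (auto simp: inj_on_def)
  have IH: "(\<Sum>k\<le>length a. f k) = ?o * R"
    unfolding f_def R_def using Cons by (intro Cons.IH) (auto simp: inj_on_def)
  have f0: "f 0 = ?o * M / (t i - h)"
    by (simp add: f_def M_def omega_word_Cons h_def)
  \<comment> \<open>Inserting \<open>i\<close> behind the head of \<open>a\<close> leaves the
    successor of \<open>q\<close> unchanged, so the factor of \<open>q\<close> splits off. At
    position 0 of \<open>a\<close> the successor of \<open>q\<close> becomes \<open>i\<close>; that
    term is treated apart.\<close>
  have tail: "omega_word t w (q # insert_at (Suc k) i a) = omega_word t w (insert_at (Suc k) i a) / (t q - h)"
    if "Suc k \<le> length a" for k
    using that by (cases a) (simp_all add: h_def omega_word_Cons[of t w q])
  have "(\<Sum>k\<le>length (q # a). omega_word t w (insert_at k i (q # a)) * (m + (\<Sum>q\<in>set (drop k (q # a)). \<beta> q)))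
     = omega_word t w (i # q # a) * (\<beta> q + M)
       + (\<Sum>k\<le>length a. omega_word t w (q # insert_at k i a) * (m + (\<Sum>q\<in>set (drop k a). \<beta> q)))"
    unfolding length_Cons sum.atMost_Suc_shift using Cons.prems by (simp add: M_def algebra_simps)
  also have "omega_word t w (i # q # a) = ?o / ((t i - t q) * (t q - h))"
    by (simp add: omega_word_Cons h_def)
  also have "(\<Sum>k\<le>length a. omega_word t w (q # insert_at k i a) * (m + (\<Sum>q\<in>set (drop k a). \<beta> q)))
      = omega_word t w (q # i # a) * M + ((\<Sum>k\<le>length a. f k) - f 0) / (t q - h)"
  proof -
    have "(\<Sum>k\<le>length a. omega_word t w (q # insert_at k i a) * (m + (\<Sum>q\<in>set (drop k a). \<beta> q)))
      = omega_word t w (q # i # a) * M + (\<Sum>k<length a. f (Suc k) / (t q - h))"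
      unfolding sum.atMost_shift
      by (intro arg_cong2[of _ _ _ _ "(+)"] sum.cong) (simp_all add: M_def tail f_def)
    moreover have "(\<Sum>k\<le>length a. f k) - f 0 = (\<Sum>k<length a. f (Suc k))"
      unfolding sum.atMost_shift by simp
    ultimately show ?thesis by (simp add: sum_divide_distrib)
  qed
  also have "omega_word t w (q # i # a) = ?o / ((t q - t i) * (t i - h))"
    by (simp add: omega_word_Cons h_def)
  also have "?o / ((t i - t q) * (t q - h)) * (\<beta> q + M) +
      (?o / ((t q - t i) * (t i - h)) * M + ((\<Sum>k\<le>length a. f k) - f 0) / (t q - h))
    = ?o / (t q - h) * (R + \<beta> q / (t i - t q))"
  proof -
    \<comment> \<open>The terms with \<open>M\<close> come from \<open>i\<close> directly before
      \<open>q\<close>, from \<open>i\<close> directly after \<open>q\<close>, and from the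
      subtracted \<open>f 0\<close>; this identity makes them cancel.\<close>
    have "1 / ((t i - t q) * (t q - h)) + 1 / ((t q - t i) * (t i - h)) = 1 / ((t i - h) * (t q - h))"
      using ne by (simp add: divide_simps) (simp add: algebra_simps)
    then have d: "1 / (A * D) + 1 / (A' * H) = 1 / (H * D)"
      if "A = t i - t q" "A' = t q - t i" "D = t q - h" "H = t i - h" for A A' D H
      using that by simp
    have "?o / (A * D) * (\<beta> q + M) + (?o / (A' * H) * M + (?o * R - ?o * M / H) / D)
        = ?o / D * (R + \<beta> q / A)" if "1 / (A * D) + 1 / (A' * H) = 1 / (H * D)" for A A' D H
    proof -
      have "?o / (A * D) * (\<beta> q + M) + (?o / (A' * H) * M + (?o * R - ?o * M / H) / D)
        = ?o * M * ((1 / (A * D) + 1 / (A' * H)) - 1 / (H * D)) + ?o / (A * D) * \<beta> q + ?o * R / D"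
        by (simp add: algebra_simps diff_divide_distrib add_divide_distrib)
      then show ?thesis unfolding that by (simp add: algebra_simps add_divide_distrib)
    qed
    from this[OF d[OF refl refl refl refl]] show ?thesis unfolding IH f0 .
  qed
  also have "\<dots> = omega_word t w (q # a) * (m / (t i - w) + (\<Sum>q\<in>set (q # a). \<beta> q / (t i - t q)))"
    using Cons.prems by (simp add: omega_word_Cons h_def R_def algebra_simps)
  finally show ?case .
qed simp

text \<open>A word with a marked position amounts to the marked label, the rest of the word, and the
  place where the label is put back. This turns the deletion of a letter into a sum over
  insertions.\<close>

lemma sum_permutations_delete:
  assumes "finite X"
  shows "(\<Sum>a\<in>permutations_of_set X. \<Sum>k<length a. f a k) =
    (\<Sum>i\<in>X. \<Sum>a\<in>permutations_of_set (X - {i}). \<Sum>k\<le>length a. f (insert_at k i a) k)"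
proof -
  have "(\<Sum>a\<in>permutations_of_set X. \<Sum>k<length a. f a k) =
     (\<Sum>x\<in>(SIGMA a:permutations_of_set X. {..<length a}). f (fst x) (snd x))"
    by (subst sum.Sigma) (auto simp: split_beta)
  also have "\<dots> = (\<Sum>x\<in>(SIGMA i:X. SIGMA a:permutations_of_set (X - {i}). {..length a}).
      f (insert_at (snd (snd x)) (fst x) (fst (snd x))) (snd (snd x)))"
  proof (rule sum.reindex_bij_witness[of _ "\<lambda>x. (insert_at (snd (snd x)) (fst x) (fst (snd x)), snd (snd x))"
      "\<lambda>x. (fst x ! snd x, delete_at (snd x) (fst x), snd x)"])
    fix x assume x: "x \<in> (SIGMA a:permutations_of_set X. {..<length a})"
    then obtain a k where [simp]: "x = (a, k)" and a: "set a = X" "distinct a" "k < length a"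
      by (auto simp: permutations_of_set_def)
    then have "k \<le> length (delete_at k a)" "a ! k \<in> X" using length_delete_at[of k a] by auto
    then show "(fst x ! snd x, delete_at (snd x) (fst x), snd x) \<in>
        (SIGMA i:X. SIGMA a:permutations_of_set (X - {i}). {..length a})"
      using a by (simp add: permutations_of_set_def set_delete_at distinct_delete_at)
    show "(insert_at (snd (snd (fst x ! snd x, delete_at (snd x) (fst x), snd x)))
        (fst (fst x ! snd x, delete_at (snd x) (fst x), snd x))
        (fst (snd (fst x ! snd x, delete_at (snd x) (fst x), snd x))),
        snd (snd (fst x ! snd x, delete_at (snd x) (fst x), snd x))) = x"
      using a by simp
    then show "f (insert_at (snd (snd (fst x ! snd x, delete_at (snd x) (fst x), snd x)))
        (fst (fst x ! snd x, delete_at (snd x) (fst x), snd x))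
        (fst (snd (fst x ! snd x, delete_at (snd x) (fst x), snd x))))
        (snd (snd (fst x ! snd x, delete_at (snd x) (fst x), snd x))) = f (fst x) (snd x)"
      by (metis fst_conv snd_conv)
  next
    fix x assume "x \<in> (SIGMA i:X. SIGMA a:permutations_of_set (X - {i}). {..length a})"
    then obtain i a k where x: "x = (i, a, k)" "i \<in> X" "set a = X - {i}" "distinct a" "k \<le> length a"
      by (auto simp: permutations_of_set_def)
    then show "(insert_at (snd (snd x)) (fst x) (fst (snd x)), snd (snd x)) \<in> (SIGMA a:permutations_of_set X. {..<length a})"
      by (simp add: permutations_of_set_def insert_absorb less_Suc_eq_le)
    show "(fst (insert_at (snd (snd x)) (fst x) (fst (snd x)), snd (snd x)) ! snd (insert_at (snd (snd x)) (fst x) (fst (snd x)), snd (snd x)),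
       delete_at (snd (insert_at (snd (snd x)) (fst x) (fst (snd x)), snd (snd x))) (fst (insert_at (snd (snd x)) (fst x) (fst (snd x)), snd (snd x))),
       snd (insert_at (snd (snd x)) (fst x) (fst (snd x)), snd (snd x))) = x"
      using x by simp
  qed
  also have "\<dots> = (\<Sum>i\<in>X. \<Sum>a\<in>permutations_of_set (X - {i}). \<Sum>k\<le>length a. f (insert_at k i a) k)"
    using assms by (simp add: sum.Sigma split_beta)
  finally show ?thesis .
qed

section \<open>Tuples of words\<close>

text \<open>Every label is used exactly once. These tuples replace the pairs (I, \<sigma>): the
  colours of the labels give I, the words read one after another give \<sigma>. Extensionality makes
  equality of tuples the same as equality on \<open>N\<close>.\<close>

definition label_tuples :: "nat set \<Rightarrow> 'a set \<Rightarrow> (nat \<Rightarrow> 'a list) set" where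
  "label_tuples N L = {b \<in> extensional N. (\<forall>s\<in>N. distinct (b s)) \<and>
     (\<forall>s\<in>N. \<forall>s'\<in>N. s \<noteq> s' \<longrightarrow> set (b s) \<inter> set (b s') = {}) \<and> (\<Union>s\<in>N. set (b s)) = L}"

lemma label_tuplesD:
  assumes "b \<in> label_tuples N L"
  shows "s \<in> N \<Longrightarrow> distinct (b s)" "s \<in> N \<Longrightarrow> set (b s) \<subseteq> L"
    "\<lbrakk>s \<in> N; s' \<in> N; s \<noteq> s'\<rbrakk> \<Longrightarrow> set (b s) \<inter> set (b s') = {}"
    "(\<Union>s\<in>N. set (b s)) = L" "b \<in> extensional N"
  using assms by (auto simp: label_tuples_def)

lemma label_tuples_slot:
  assumes "b \<in> label_tuples N L" "i \<in> L"
  shows "\<exists>!s. s \<in> N \<and> i \<in> set (b s)"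
  using assms by (auto simp: label_tuples_def)

definition slot_of :: "nat set \<Rightarrow> (nat \<Rightarrow> 'a list) \<Rightarrow> 'a \<Rightarrow> nat" where
  "slot_of N b i = (THE s. s \<in> N \<and> i \<in> set (b s))"

lemma slot_of:
  assumes "b \<in> label_tuples N L" "i \<in> L"
  shows "slot_of N b i \<in> N" "i \<in> set (b (slot_of N b i))"
    "\<lbrakk>s \<in> N; i \<in> set (b s)\<rbrakk> \<Longrightarrow> slot_of N b i = s"
proof -
  from label_tuples_slot[OF assms] have "slot_of N b i \<in> N \<and> i \<in> set (b (slot_of N b i))"
    unfolding slot_of_def by (rule theI')
  then show "slot_of N b i \<in> N" "i \<in> set (b (slot_of N b i))" by auto
  with label_tuples_slot[OF assms] show "\<lbrakk>s \<in> N; i \<in> set (b s)\<rbrakk> \<Longrightarrow> slot_of N b i = s" by blast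
qed

text \<open>Choosing a tuple means choosing a slot for each label and then, independently in each
  slot, an order. The inner sums over \<open>PiE\<close> let products over slots be exchanged with
  sums.\<close>

lemma sum_label_tuples:
  assumes "finite N" "finite L"
  shows "(\<Sum>b\<in>label_tuples N L. f b) =
    (\<Sum>g\<in>PiE L (\<lambda>_. N). \<Sum>b\<in>PiE N (\<lambda>s. permutations_of_set {i\<in>L. g i = s}). f b)"
proof -
  have "(\<Sum>x\<in>(SIGMA g:PiE L (\<lambda>_. N). PiE N (\<lambda>s. permutations_of_set {i\<in>L. g i = s})). f (snd x))
      = (\<Sum>b\<in>label_tuples N L. f b)"
  proof (rule sum.reindex_bij_witness[of _ "\<lambda>b. (\<lambda>i\<in>L. slot_of N b i, b)" snd])
    fix x assume "x \<in> (SIGMA g:PiE L (\<lambda>_. N). PiE N (\<lambda>s. permutations_of_set {i\<in>L. g i = s}))"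
    then obtain g b where x: "x = (g, b)" and g: "g \<in> PiE L (\<lambda>_. N)"
      and b: "b \<in> extensional N" "\<And>s. s \<in> N \<Longrightarrow> set (b s) = {i\<in>L. g i = s} \<and> distinct (b s)"
      by (auto simp: PiE_iff permutations_of_set_def)
    have T: "b \<in> label_tuples N L"
      using b g by (fastforce simp: label_tuples_def PiE_iff)
    then show "snd x \<in> label_tuples N L" by (simp add: x)
    have "slot_of N b i = g i" if "i \<in> L" for i
      using slot_of(3)[OF T that, of "g i"] b that g by (auto simp: PiE_iff)
    then have "(\<lambda>i\<in>L. slot_of N b i) = g"
      using g by (auto simp: PiE_iff extensional_def restrict_def fun_eq_iff)
    then show "(\<lambda>i\<in>L. slot_of N (snd x) i, snd x) = x" by (simp add: x)
  next
    fix b assume b: "b \<in> label_tuples N L"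
    have "set (b s) = {i\<in>L. slot_of N b i = s}" if "s \<in> N" for s
      using slot_of[OF b] label_tuplesD(2)[OF b that] that by blast
    then show "(\<lambda>i\<in>L. slot_of N b i, b) \<in> (SIGMA g:PiE L (\<lambda>_. N). PiE N (\<lambda>s. permutations_of_set {i\<in>L. g i = s}))"
      using b slot_of(1)[OF b] label_tuplesD(1,5)[OF b]
      by (auto simp: PiE_iff permutations_of_set_def)
  qed auto
  then show ?thesis using assms by (subst sum.Sigma) (auto intro!: finite_PiE simp: split_beta)
qed

lemma finite_label_tuples [simp]:
  assumes "finite N" "finite L" shows "finite (label_tuples N L)"
proof (rule finite_subset)
  show "label_tuples N L \<subseteq> PiE N (\<lambda>_. {xs. set xs \<subseteq> L \<and> length xs \<le> card L})"
  proof
    fix b assume b: "b \<in> label_tuples N L"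
    have "length (b s) \<le> card L" if "s \<in> N" for s
      using label_tuplesD(1,2)[OF b that] assms by (metis card_mono distinct_card)
    then show "b \<in> PiE N (\<lambda>_. {xs. set xs \<subseteq> L \<and> length xs \<le> card L})"
      using label_tuplesD[OF b] by (auto simp: PiE_iff)
  qed
  show "finite (PiE N (\<lambda>_. {xs. set xs \<subseteq> L \<and> length xs \<le> card L}))"
    using assms by (intro finite_PiE finite_lists_length_le) auto
qed

lemma label_tuples_map:
  assumes "inj_on g L" "b \<in> label_tuples N L"
  shows "(\<lambda>s\<in>N. map g (b s)) \<in> label_tuples N (g ` L)"
proof -
  have sub: "set (b s) \<subseteq> L" if "s \<in> N" for s by (rule label_tuplesD(2)[OF assms(2) that])
  have "(\<Union>s\<in>N. set (map g (b s))) = g ` (\<Union>s\<in>N. set (b s))" by auto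
  then have "(\<Union>s\<in>N. set (map g (b s))) = g ` L" using label_tuplesD(4)[OF assms(2)] by simp
  moreover have "set (map g (b s)) \<inter> set (map g (b s')) = {}" if "s \<in> N" "s' \<in> N" "s \<noteq> s'" for s s'
  proof -
    have "g ` set (b s) \<inter> g ` set (b s') = g ` (set (b s) \<inter> set (b s'))"
      using inj_on_image_Int[OF assms(1) sub[OF that(1)] sub[OF that(2)]] by simp
    then show ?thesis using label_tuplesD(3)[OF assms(2) that] by simp
  qed
  moreover have "distinct (map g (b s))" if "s \<in> N" for s
    using label_tuplesD(1)[OF assms(2) that] sub[OF that] assms(1) by (auto simp: distinct_map intro: inj_on_subset)
  ultimately show ?thesis by (simp add: label_tuples_def)
qed

lemma label_tuples_empty: "label_tuples N {} = {\<lambda>s\<in>N. []}"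
  by (auto simp: label_tuples_def extensional_def restrict_def fun_eq_iff)

text \<open>The recursion for inductions on the number of labels: \<open>i\<close> has a unique
  place in a tuple, and deleting it leaves a tuple on \<open>L\<close>.\<close>

lemma sum_label_tuples_insert:
  assumes "finite N" "finite L" "i \<notin> L"
  shows "(\<Sum>b\<in>label_tuples N (insert i L). f b) =
    (\<Sum>b\<in>label_tuples N L. \<Sum>s\<in>N. \<Sum>k\<le>length (b s). f (b(s := insert_at k i (b s))))"
proof -
  let ?A = "SIGMA b:label_tuples N L. SIGMA s:N. {..length (b s)}"
  define F where "F x = (fst x)(fst (snd x) := insert_at (snd (snd x)) i (fst x (fst (snd x))))"
    for x :: "(nat \<Rightarrow> 'a list) \<times> nat \<times> nat"
  have bij: "bij_betw F ?A (label_tuples N (insert i L))"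
  proof (rule bij_betw_imageI)
    have *: "b \<in> extensional N \<and> (\<forall>s\<in>N. distinct (b s) \<and> i \<notin> set (b s)) \<and> s \<in> N \<and> k \<le> length (b s)"
      if "(b, s, k) \<in> ?A" for b s k
      using that assms(3) by (auto simp: label_tuples_def)
    show "inj_on F ?A"
    proof (rule inj_onI)
      fix x y assume xy: "x \<in> ?A" "y \<in> ?A" "F x = F y"
      obtain b s k b' s' k' where x: "x = (b, s, k)" and y: "y = (b', s', k')" by (metis prod_cases3)
      note x' = *[OF xy(1)[unfolded x]] and y' = *[OF xy(2)[unfolded y]]
      have F: "b(s := insert_at k i (b s)) = b'(s' := insert_at k' i (b' s'))"
        using xy(3) by (simp add: F_def x y)
      have s: "s = s'"
      proof (rule ccontr)
        assume "s \<noteq> s'"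
        then have "insert_at k i (b s) = b' s" using fun_cong[OF F, of s] by simp
        then have "i \<in> set (b' s)" by (metis insertI1 set_insert_at)
        then show False using x' y' by blast
      qed
      have ins: "insert_at k i (b s) = insert_at k' i (b' s)" using fun_cong[OF F, of s] s by simp
      have "k = k'"
      proof -
        have d: "distinct (insert_at k i (b s))" using x' by simp
        have "insert_at k i (b s) ! k = i" using x' by simp
        moreover have "insert_at k' i (b' s) ! k' = i" using y' s by simp
        then have "insert_at k i (b s) ! k' = i" by (simp only: ins)
        moreover have "k < length (insert_at k i (b s))" using x' by (simp add: less_Suc_eq_le)
        moreover have "k' < length (insert_at k i (b s))" unfolding ins using y' s by (simp add: less_Suc_eq_le)
        ultimately show ?thesis using d by (metis nth_eq_iff_index_eq)
      qed
      then have "b s = b' s" using ins x' y' s by (metis delete_insert_at)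
      then have "b = b'" using F s by (auto simp: fun_eq_iff split: if_splits)
      then show "x = y" using s \<open>k = k'\<close> by (simp add: x y)
    qed
    show "F ` ?A = label_tuples N (insert i L)"
    proof (intro equalityI subsetI)
      fix y assume "y \<in> F ` ?A"
      then obtain b s k where y: "y = b(s := insert_at k i (b s))" and A: "(b, s, k) \<in> ?A"
        by (auto simp: F_def)
      have b: "b \<in> label_tuples N L" "s \<in> N" "k \<le> length (b s)" using A by auto
      have s': "set (y s') = (if s' = s then insert i (set (b s)) else set (b s'))" for s' by (simp add: y)
      have "(\<Union>s\<in>N. set (y s)) = insert i (\<Union>s\<in>N. set (b s))"
        unfolding s' using b(2) by auto
      moreover have "set (y u) \<inter> set (y v) = {}" if "u \<in> N" "v \<in> N" "u \<noteq> v" for u v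
        using label_tuplesD(3)[OF b(1) that] label_tuplesD(2)[OF b(1)] that assms(3)
        unfolding s' by auto
      moreover have "distinct (y u)" if "u \<in> N" for u
        using label_tuplesD(1)[OF b(1) that] label_tuplesD(2)[OF b(1)] b(2) assms(3) by (auto simp: y)
      moreover have "y \<in> extensional N"
        using label_tuplesD(5)[OF b(1)] b(2) by (auto simp: y extensional_def)
      ultimately show "y \<in> label_tuples N (insert i L)"
        using label_tuplesD(4)[OF b(1)] by (simp add: label_tuples_def)
    next
      fix y assume y: "y \<in> label_tuples N (insert i L)"
      define s where "s = slot_of N y i"
      have s: "s \<in> N" "i \<in> set (y s)" using slot_of(1,2)[OF y, of i] by (auto simp: s_def)
      then obtain k where k: "k < length (y s)" "y s ! k = i" by (meson in_set_conv_nth)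
      define b where "b = y(s := delete_at k (y s))"
      have ds: "distinct (y s)" by (rule label_tuplesD(1)[OF y s(1)])
      have sb: "set (b s') = set (y s') - {i}" if "s' \<in> N" for s'
        using that slot_of(3)[OF y, of i s'] set_delete_at[OF ds k(1)] k(2)
        by (auto simp: b_def s_def)
      have "b \<in> label_tuples N L"
        unfolding label_tuples_def mem_Collect_eq
      proof (intro conjI ballI impI)
        show "b \<in> extensional N" using label_tuplesD(5)[OF y] s(1) by (auto simp: b_def extensional_def)
        show "distinct (b s')" if "s' \<in> N" for s'
          using label_tuplesD(1)[OF y that] ds by (simp add: b_def distinct_delete_at)
        show "set (b u) \<inter> set (b v) = {}" if "u \<in> N" "v \<in> N" "u \<noteq> v" for u v
          using label_tuplesD(3)[OF y that] sb that by auto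
        have "(\<Union>s\<in>N. set (b s)) = (\<Union>s\<in>N. set (y s)) - {i}" using sb by auto
        then show "(\<Union>s\<in>N. set (b s)) = L" using label_tuplesD(4)[OF y] assms(3) by simp
      qed
      moreover have "k \<le> length (b s)" using k(1) length_delete_at[of k "y s"] by (simp add: b_def)
      moreover have "F (b, s, k) = y" using k by (auto simp: F_def b_def)
      ultimately show "y \<in> F ` ?A" using s(1) by (intro rev_image_eqI[of "(b, s, k)"]) auto
    qed
  qed
  have "(\<Sum>b\<in>label_tuples N (insert i L). f b) = (\<Sum>x\<in>?A. f (F x))"
    using sum.reindex_bij_betw[OF bij, of f] by simp
  then show ?thesis using assms by (simp add: sum.Sigma split_beta F_def)
qed

section \<open>Sums over forests\<close>

text \<open>Edges of graphs on a set of labels and a set of roots \<open>N\<close> (the slots) have targets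
  \<open>Inl q\<close>, a label, or \<open>Inr s\<close>, a root.\<close>

fun chain_weight :: "('a \<Rightarrow> 'a + nat \<Rightarrow> complex) \<Rightarrow> nat \<Rightarrow> 'a list \<Rightarrow> complex" where
  "chain_weight w s [] = 1"
| "chain_weight w s (i # b) = (w i (Inr s) + (\<Sum>q\<in>set b. w i (Inl q))) * chain_weight w s b"

text \<open>The second assumption says that no label of \<open>a\<close> points to \<open>i\<close>;
  hence only the new factor of \<open>i\<close> depends on where it is inserted.\<close>

lemma chain_weight_insert_at:
  assumes "i \<notin> set a" "\<And>j. j \<in> set a \<Longrightarrow> w j (Inl i) = 0"
  shows "chain_weight w s (insert_at k i a) = (w i (Inr s) + (\<Sum>q\<in>set (drop k a). w i (Inl q))) * chain_weight w s a"
  using assms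
proof (induction a arbitrary: k)
  case (Cons j a)
  show ?case
  proof (cases k)
    case (Suc k')
    have "chain_weight w s (insert_at k' i a) = (w i (Inr s) + (\<Sum>q\<in>set (drop k' a). w i (Inl q))) * chain_weight w s a"
      using Cons by auto
    then show ?thesis using Cons.prems Suc by simp
  qed simp
qed (simp add: insert_at_def)

text \<open>The possible targets \<open>Q i\<close> depend on the word alone. Having one
  \<open>Q\<close> for all weights allows \<open>w\<close> to be compared with
  \<open>delta_weight p\<close>.\<close>

lemma chain_weight_eq_prod_sum:
  assumes "distinct a"
  shows "\<exists>Q. (\<forall>i. Q i \<subseteq> insert (Inr s) (Inl ` set a)) \<and>
    (\<forall>w. chain_weight w s a = (\<Prod>i\<in>set a. \<Sum>x\<in>Q i. w i x))"
  using assms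
proof (induction a)
  case Nil
  show ?case by (intro exI[of _ "\<lambda>_. {}"]) auto
next
  case (Cons j a)
  then obtain Q where Q: "\<And>i. Q i \<subseteq> insert (Inr s) (Inl ` set a)"
    "\<And>w. chain_weight w s a = (\<Prod>i\<in>set a. \<Sum>x\<in>Q i. w i x)" by auto
  define P where "P = Q(j := insert (Inr s) (Inl ` set a))"
  have "chain_weight w s (j # a) = (\<Prod>i\<in>set (j # a). \<Sum>x\<in>P i. w i x)" for w
  proof -
    have "(\<Prod>i\<in>set a. \<Sum>x\<in>P i. w i x) = chain_weight w s a"
      unfolding Q(2) using Cons.prems by (intro prod.cong) (auto simp: P_def)
    moreover have "(\<Sum>x\<in>P j. w j x) = w j (Inr s) + (\<Sum>q\<in>set a. w j (Inl q))"
      by (simp add: P_def sum.insert image_iff sum.reindex)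
    ultimately show ?thesis using Cons.prems by simp
  qed
  moreover have "P i \<subseteq> insert (Inr s) (Inl ` set (j # a))" for i using Q(1)[of i] by (auto simp: P_def)
  ultimately show ?case by blast
qed

definition targets :: "nat set \<Rightarrow> 'a set \<Rightarrow> ('a + nat) set" where
  "targets N L = Inl ` L \<union> Inr ` N"

lemma finite_targets [simp]: "finite N \<Longrightarrow> finite L \<Longrightarrow> finite (targets N L)"
  by (simp add: targets_def)

lemma sum_targets: "finite N \<Longrightarrow> finite L \<Longrightarrow> (\<Sum>x\<in>targets N L. f x) = (\<Sum>q\<in>L. f (Inl q)) + (\<Sum>s\<in>N. f (Inr s))"
  unfolding targets_def by (subst sum.union_disjoint) (auto simp: sum.reindex)

abbreviation delta_weight :: "('a \<Rightarrow> 'a + nat) \<Rightarrow> 'a \<Rightarrow> 'a + nat \<Rightarrow> complex" where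
  "delta_weight p i x \<equiv> if p i = x then 1 else 0"

text \<open>Multiplying out chooses a target for each label, so every monomial occurs with
  coefficient 0 or 1, and the indicator weights of \<open>p\<close> read this coefficient off. It is
  1 iff each label points to its own slot or to a later label of its own word.\<close>

lemma prod_chain_weight_expand:
  assumes "finite N" "finite L" "b \<in> label_tuples N L"
  shows "(\<Prod>s\<in>N. chain_weight w s (b s)) =
    (\<Sum>p\<in>PiE L (\<lambda>_. targets N L). (\<Prod>i\<in>L. w i (p i)) * (\<Prod>s\<in>N. chain_weight (delta_weight p) s (b s)))"
proof -
  have "\<exists>Q. \<forall>s\<in>N. (\<forall>i. Q s i \<subseteq> insert (Inr s) (Inl ` set (b s))) \<and>
    (\<forall>w. chain_weight w s (b s) = (\<Prod>i\<in>set (b s). \<Sum>x\<in>Q s i. w i x))"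
    using chain_weight_eq_prod_sum[OF label_tuplesD(1)[OF assms(3)]] by (intro bchoice) blast
  then obtain Q where Q: "\<And>s i. s \<in> N \<Longrightarrow> Q s i \<subseteq> insert (Inr s) (Inl ` set (b s))"
    "\<And>s w. s \<in> N \<Longrightarrow> chain_weight w s (b s) = (\<Prod>i\<in>set (b s). \<Sum>x\<in>Q s i. w i x)" by metis
  define P where "P i = Q (slot_of N b i) i" for i
  have P: "(\<Prod>s\<in>N. chain_weight w s (b s)) = (\<Prod>i\<in>L. \<Sum>x\<in>P i. w i x)" for w
  proof -
    have "(\<Prod>s\<in>N. chain_weight w s (b s)) = (\<Prod>s\<in>N. \<Prod>i\<in>set (b s). \<Sum>x\<in>P i. w i x)"
    proof (intro prod.cong refl)
      fix s assume s: "s \<in> N"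
      have "slot_of N b i = s" if "i \<in> set (b s)" for i
        using slot_of(3)[OF assms(3) _ s that] label_tuplesD(2)[OF assms(3) s] that by blast
      then show "chain_weight w s (b s) = (\<Prod>i\<in>set (b s). \<Sum>x\<in>P i. w i x)"
        unfolding Q(2)[OF s] by (intro prod.cong) (auto simp: P_def)
    qed
    also have "\<dots> = (\<Prod>i\<in>(\<Union>s\<in>N. set (b s)). \<Sum>x\<in>P i. w i x)"
      using assms(1) label_tuplesD(3)[OF assms(3)] by (subst prod.UNION_disjoint) auto
    finally show ?thesis using label_tuplesD(4)[OF assms(3)] by simp
  qed
  have PX: "P i \<subseteq> targets N L" if "i \<in> L" for i
    using Q(1)[of "slot_of N b i" i] slot_of[OF assms(3) that] label_tuplesD(2)[OF assms(3), of "slot_of N b i"]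
    unfolding P_def targets_def by blast
  let ?X = "targets N L"
  have "(\<Prod>s\<in>N. chain_weight w s (b s)) = (\<Prod>i\<in>L. \<Sum>x\<in>?X. w i x * (if x \<in> P i then 1 else 0))"
    unfolding P
  proof (intro prod.cong refl)
    fix i assume "i \<in> L"
    then show "(\<Sum>x\<in>P i. w i x) = (\<Sum>x\<in>?X. w i x * (if x \<in> P i then 1 else 0))"
      using PX[of i] assms by (intro sum.mono_neutral_cong_left) auto
  qed
  also have "\<dots> = (\<Sum>p\<in>PiE L (\<lambda>_. ?X). \<Prod>i\<in>L. w i (p i) * (if p i \<in> P i then 1 else 0))"
    using assms by (subst prod_sum_PiE) auto
  also have "\<dots> = (\<Sum>p\<in>PiE L (\<lambda>_. ?X). (\<Prod>i\<in>L. w i (p i)) * (\<Prod>s\<in>N. chain_weight (delta_weight p) s (b s)))"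
  proof (intro sum.cong refl)
    fix p assume "p \<in> PiE L (\<lambda>_. ?X)"
    have "(\<Sum>x\<in>P i. if p i = x then 1 else 0 :: complex) = (if p i \<in> P i then 1 else 0)" if "i \<in> L" for i
      using finite_subset[OF PX[OF that]] assms by (subst sum.delta') auto
    then have "(\<Prod>s\<in>N. chain_weight (delta_weight p) s (b s)) = (\<Prod>i\<in>L. if p i \<in> P i then 1 else 0)"
      unfolding P by (intro prod.cong) auto
    then show "(\<Prod>i\<in>L. w i (p i) * (if p i \<in> P i then 1 else 0)) =
        (\<Prod>i\<in>L. w i (p i)) * (\<Prod>s\<in>N. chain_weight (delta_weight p) s (b s))"
      by (simp add: prod.distrib)
  qed
  finally show ?thesis .
qed

text \<open>Every path of a map \<open>p\<close> on \<open>L\<close> ends in a root iff no nonempty subset of \<open>L\<close> is mapped to itself.\<close>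

definition is_forest :: "'a set \<Rightarrow> ('a \<Rightarrow> 'a + nat) \<Rightarrow> bool" where
  "is_forest L p \<longleftrightarrow> (\<forall>Y. Y \<subseteq> L \<and> Y \<noteq> {} \<longrightarrow> (\<exists>i\<in>Y. p i \<notin> Inl ` Y))"

text \<open>If every label were hit, the at most \<open>card L\<close> values of \<open>p\<close>
  would be exactly the labels, so \<open>p\<close> would map \<open>L\<close> into itself, which a
  forest excludes.\<close>

lemma forest_leaf:
  assumes "finite L" "L \<noteq> {}" "is_forest L p"
  obtains i where "i \<in> L" "\<And>j. j \<in> L \<Longrightarrow> p j \<noteq> Inl i"
proof -
  have "\<exists>i\<in>L. \<forall>j\<in>L. p j \<noteq> Inl i"
  proof (rule ccontr)
    assume "\<not> ?thesis"
    then have sub: "Inl ` L \<subseteq> p ` L" by force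
    have "card (p ` L) \<le> card (Inl ` L :: ('a + nat) set)"
      using assms(1) by (simp add: card_image card_image_le)
    then have "Inl ` L = p ` L" using sub assms(1) by (intro card_seteq) auto
    then show False using assms unfolding is_forest_def by blast
  qed
  then show ?thesis using that by blast
qed

definition target_val :: "('a \<Rightarrow> complex) \<Rightarrow> (nat \<Rightarrow> complex) \<Rightarrow> 'a + nat \<Rightarrow> complex" where
  "target_val u z x = (case x of Inl q \<Rightarrow> u q | Inr s \<Rightarrow> z s)"

lemma target_val_simps [simp]: "target_val u z (Inl q) = u q" "target_val u z (Inr s) = z s"
  by (simp_all add: target_val_def)

text \<open>A sum over the linear extensions of the forest: the indicator weights keep the tuples in
  which each label stands in the word of its root and before its target. Removing a leaf
  \<open>i\<close> leaves a forest, and putting \<open>i\<close> back in all places before its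
  target contributes one factor by \<open>omega_word_insert_sum\<close>.\<close>

lemma omega_forest_sum:
  assumes "finite N" "finite L" "is_forest L p" "p \<in> L \<rightarrow> targets N L"
    "inj_on u L" "\<And>s. s \<in> N \<Longrightarrow> z s \<notin> u ` L"
  shows "(\<Sum>b\<in>label_tuples N L. (\<Prod>s\<in>N. omega_word u (z s) (b s)) * (\<Prod>s\<in>N. chain_weight (delta_weight p) s (b s)))
    = (\<Prod>i\<in>L. 1 / (u i - target_val u z (p i)))"
  using assms(2-6)
proof (induction "card L" arbitrary: L)
  case 0
  then show ?case by (simp add: label_tuples_empty)
next
  case (Suc n)
  then obtain i where i: "i \<in> L" "\<And>j. j \<in> L \<Longrightarrow> p j \<noteq> Inl i"
    using forest_leaf[of L p] by (metis card.empty nat.distinct(1))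
  define M where "M = L - {i}"
  have L: "L = insert i M" "i \<notin> M" "finite M" using i Suc.prems by (auto simp: M_def)
  have IH: "(\<Sum>b\<in>label_tuples N M. (\<Prod>s\<in>N. omega_word u (z s) (b s)) * (\<Prod>s\<in>N. chain_weight (delta_weight p) s (b s)))
    = (\<Prod>i\<in>M. 1 / (u i - target_val u z (p i)))"
  proof (rule Suc.hyps(1))
    show "n = card M" using Suc.hyps(2) L by simp
    show "is_forest M p" using Suc.prems(2) L unfolding is_forest_def by blast
    show "p \<in> M \<rightarrow> targets N M" using Suc.prems(3) i L unfolding targets_def by fastforce
    show "inj_on u M" using Suc.prems(4) L by (auto simp: inj_on_def)
  qed (use L Suc.prems(5) in auto)
  let ?W = "\<lambda>s b. omega_word u (z s) b * chain_weight (delta_weight p) s b"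
  let ?d = "\<lambda>x. delta_weight p i x"
  have "(\<Sum>b\<in>label_tuples N L. \<Prod>s\<in>N. ?W s (b s)) =
    (\<Sum>b\<in>label_tuples N M. \<Sum>s\<in>N. \<Sum>k\<le>length (b s). \<Prod>s'\<in>N. ?W s' ((b(s := insert_at k i (b s))) s'))"
    unfolding L(1) by (rule sum_label_tuples_insert[OF assms(1) L(3,2)])
  also have "\<dots> = (\<Sum>b\<in>label_tuples N M. (\<Prod>s\<in>N. ?W s (b s)) / (u i - target_val u z (p i)))"
  proof (intro sum.cong refl)
    fix b assume b: "b \<in> label_tuples N M"
    have "(\<Sum>k\<le>length (b s). \<Prod>s'\<in>N. ?W s' ((b(s := insert_at k i (b s))) s'))
       = (\<Prod>s\<in>N. ?W s (b s)) * (?d (Inr s) / (u i - z s) + (\<Sum>q\<in>set (b s). ?d (Inl q) / (u i - u q)))"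
      if s: "s \<in> N" for s
    proof -
      have sM: "set (b s) \<subseteq> M" by (rule label_tuplesD(2)[OF b s])
      have split: "(\<Prod>s'\<in>N. ?W s' ((b(s := y)) s')) = ?W s y * (\<Prod>s'\<in>N - {s}. ?W s' (b s'))" for y
        using s assms(1) by (subst prod.remove[of N s]) auto
      have G: "chain_weight (delta_weight p) s (insert_at k i (b s)) =
         (?d (Inr s) + (\<Sum>q\<in>set (drop k (b s)). ?d (Inl q))) * chain_weight (delta_weight p) s (b s)" for k
        using sM L i by (intro chain_weight_insert_at) auto
      have "(\<Sum>k\<le>length (b s). \<Prod>s'\<in>N. ?W s' ((b(s := insert_at k i (b s))) s'))
        = (\<Sum>k\<le>length (b s). omega_word u (z s) (insert_at k i (b s)) * (?d (Inr s) + (\<Sum>q\<in>set (drop k (b s)). ?d (Inl q))))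
           * (chain_weight (delta_weight p) s (b s) * (\<Prod>s'\<in>N - {s}. ?W s' (b s')))"
        unfolding split G sum_distrib_right by (intro sum.cong refl) (simp only: mult_ac)
      also have "\<dots> = omega_word u (z s) (b s) * (?d (Inr s) / (u i - z s) + (\<Sum>q\<in>set (b s). ?d (Inl q) / (u i - u q)))
           * (chain_weight (delta_weight p) s (b s) * (\<Prod>s'\<in>N - {s}. ?W s' (b s')))"
        using sM L Suc.prems(4,5) s label_tuplesD(1)[OF b s]
        by (subst omega_word_insert_sum) (auto intro: inj_on_subset)
      also have "\<dots> = ?W s (b s) * (\<Prod>s'\<in>N - {s}. ?W s' (b s')) * (?d (Inr s) / (u i - z s) + (\<Sum>q\<in>set (b s). ?d (Inl q) / (u i - u q)))"
        by (simp only: mult_ac)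
      also have "?W s (b s) * (\<Prod>s'\<in>N - {s}. ?W s' (b s')) = (\<Prod>s\<in>N. ?W s (b s))"
        using s assms(1) by (subst prod.remove[of N s]) auto
      finally show ?thesis .
    qed
    then have "(\<Sum>s\<in>N. \<Sum>k\<le>length (b s). \<Prod>s'\<in>N. ?W s' ((b(s := insert_at k i (b s))) s'))
       = (\<Prod>s\<in>N. ?W s (b s)) * ((\<Sum>s\<in>N. ?d (Inr s) / (u i - z s)) + (\<Sum>s\<in>N. \<Sum>q\<in>set (b s). ?d (Inl q) / (u i - u q)))"
      by (simp add: sum_distrib_left[symmetric] sum.distrib[symmetric] del: fun_upd_apply)
    \<comment> \<open>The words of \<open>b\<close> exhaust \<open>M\<close>, so the slots and the
      labels in them run through all possible targets, exactly one of which is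
      \<open>p i\<close>.\<close>
    also have "(\<Sum>s\<in>N. \<Sum>q\<in>set (b s). ?d (Inl q) / (u i - u q)) = (\<Sum>q\<in>M. ?d (Inl q) / (u i - u q))"
      unfolding label_tuplesD(4)[OF b, symmetric]
      using assms(1) label_tuplesD(3)[OF b] by (subst sum.UNION_disjoint) auto
    also have "(\<Sum>s\<in>N. ?d (Inr s) / (u i - z s)) + (\<Sum>q\<in>M. ?d (Inl q) / (u i - u q))
        = (\<Sum>x\<in>targets N M. ?d x / (u i - target_val u z x))"
      using L(3) assms(1) by (simp add: sum_targets)
    also have "\<dots> = (\<Sum>x\<in>targets N M. if p i = x then 1 / (u i - target_val u z x) else 0)"
      by (intro sum.cong) auto
    also have "\<dots> = 1 / (u i - target_val u z (p i))"
    proof -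
      have "p i \<in> targets N M" using Suc.prems(3) i L unfolding targets_def by fastforce
      then show ?thesis using L(3) assms(1) by (subst sum.delta') auto
    qed
    finally show "(\<Sum>s\<in>N. \<Sum>k\<le>length (b s). \<Prod>s'\<in>N. ?W s' ((b(s := insert_at k i (b s))) s'))
       = (\<Prod>s\<in>N. ?W s (b s)) / (u i - target_val u z (p i))" by simp
  qed
  also have "\<dots> = (\<Prod>i\<in>M. 1 / (u i - target_val u z (p i))) / (u i - target_val u z (p i))"
    unfolding IH[symmetric] by (simp add: sum_divide_distrib prod.distrib)
  also have "\<dots> = (\<Prod>i\<in>L. 1 / (u i - target_val u z (p i)))"
    using L by simp
  finally show ?case by (simp add: prod.distrib)
qed

text \<open>The last label of the word that lies in \<open>Y\<close> points into \<open>Y\<close>,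
  hence neither to a later label nor to the slot: its factor is zero.\<close>

lemma chain_weight_cycle:
  assumes "\<And>i. i \<in> Y \<Longrightarrow> p i \<in> Inl ` Y" "Y \<inter> set a \<noteq> {}" "distinct a"
  shows "chain_weight (delta_weight p) s a = 0"
  using assms(2,3)
proof (induction a)
  case (Cons i a)
  show ?case
  proof (cases "Y \<inter> set a = {}")
    case True
    then have "i \<in> Y" using Cons.prems by auto
    then obtain q where "p i = Inl q" "q \<in> Y" using assms(1) by blast
    moreover have "q \<notin> set a" using True \<open>q \<in> Y\<close> by auto
    ultimately show ?thesis by simp
  qed (use Cons in simp)
qed simp

lemma omega_nonforest_sum:
  assumes "finite N" "\<not> is_forest L p" "b \<in> label_tuples N L"
  shows "(\<Prod>s\<in>N. chain_weight (delta_weight p) s (b s)) = 0"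
proof -
  obtain Y where Y: "Y \<subseteq> L" "Y \<noteq> {}" "\<And>i. i \<in> Y \<Longrightarrow> p i \<in> Inl ` Y"
    using assms(2) unfolding is_forest_def by blast
  then obtain i where i: "i \<in> Y" "i \<in> L" by blast
  let ?s = "slot_of N b i"
  have "Y \<inter> set (b ?s) \<noteq> {}" using slot_of[OF assms(3) i(2)] i by blast
  then have "chain_weight (delta_weight p) ?s (b ?s) = 0"
  proof (intro chain_weight_cycle)
    show "p j \<in> Inl ` Y" if "j \<in> Y" for j by (rule Y(3)[OF that])
    show "distinct (b ?s)" by (rule label_tuplesD(1)[OF assms(3) slot_of(1)[OF assms(3) i(2)]])
  qed
  then show ?thesis using slot_of(1)[OF assms(3) i(2)] by (intro prod_zero[OF assms(1)]) auto
qed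

text \<open>The weights \<open>w\<close> are free and will carry the dependence on a second point;
  \<open>u\<close> enters through the chains and reappears in one denominator per edge.\<close>

theorem omega_chain_sum_eq_forest_sum:
  assumes "finite N" "finite L" "inj_on u L" "\<And>s. s \<in> N \<Longrightarrow> z s \<notin> u ` L"
  shows "(\<Sum>b\<in>label_tuples N L. (\<Prod>s\<in>N. omega_word u (z s) (b s)) * (\<Prod>s\<in>N. chain_weight w s (b s)))
    = (\<Sum>p\<in>{p \<in> PiE L (\<lambda>_. targets N L). is_forest L p}. \<Prod>i\<in>L. w i (p i) / (u i - target_val u z (p i)))"
proof -
  let ?P = "PiE L (\<lambda>_. targets N L)"
  let ?om = "\<lambda>b. \<Prod>s\<in>N. omega_word u (z s) (b s)"
  let ?G = "\<lambda>p b. \<Prod>s\<in>N. chain_weight (delta_weight p) s (b s)"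
  have fP: "finite ?P" using assms by (intro finite_PiE) auto
  have "(\<Sum>b\<in>label_tuples N L. ?om b * (\<Prod>s\<in>N. chain_weight w s (b s)))
    = (\<Sum>b\<in>label_tuples N L. \<Sum>p\<in>?P. (\<Prod>i\<in>L. w i (p i)) * (?om b * ?G p b))"
    by (intro sum.cong refl)
      (simp add: prod_chain_weight_expand[OF assms(1,2)] sum_distrib_left mult_ac)
  also have "\<dots> = (\<Sum>p\<in>?P. (\<Prod>i\<in>L. w i (p i)) * (\<Sum>b\<in>label_tuples N L. ?om b * ?G p b))"
    by (subst sum.swap) (simp add: sum_distrib_left)
  also have "\<dots> = (\<Sum>p\<in>?P. if is_forest L p then \<Prod>i\<in>L. w i (p i) / (u i - target_val u z (p i)) else 0)"
  proof (intro sum.cong refl)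
    fix p assume p: "p \<in> ?P"
    show "(\<Prod>i\<in>L. w i (p i)) * (\<Sum>b\<in>label_tuples N L. ?om b * ?G p b) =
      (if is_forest L p then \<Prod>i\<in>L. w i (p i) / (u i - target_val u z (p i)) else 0)"
    proof (cases "is_forest L p")
      case True
      have "(\<Sum>b\<in>label_tuples N L. ?om b * ?G p b) = (\<Prod>i\<in>L. 1 / (u i - target_val u z (p i)))"
        using p assms True by (intro omega_forest_sum) auto
      then show ?thesis using True by (simp add: prod.distrib[symmetric] prod_dividef)
    next
      case False
      then show ?thesis using omega_nonforest_sum[OF assms(1) False] by simp
    qed
  qed
  also have "\<dots> = (\<Sum>p\<in>{p \<in> ?P. is_forest L p}. \<Prod>i\<in>L. w i (p i) / (u i - target_val u z (p i)))"
    using fP by (simp add: sum.inter_filter)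
  finally show ?thesis .
qed

section \<open>The matrix-tree theorem\<close>

text \<open>The Laplacian of the single map \<open>p\<close> with unit weights; an edge to a root
  shows on the diagonal only.\<close>

definition forest_mat :: "nat \<Rightarrow> (nat \<Rightarrow> nat + nat) \<Rightarrow> complex mat" where
  "forest_mat m p = mat m m (\<lambda>(i, j). (if i = j then 1 else 0) - (if p i = Inl j then 1 else 0))"

lemma is_forestD:
  assumes "is_forest L p" "Y \<subseteq> L" "Y \<noteq> {}"
  obtains i where "i \<in> Y" "p i \<notin> Inl ` Y"
  using assms unfolding is_forest_def by blast

lemma forest_mat_carrier: "forest_mat m p \<in> carrier_mat m m"
  by (simp add: forest_mat_def)

text \<open>In the Leibniz expansion a permutation other than the identity contributes only if it
  agrees with \<open>p\<close> on the set \<open>Y\<close> of points it moves; then \<open>p\<close>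
  would map \<open>Y\<close> into itself.\<close>

lemma det_forest_mat:
  assumes "is_forest {0..<m} p"
  shows "Determinant.det (forest_mat m p) = 1"
proof -
  let ?f = "\<lambda>\<pi>. signof \<pi> * (\<Prod>i = 0..<m. forest_mat m p $$ (i, \<pi> i))"
  have zero: "?f \<pi> = 0" if \<pi>: "\<pi> permutes {0..<m}" "\<pi> \<noteq> id" for \<pi>
  proof -
    define Y where "Y = {i \<in> {0..<m}. \<pi> i \<noteq> i}"
    have "Y \<noteq> {}"
    proof
      assume "Y = {}"
      then have "\<pi> i = i" for i using permutes_not_in[OF \<pi>(1), of i] by (cases "i < m") (auto simp: Y_def)
      then show False using \<pi>(2) by (auto simp: fun_eq_iff)
    qed
    moreover have "Y \<subseteq> {0..<m}" by (auto simp: Y_def)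
    ultimately obtain i where "i \<in> Y" and pi: "p i \<notin> Inl ` Y" by (elim is_forestD[OF assms])
    then have i: "i < m" "\<pi> i \<noteq> i" by (auto simp: Y_def)
    have "\<pi> i \<in> {0..<m}" using permutes_in_image[OF \<pi>(1), of i] i(1) by simp
    then have "\<pi> i \<in> Y" using i(2) by (simp add: Y_def inj_eq[OF permutes_inj[OF \<pi>(1)]])
    then have "p i \<noteq> Inl (\<pi> i)" using pi by auto
    then have "forest_mat m p $$ (i, \<pi> i) = 0"
      using i \<open>\<pi> i \<in> {0..<m}\<close> by (auto simp: forest_mat_def)
    then have "(\<Prod>i = 0..<m. forest_mat m p $$ (i, \<pi> i)) = 0"
      using i(1) by (intro prod_zero) auto
    then show ?thesis by simp
  qed
  have "p i \<noteq> Inl i" if "i < m" for i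
    using assms that unfolding is_forest_def by (auto dest!: spec[of _ "{i}"])
  then have one: "?f id = 1" by (simp add: forest_mat_def)
  have "Determinant.det (forest_mat m p) = (\<Sum>\<pi>\<in>{\<pi>. \<pi> permutes {0..<m}}. ?f \<pi>)"
    by (rule det_def'[OF forest_mat_carrier])
  also have "\<dots> = (\<Sum>\<pi>\<in>{\<pi>. \<pi> permutes {0..<m}}. if \<pi> = id then 1 else 0)"
    by (intro sum.cong refl) (use zero one in auto)
  also have "\<dots> = 1" by (subst sum.delta) (auto simp: permutes_id finite_permutations)
  finally show ?thesis .
qed

text \<open>The indicator vector of the largest set \<open>Z\<close> that \<open>p\<close> maps into
  itself lies in the kernel. Maximality serves the rows outside \<open>Z\<close>: there
  \<open>p i\<close> is outside \<open>Z\<close> as well, so that the row gives 0 and not -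
  1.\<close>

lemma det_nonforest_mat:
  assumes "\<not> is_forest {0..<m} p"
  shows "Determinant.det (forest_mat m p) = 0"
proof -
  let ?C = "{Y. Y \<subseteq> {0..<m} \<and> (\<forall>i\<in>Y. p i \<in> Inl ` Y)}"
  define Z where "Z = \<Union> ?C"
  have Z1: "Z \<subseteq> {0..<m}" unfolding Z_def by (rule Union_least) simp
  have Z2: "p i \<in> Inl ` Z" if i: "i \<in> Z" for i
  proof -
    obtain Y where Y: "Y \<in> ?C" "i \<in> Y" using i unfolding Z_def by (rule UnionE)
    then have "Inl ` Y \<subseteq> (Inl ` Z :: (nat + nat) set)" unfolding Z_def by (intro image_mono Union_upper)
    then show ?thesis using Y by auto
  qed
  have max: "i \<in> Z" if "i < m" "p i \<in> Inl ` Z" for i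
  proof -
    have "p j \<in> Inl ` insert i Z" if "j \<in> insert i Z" for j
      using Z2[of j] that \<open>p i \<in> Inl ` Z\<close> image_mono[OF subset_insertI[of Z i], of "Inl :: nat \<Rightarrow> nat + nat"]
      by (cases "j = i") (auto simp del: image_insert)
    then have "insert i Z \<in> ?C" using that(1) Z1 by simp
    then have "insert i Z \<subseteq> Z" unfolding Z_def by (rule Union_upper)
    then show ?thesis by simp
  qed
  obtain Y where Y: "Y \<subseteq> {0..<m}" "Y \<noteq> {}" "\<forall>i\<in>Y. p i \<in> Inl ` Y"
    using assms unfolding is_forest_def by auto
  then have "Y \<subseteq> Z" unfolding Z_def by (intro Union_upper) simp
  then obtain i0 where i0: "i0 \<in> Z" using Y(2) by auto
  define v :: "complex vec" where "v = vec m (\<lambda>i. if i \<in> Z then 1 else 0)"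
  have "forest_mat m p *\<^sub>v v = 0\<^sub>v m"
  proof (rule eq_vecI)
    fix i assume "i < dim_vec (0\<^sub>v m :: complex vec)"
    then have i: "i < m" by simp
    have "(forest_mat m p *\<^sub>v v) $ i = (\<Sum>j = 0..<m. (if i = j then if j \<in> Z then 1 else 0 else 0)
        - (if p i = Inl j then if j \<in> Z then 1 else 0 else 0))"
      using i by (auto simp: forest_mat_def v_def scalar_prod_def intro!: sum.cong)
    also have "\<dots> = (if i \<in> Z then 1 else 0) - (\<Sum>j = 0..<m. if p i = Inl j then if j \<in> Z then 1 else 0 else 0)"
      unfolding sum_subtractf using i by (subst sum.delta') auto
    also have "(\<Sum>j = 0..<m. if p i = Inl j then if j \<in> Z then 1 else 0 else 0 :: complex) = (if i \<in> Z then 1 else 0)"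
    proof (cases "i \<in> Z")
      case True
      then obtain q where q: "p i = Inl q" "q \<in> Z" using Z2[OF True] by auto
      then have "(\<Sum>j = 0..<m. if p i = Inl j then if j \<in> Z then 1 else 0 else 0 :: complex)
          = (\<Sum>j = 0..<m. if q = j then 1 else 0)" by (intro sum.cong) auto
      also have "\<dots> = 1" using q(2) Z1 by (subst sum.delta') auto
      finally show ?thesis using True by simp
    next
      case False
      then have "p i \<notin> Inl ` Z" using max[OF i] by auto
      then have "(if p i = Inl j then if j \<in> Z then 1 else 0 else 0 :: complex) = 0" for j by auto
      then show ?thesis using False by simp
    qed
    finally show "(forest_mat m p *\<^sub>v v) $ i = 0\<^sub>v m $ i" using i by simp
  qed (simp add: forest_mat_def)
  moreover have "v \<noteq> 0\<^sub>v m"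
  proof
    assume "v = 0\<^sub>v m"
    then have "v $ i0 = 0" using i0 Z1 by auto
    then show False using i0 Z1 by (auto simp: v_def)
  qed
  ultimately show ?thesis
    by (subst det_0_iff_vec_prod_zero[of _ m]) (auto simp: forest_mat_def v_def intro!: exI[of _ v])
qed

text \<open>Row \<open>i\<close> is the sum over \<open>x\<close> of \<open>a i x\<close> times row
  \<open>i\<close> of \<open>forest_mat\<close> for a map sending \<open>i\<close> to
  \<open>x\<close>. By multilinearity in the rows, the determinant is a sum over maps
  \<open>p\<close> of the product of their weights times the determinant of
  \<open>forest_mat m p\<close>, which is 1 for forests and 0 otherwise. The loop weights
  \<open>a i (Inl i)\<close> cancel on the diagonal.\<close>

theorem det_eq_forest_sum:
  fixes a :: "nat \<Rightarrow> nat + nat \<Rightarrow> complex"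
  assumes "finite N"
  shows "Determinant.det (mat m m (\<lambda>(i, j). (if i = j then \<Sum>x\<in>targets N {0..<m}. a i x else 0) - a i (Inl j)))
    = (\<Sum>p\<in>{p \<in> PiE {0..<m} (\<lambda>_. targets N {0..<m}). is_forest {0..<m} p}. \<Prod>i\<in>{0..<m}. a i (p i))"
    (is "Determinant.det ?M = _")
proof -
  let ?X = "targets N {0..<m}"
  let ?P = "PiE {0..<m} (\<lambda>_. ?X)"
  have fP: "finite ?P" using assms by (intro finite_PiE) auto
  have car: "?M \<in> carrier_mat m m" by simp
  have row: "(\<Prod>i = 0..<m. ?M $$ (i, \<pi> i)) = (\<Sum>p\<in>?P. (\<Prod>i = 0..<m. a i (p i)) * (\<Prod>i = 0..<m. forest_mat m p $$ (i, \<pi> i)))"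
    if \<pi>: "\<pi> permutes {0..<m}" for \<pi>
  proof -
    have \<pi>m: "\<pi> i < m" if "i < m" for i using permutes_in_image[OF \<pi>, of i] that by simp
    have "(\<Prod>i = 0..<m. ?M $$ (i, \<pi> i)) =
      (\<Prod>i = 0..<m. \<Sum>x\<in>?X. a i x * ((if i = \<pi> i then 1 else 0) - (if x = Inl (\<pi> i) then 1 else 0)))"
    proof (intro prod.cong refl)
      fix i assume i: "i \<in> {0..<m}"
      have "Inl (\<pi> i) \<in> ?X" using \<pi>m i by (auto simp: targets_def)
      then have "(\<Sum>x\<in>?X. a i x * (if x = Inl (\<pi> i) then 1 else 0)) = a i (Inl (\<pi> i))"
        using assms by (subst sum.mono_neutral_right[of _ "{Inl (\<pi> i)}"]) auto
      then show "?M $$ (i, \<pi> i) = (\<Sum>x\<in>?X. a i x * ((if i = \<pi> i then 1 else 0) - (if x = Inl (\<pi> i) then 1 else 0)))"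
        using i \<pi>m[of i] by (simp add: right_diff_distrib sum_subtractf)
    qed
    also have "\<dots> = (\<Sum>p\<in>?P. \<Prod>i = 0..<m. a i (p i) * ((if i = \<pi> i then 1 else 0) - (if p i = Inl (\<pi> i) then 1 else 0)))"
      using assms by (subst prod_sum_PiE) auto
    also have "\<dots> = (\<Sum>p\<in>?P. (\<Prod>i = 0..<m. a i (p i)) * (\<Prod>i = 0..<m. forest_mat m p $$ (i, \<pi> i)))"
      unfolding prod.distrib[symmetric] by (intro sum.cong prod.cong refl) (simp add: forest_mat_def \<pi>m)
    finally show ?thesis .
  qed
  have "Determinant.det ?M = (\<Sum>\<pi>\<in>{\<pi>. \<pi> permutes {0..<m}}. signof \<pi> * (\<Prod>i = 0..<m. ?M $$ (i, \<pi> i)))"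
    by (rule det_def'[OF car])
  also have "\<dots> = (\<Sum>\<pi>\<in>{\<pi>. \<pi> permutes {0..<m}}. \<Sum>p\<in>?P. (\<Prod>i = 0..<m. a i (p i)) *
      (signof \<pi> * (\<Prod>i = 0..<m. forest_mat m p $$ (i, \<pi> i))))"
    by (intro sum.cong refl, subst row) (simp_all add: sum_distrib_left mult_ac)
  also have "\<dots> = (\<Sum>p\<in>?P. (\<Prod>i = 0..<m. a i (p i)) * Determinant.det (forest_mat m p))"
    by (subst sum.swap) (simp add: sum_distrib_left det_def'[OF forest_mat_carrier])
  also have "\<dots> = (\<Sum>p\<in>?P. if is_forest {0..<m} p then \<Prod>i = 0..<m. a i (p i) else 0)"
    by (intro sum.cong refl) (simp add: det_forest_mat det_nonforest_mat)
  also have "\<dots> = (\<Sum>p\<in>{p \<in> ?P. is_forest {0..<m} p}. \<Prod>i\<in>{0..<m}. a i (p i))"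
    using fP by (simp add: sum.inter_filter)
  finally show ?thesis .
qed

text \<open>The edge from \<open>i\<close> to \<open>x\<close> has the weight \<open>w i x / ((t i - t x) (u i - u x))\<close>, where \<open>t x = u x = z s\<close> for a root
  \<open>x = Inr s\<close>. Terms with \<open>x = Inl i\<close> are zero, because \<open>a / 0 = 0\<close>.\<close>

definition laplacian :: "nat set \<Rightarrow> nat \<Rightarrow> (nat \<Rightarrow> nat + nat \<Rightarrow> complex) \<Rightarrow> (nat \<Rightarrow> complex)
    \<Rightarrow> (nat \<Rightarrow> complex) \<Rightarrow> (nat \<Rightarrow> complex) \<Rightarrow> complex mat" where
  "laplacian N m w z t u = mat m m (\<lambda>(i, j).
     (if i = j then \<Sum>x\<in>targets N {0..<m}. w i x / ((t i - target_val t z x) * (u i - target_val u z x)) else 0)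
     - w i (Inl j) / ((t i - t j) * (u i - u j)))"

corollary omega_chain_sum_eq_det:
  assumes "finite N" "inj_on u {0..<m}" "\<And>s. s \<in> N \<Longrightarrow> z s \<notin> u ` {0..<m}"
  shows "(\<Sum>b\<in>label_tuples N {0..<m}. (\<Prod>s\<in>N. omega_word u (z s) (b s)) *
      (\<Prod>s\<in>N. chain_weight (\<lambda>i x. w i x / (t i - target_val t z x)) s (b s)))
    = Determinant.det (laplacian N m w z t u)"
proof -
  have *: "laplacian N m w z t u = mat m m (\<lambda>(i, j).
      (if i = j then \<Sum>x\<in>targets N {0..<m}. w i x / (t i - target_val t z x) / (u i - target_val u z x) else 0)
     - w i (Inl j) / (t i - target_val t z (Inl j)) / (u i - target_val u z (Inl j)))"
    unfolding laplacian_def by (rule cong_mat) auto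
  show ?thesis
    unfolding * using assms
    by (subst omega_chain_sum_eq_forest_sum, simp, simp, simp, simp) (subst det_eq_forest_sum, auto)
qed

section \<open>Permutations preserving colours\<close>

text \<open>For finite \<open>L\<close>, the product of the symmetric groups on the colour
  classes.\<close>

definition color_perms :: "('a \<Rightarrow> 'c) \<Rightarrow> 'a set \<Rightarrow> ('a \<Rightarrow> 'a) set" where
  "color_perms c L = {\<pi>. \<pi> permutes L \<and> (\<forall>i\<in>L. c (\<pi> i) = c i)}"

lemma finite_color_perms [simp]: "finite L \<Longrightarrow> finite (color_perms c L)"
  unfolding color_perms_def using finite_permutations[of L] by (rule rev_finite_subset) auto

lemma relabel_tuple:
  assumes "b \<in> label_tuples N L" "\<pi> permutes L"
  shows "(\<lambda>s\<in>N. map \<pi> (b s)) \<in> label_tuples N L"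
  using label_tuples_map[OF permutes_inj_on[OF assms(2)] assms(1)] permutes_image[OF assms(2)] by simp

text \<open>Colour preserving permutations act simply transitively on the tuples with a given colour
  pattern: the permutation is read off by comparing the labels at equal places of \<open>b\<close>
  and \<open>b'\<close>.\<close>

lemma bij_betw_relabel:
  assumes "finite L" "b \<in> label_tuples N L"
  shows "bij_betw (\<lambda>\<pi>. \<lambda>s\<in>N. map \<pi> (b s)) (color_perms c L)
    {b' \<in> label_tuples N L. \<forall>s\<in>N. map c (b' s) = map c (b s)}"
proof (rule bij_betw_imageI)
  let ?F = "\<lambda>\<pi>. \<lambda>s\<in>N. map \<pi> (b s)"
  show "inj_on ?F (color_perms c L)"
  proof (rule inj_onI)
    fix \<pi> \<rho> assume pr: "\<pi> \<in> color_perms c L" "\<rho> \<in> color_perms c L" "?F \<pi> = ?F \<rho>"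
    have "\<pi> i = \<rho> i" for i
    proof (cases "i \<in> L")
      case True
      let ?s = "slot_of N b i"
      have "map \<pi> (b ?s) = map \<rho> (b ?s)"
        using fun_cong[OF pr(3), of ?s] slot_of(1)[OF assms(2) True] by simp
      then show ?thesis using slot_of(2)[OF assms(2) True] by simp
    next
      case False
      then show ?thesis using pr(1,2) by (auto simp: color_perms_def permutes_def)
    qed
    then show "\<pi> = \<rho>" by (rule ext)
  qed
  show "?F ` color_perms c L = {b' \<in> label_tuples N L. \<forall>s\<in>N. map c (b' s) = map c (b s)}"
  proof (intro equalityI subsetI)
    fix y assume "y \<in> ?F ` color_perms c L"
    then obtain \<pi> where p: "\<pi> permutes L" "\<And>i. i \<in> L \<Longrightarrow> c (\<pi> i) = c i" "y = ?F \<pi>"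
      unfolding color_perms_def by blast
    have "map c (y s) = map c (b s)" if "s \<in> N" for s
      using that p(2) label_tuplesD(2)[OF assms(2) that] by (auto simp: p(3))
    then show "y \<in> {b' \<in> label_tuples N L. \<forall>s\<in>N. map c (b' s) = map c (b s)}"
      using relabel_tuple[OF assms(2) p(1)] p(3) by simp
  next
    fix b' assume "b' \<in> {b' \<in> label_tuples N L. \<forall>s\<in>N. map c (b' s) = map c (b s)}"
    then have b': "b' \<in> label_tuples N L" "\<And>s. s \<in> N \<Longrightarrow> map c (b' s) = map c (b s)" by auto
    have len: "length (b' s) = length (b s)" if "s \<in> N" for s
      using b'(2)[OF that] by (metis length_map)
    have pos: "\<exists>k. k < length (b (slot_of N b i)) \<and> b (slot_of N b i) ! k = i" if "i \<in> L" for i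
      using slot_of(2)[OF assms(2) that] by (simp add: in_set_conv_nth)
    define idx where "idx i = (SOME k. k < length (b (slot_of N b i)) \<and> b (slot_of N b i) ! k = i)" for i
    have idx: "idx i < length (b (slot_of N b i))" "b (slot_of N b i) ! idx i = i" if "i \<in> L" for i
      using someI_ex[OF pos[OF that]] unfolding idx_def by auto
    define \<pi> where "\<pi> i = (if i \<in> L then b' (slot_of N b i) ! idx i else i)" for i
    have \<pi>: "\<pi> (b s ! k) = b' s ! k" if "s \<in> N" "k < length (b s)" for s k
    proof -
      have i: "b s ! k \<in> set (b s)" using that by simp
      then have L: "b s ! k \<in> L" using label_tuplesD(2)[OF assms(2) that(1)] by blast
      have s: "slot_of N b (b s ! k) = s" using slot_of(3)[OF assms(2) L that(1) i] .
      have "idx (b s ! k) = k"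
        using idx[OF L] label_tuplesD(1)[OF assms(2) that(1)] that(2) unfolding s
        by (simp add: nth_eq_iff_index_eq)
      then show ?thesis using L by (simp add: \<pi>_def s)
    qed
    have mapeq: "map \<pi> (b s) = b' s" if "s \<in> N" for s
      using that len[OF that] \<pi>[OF that] by (auto simp: list_eq_iff_nth_eq)
    have img: "\<pi> ` L = L"
    proof -
      have "\<pi> ` L = (\<Union>s\<in>N. set (map \<pi> (b s)))" unfolding label_tuplesD(4)[OF assms(2), symmetric] by auto
      also have "\<dots> = (\<Union>s\<in>N. set (b' s))" using mapeq by auto
      finally show ?thesis using label_tuplesD(4)[OF b'(1)] by simp
    qed
    \<comment> \<open>A map of a finite set onto itself is injective.\<close>
    have "inj_on \<pi> L" using img assms(1) by (metis eq_card_imp_inj_on)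
    then have "\<pi> permutes L" using img by (intro bij_imp_permutes) (auto simp: bij_betw_def \<pi>_def)
    moreover have "c (\<pi> i) = c i" if "i \<in> L" for i
    proof -
      have "map c (map \<pi> (b (slot_of N b i))) = map c (b (slot_of N b i))"
        using slot_of(1)[OF assms(2) that] by (simp only: mapeq b'(2))
      then show ?thesis using slot_of(2)[OF assms(2) that] by simp
    qed
    moreover have "?F \<pi> = b'"
      using mapeq label_tuplesD(5)[OF b'(1)] by (auto simp: extensional_def restrict_def fun_eq_iff)
    ultimately show "b' \<in> ?F ` color_perms c L" unfolding color_perms_def by blast
  qed
qed

text \<open>A tuple with the colours of \<open>b\<close> is \<open>b\<close> relabeled by a unique
  \<pi>, and relabeling a chain is the same as permuting the coordinates of its point. So the double
  sum splits into one matrix-tree sum for each \<pi>, taken at the points \<open>t\<close> and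
  \<open>u \<circ> \<pi>\<close>.\<close>

theorem omega_chain_color_sum_eq_det:
  assumes "finite N" "inj_on u {0..<m}" "\<And>s. s \<in> N \<Longrightarrow> z s \<notin> u ` {0..<m}"
  shows "(\<Sum>b'\<in>label_tuples N {0..<m}. (\<Prod>s\<in>N. omega_word u (z s) (b' s)) *
      (\<Sum>b\<in>{b \<in> label_tuples N {0..<m}. \<forall>s\<in>N. map c (b s) = map c (b' s)}.
         \<Prod>s\<in>N. chain_weight (\<lambda>i x. w i x / (t i - target_val t z x)) s (b s)))
    = (\<Sum>\<pi>\<in>color_perms c {0..<m}. Determinant.det (laplacian N m w z t (u \<circ> \<pi>)))"
proof -
  let ?T = "label_tuples N {0..<m}"
  let ?om = "\<lambda>u b. \<Prod>s\<in>N. omega_word u (z s) (b s)"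
  let ?G = "\<lambda>b. \<Prod>s\<in>N. chain_weight (\<lambda>i x. w i x / (t i - target_val t z x)) s (b s)"
  have fT: "finite ?T" using assms(1) by simp
  have "(\<Sum>b'\<in>?T. ?om u b' * (\<Sum>b\<in>{b \<in> ?T. \<forall>s\<in>N. map c (b s) = map c (b' s)}. ?G b))
    = (\<Sum>b'\<in>?T. \<Sum>b\<in>?T. if \<forall>s\<in>N. map c (b s) = map c (b' s) then ?om u b' * ?G b else 0)"
    unfolding sum.inter_filter[OF fT] sum_distrib_left by (intro sum.cong refl) auto
  also have "\<dots> = (\<Sum>b\<in>?T. \<Sum>b'\<in>{b' \<in> ?T. \<forall>s\<in>N. map c (b' s) = map c (b s)}. ?om u b' * ?G b)"
    unfolding sum.inter_filter[OF fT] by (subst sum.swap) (intro sum.cong refl, metis)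
  also have "\<dots> = (\<Sum>b\<in>?T. \<Sum>\<pi>\<in>color_perms c {0..<m}. ?om (u \<circ> \<pi>) b * ?G b)"
  proof (intro sum.cong refl)
    fix b assume b: "b \<in> ?T"
    have "(\<Sum>b'\<in>{b' \<in> ?T. \<forall>s\<in>N. map c (b' s) = map c (b s)}. ?om u b' * ?G b)
      = (\<Sum>\<pi>\<in>color_perms c {0..<m}. ?om u (\<lambda>s\<in>N. map \<pi> (b s)) * ?G b)"
      by (subst sum.reindex_bij_betw[OF bij_betw_relabel[OF _ b], symmetric]) auto
    also have "\<dots> = (\<Sum>\<pi>\<in>color_perms c {0..<m}. ?om (u \<circ> \<pi>) b * ?G b)"
      by (intro sum.cong refl arg_cong2[of _ _ _ _ "(*)"] prod.cong) (simp_all add: omega_word_map)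
    finally show "(\<Sum>b'\<in>{b' \<in> ?T. \<forall>s\<in>N. map c (b' s) = map c (b s)}. ?om u b' * ?G b)
      = (\<Sum>\<pi>\<in>color_perms c {0..<m}. ?om (u \<circ> \<pi>) b * ?G b)" .
  qed
  also have "\<dots> = (\<Sum>\<pi>\<in>color_perms c {0..<m}. \<Sum>b\<in>?T. ?om (u \<circ> \<pi>) b * ?G b)"
    by (rule sum.swap)
  also have "\<dots> = (\<Sum>\<pi>\<in>color_perms c {0..<m}. Determinant.det (laplacian N m w z t (u \<circ> \<pi>)))"
  proof (intro sum.cong refl)
    fix \<pi> assume "\<pi> \<in> color_perms c {0..<m}"
    then have p: "\<pi> permutes {0..<m}" by (simp add: color_perms_def)
    have i: "inj_on (u \<circ> \<pi>) {0..<m}"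
      using p assms(2) by (intro comp_inj_on) (auto simp: permutes_image permutes_inj_on)
    have "(u \<circ> \<pi>) ` {0..<m} = u ` {0..<m}" using permutes_image[OF p] by (metis image_comp)
    then show "(\<Sum>b\<in>?T. ?om (u \<circ> \<pi>) b * ?G b) = Determinant.det (laplacian N m w z t (u \<circ> \<pi>))"
      using omega_chain_sum_eq_det[OF assms(1) i] assms(3) by simp
  qed
  finally show ?thesis .
qed

section \<open>Generators of the Lie algebra\<close>

lemma chev_carrier [simp]:
  "chev_E r i \<in> carrier_mat (Suc r) (Suc r)" "chev_F r i \<in> carrier_mat (Suc r) (Suc r)"
  "chev_H r i \<in> carrier_mat (Suc r) (Suc r)"
  by (auto simp: chev_E_def chev_F_def chev_H_def)

lemma chev_in_sl:
  assumes "i \<in> {1..r}"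
  shows "chev_E r i \<in> sl r" "chev_F r i \<in> sl r" "chev_H r i \<in> sl r" "chev_H r i \<in> cartan r"
proof -
  have "(\<Sum>k<r + 1. chev_E r i $$ (k, k)) = 0" "(\<Sum>k<r + 1. chev_F r i $$ (k, k)) = 0"
    by (rule sum.neutral, use assms in \<open>auto simp: chev_E_def chev_F_def\<close>)+
  then show "chev_E r i \<in> sl r" "chev_F r i \<in> sl r" unfolding sl_def by auto
  have "(\<Sum>k<r + 1. chev_H r i $$ (k, k)) = (\<Sum>k<r + 1. (if k = i - 1 then 1 else 0) - (if k = i then 1 else 0))"
    unfolding chev_H_eq[OF assms] by (intro sum.cong) auto
  also have "\<dots> = 0" unfolding sum_subtractf using assms by (subst (1 2) sum.delta) auto
  finally show "chev_H r i \<in> sl r" unfolding sl_def by simp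
  then show "chev_H r i \<in> cartan r" unfolding cartan_def chev_H_eq[OF assms] by (auto simp: diagonal_mat_def)
qed

section \<open>Matrix units and brackets of the Chevalley generators\<close>

definition mat_unit :: "nat \<Rightarrow> nat \<Rightarrow> nat \<Rightarrow> complex mat" where
  "mat_unit r a b = mat (r + 1) (r + 1) (\<lambda>(x, y). if x = a \<and> y = b then 1 else 0)"

lemma mat_unit_carrier [simp]: "mat_unit r a b \<in> carrier_mat (r + 1) (r + 1)"
  by (simp add: mat_unit_def)

lemma mat_unit_mult:
  assumes "b \<le> r"
  shows "mat_unit r a b * mat_unit r c d = (if b = c then mat_unit r a d else 0\<^sub>m (r + 1) (r + 1))"
proof (rule eq_matI)
  fix i j assume "i < dim_row (if b = c then mat_unit r a d else 0\<^sub>m (r + 1) (r + 1))"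
    "j < dim_col (if b = c then mat_unit r a d else 0\<^sub>m (r + 1) (r + 1))"
  then have ij: "i < r + 1" "j < r + 1" by (auto simp: mat_unit_def split: if_splits)
  then have "(mat_unit r a b * mat_unit r c d) $$ (i, j)
      = (\<Sum>k = 0..<r + 1. (if i = a \<and> k = b then 1 else 0) * (if k = c \<and> j = d then 1 else 0))"
    by (simp add: mat_unit_def scalar_prod_def del: sum.op_ivl_Suc)
  also have "\<dots> = (\<Sum>k = 0..<r + 1. if k = b then (if i = a \<and> b = c \<and> j = d then 1 else 0) else 0)"
    by (intro sum.cong) auto
  also have "\<dots> = (if i = a \<and> b = c \<and> j = d then 1 else 0)" using assms by (subst sum.delta) auto
  finally show "(mat_unit r a b * mat_unit r c d) $$ (i, j) =
      (if b = c then mat_unit r a d else 0\<^sub>m (r + 1) (r + 1)) $$ (i, j)"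
    using ij by (simp add: mat_unit_def)
qed (auto simp: mat_unit_def)

lemma chev_E_eq_unit: "chev_E r i = mat_unit r (i - 1) i"
  by (simp add: chev_E_def mat_unit_def)

lemma chev_F_eq_unit: "chev_F r i = mat_unit r i (i - 1)"
  by (simp add: chev_F_def mat_unit_def)

lemma mat_unit_in_sl: "a \<noteq> b \<Longrightarrow> mat_unit r a b \<in> sl r"
  unfolding sl_def by (auto simp: mat_unit_def intro!: sum.neutral)

lemma bracket_E_F:
  assumes "i \<in> {1..r}" "j \<in> {1..r}"
  shows "chev_E r j * chev_F r i - chev_F r i * chev_E r j = (if i = j then chev_H r j else 0\<^sub>m (r + 1) (r + 1))"
proof (cases "i = j")
  case False
  then show ?thesis using assms
    unfolding chev_E_eq_unit chev_F_eq_unit by (subst (1 2) mat_unit_mult) auto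
qed (simp add: chev_H_def)

lemma bracket_H_F:
  assumes "i \<in> {1..r}" "j \<in> {1..r}"
  shows "chev_H r j * chev_F r i - chev_F r i * chev_H r j = (- simple_root i (chev_H r j)) \<cdot>\<^sub>m chev_F r i"
proof -
  have H: "chev_H r j $$ (k, k) = (if k = j - 1 then 1 else 0) - (if k = j then 1 else 0)" if "k \<le> r" for k
    unfolding chev_H_eq[OF assms(2)] using that by simp
  have "(chev_H r j * chev_F r i) $$ (a, b) = chev_H r j $$ (a, a) * chev_F r i $$ (a, b)"
    "(chev_F r i * chev_H r j) $$ (a, b) = chev_F r i $$ (a, b) * chev_H r j $$ (b, b)"
    if ab: "a < r + 1" "b < r + 1" for a b
  proof -
    have z: "chev_H r j $$ (x, y) = 0" if "x \<noteq> y" "x < r + 1" "y < r + 1" for x y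
      unfolding chev_H_eq[OF assms(2)] using that by simp
    have "(chev_H r j * chev_F r i) $$ (a, b) = (\<Sum>k = 0..<r + 1. chev_H r j $$ (a, k) * chev_F r i $$ (k, b))"
      using ab chev_carrier[of r i] chev_carrier[of r j]
      by (auto simp: scalar_prod_def simp del: sum.op_ivl_Suc chev_carrier intro!: sum.cong)
    also have "\<dots> = (\<Sum>k = 0..<r + 1. if k = a then chev_H r j $$ (a, a) * chev_F r i $$ (a, b) else 0)"
      using ab z by (intro sum.cong) auto
    also have "\<dots> = chev_H r j $$ (a, a) * chev_F r i $$ (a, b)" using ab by (subst sum.delta) auto
    finally show "(chev_H r j * chev_F r i) $$ (a, b) = chev_H r j $$ (a, a) * chev_F r i $$ (a, b)" .
    have "(chev_F r i * chev_H r j) $$ (a, b) = (\<Sum>k = 0..<r + 1. chev_F r i $$ (a, k) * chev_H r j $$ (k, b))"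
      using ab chev_carrier[of r i] chev_carrier[of r j]
      by (auto simp: scalar_prod_def simp del: sum.op_ivl_Suc chev_carrier intro!: sum.cong)
    also have "\<dots> = (\<Sum>k = 0..<r + 1. if k = b then chev_F r i $$ (a, b) * chev_H r j $$ (b, b) else 0)"
      using ab z by (intro sum.cong) auto
    also have "\<dots> = chev_F r i $$ (a, b) * chev_H r j $$ (b, b)" using ab by (subst sum.delta) auto
    finally show "(chev_F r i * chev_H r j) $$ (a, b) = chev_F r i $$ (a, b) * chev_H r j $$ (b, b)" .
  qed
  note e = this
  show ?thesis
  proof (rule eq_matI)
    fix a b assume "a < dim_row ((- simple_root i (chev_H r j)) \<cdot>\<^sub>m chev_F r i)"
      "b < dim_col ((- simple_root i (chev_H r j)) \<cdot>\<^sub>m chev_F r i)"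
    then have ab: "a < r + 1" "b < r + 1" by (auto simp: chev_F_def)
    have "(chev_H r j * chev_F r i - chev_F r i * chev_H r j) $$ (a, b)
       = (chev_H r j $$ (a, a) - chev_H r j $$ (b, b)) * chev_F r i $$ (a, b)"
      using ab chev_carrier[of r i] chev_carrier[of r j]
      by (subst index_minus_mat(1)) (auto simp: e algebra_simps simp del: chev_carrier index_mult_mat(1))
    also have "\<dots> = ((- simple_root i (chev_H r j)) \<cdot>\<^sub>m chev_F r i) $$ (a, b)"
      using ab by (auto simp: chev_F_def simple_root_def)
    finally show "(chev_H r j * chev_F r i - chev_F r i * chev_H r j) $$ (a, b)
       = ((- simple_root i (chev_H r j)) \<cdot>\<^sub>m chev_F r i) $$ (a, b)" .
  qed (use chev_carrier(2)[of r i] chev_carrier(3)[of r j] in \<open>simp_all only: carrier_matD index_minus_mat index_mult_mat index_smult_mat\<close>)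
qed

context sl_module
begin

lemma act_zero_mat: "u \<in> V \<Longrightarrow> act (0\<^sub>m (r + 1) (r + 1)) u = 0"
  using smult_act[of "0\<^sub>m (r + 1) (r + 1)" u 0] by (simp add: sl_def)

lemma act_0: "X \<in> sl r \<Longrightarrow> act X 0 = 0"
  using act_scale[of X 0 0] subspace_0[OF subspace_V] by simp

lemma act_sum:
  assumes "X \<in> sl r" "\<And>k. k \<in> K \<Longrightarrow> u k \<in> V"
  shows "act X (\<Sum>k\<in>K. u k) = (\<Sum>k\<in>K. act X (u k))"
proof (cases "finite K")
  case True
  then show ?thesis using assms(2)
    by (induction K) (simp_all add: act_0 act_add assms(1) subspace_sum[OF subspace_V])
qed (simp add: act_0 assms(1))

text \<open>The off-diagonal matrix units are iterated brackets of the \<open>chev_E\<close> or the \<open>chev_F\<close>.\<close>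

lemma act_closed_of_chevalley:
  assumes U: "subspace U" "U \<subseteq> V"
    and E: "\<And>i u. i \<in> {1..r} \<Longrightarrow> u \<in> U \<Longrightarrow> act (chev_E r i) u \<in> U"
    and F: "\<And>i u. i \<in> {1..r} \<Longrightarrow> u \<in> U \<Longrightarrow> act (chev_F r i) u \<in> U"
    and X: "X \<in> sl r" and u: "u \<in> U"
  shows "act X u \<in> U"
proof -
  define G where "G = {Y \<in> sl r. \<forall>u\<in>U. act Y u \<in> U}"
  have UV: "u \<in> V" if "u \<in> U" for u using that U(2) by auto
  have add: "Y + Z \<in> G" if "Y \<in> G" "Z \<in> G" for Y Z
  proof -
    have "Y + Z \<in> sl r" using that by (auto simp: G_def sl_def sum.distrib simp del: sum.lessThan_Suc)
    then show ?thesis using that by (auto simp: G_def add_act UV subspace_add[OF U(1)])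
  qed
  have smult: "a \<cdot>\<^sub>m Y \<in> G" if "Y \<in> G" for Y a
  proof -
    have "a \<cdot>\<^sub>m Y \<in> sl r" using that by (auto simp: G_def sl_def sum_distrib_left[symmetric] simp del: sum.lessThan_Suc)
    then show ?thesis using that by (auto simp: G_def smult_act UV subspace_scale[OF U(1)])
  qed
  have bracket: "Y * Z - Z * Y \<in> G" if "Y \<in> G" "Z \<in> G" "Y * Z - Z * Y \<in> sl r" for Y Z
    using that by (auto simp: G_def bracket_act UV subspace_diff[OF U(1)])
  have EG: "mat_unit r i (Suc i) \<in> G" and FG: "mat_unit r (Suc i) i \<in> G" if "i < r" for i
    using that E[of "Suc i"] F[of "Suc i"] chev_in_sl[of "Suc i" r]
    by (auto simp: G_def chev_E_eq_unit chev_F_eq_unit)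
  have up: "mat_unit r a (Suc (a + k)) \<in> G" if "a + k < r" for a k
    using that
  proof (induction k)
    case (Suc k)
    let ?Y = "mat_unit r a (Suc (a + k))" and ?Z = "mat_unit r (Suc (a + k)) (Suc (Suc (a + k)))"
    have "?Y * ?Z - ?Z * ?Y = mat_unit r a (Suc (a + Suc k))"
      using Suc.prems by (subst (1 2) mat_unit_mult) (auto simp: mat_unit_def)
    then show ?case using bracket[of ?Y ?Z] Suc EG[of "Suc (a + k)"] by (simp add: mat_unit_in_sl)
  qed (simp add: EG)
  have down: "mat_unit r (Suc (a + k)) a \<in> G" if "a + k < r" for a k
    using that
  proof (induction k)
    case (Suc k)
    let ?Y = "mat_unit r (Suc (a + k)) a" and ?Z = "mat_unit r (Suc (Suc (a + k))) (Suc (a + k))"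
    have "?Z * ?Y - ?Y * ?Z = mat_unit r (Suc (a + Suc k)) a"
      using Suc.prems by (subst (1 2) mat_unit_mult) (auto simp: mat_unit_def)
    then show ?case using bracket[of ?Z ?Y] Suc FG[of "Suc (a + k)"] by (simp add: mat_unit_in_sl)
  qed (simp add: FG)
  have unit: "mat_unit r a b \<in> G" if "a \<noteq> b" "a \<le> r" "b \<le> r" for a b
  proof (cases "a < b")
    case True
    then show ?thesis using up[of a "b - a - 1"] that by simp
  next
    case False
    then show ?thesis using down[of b "a - b - 1"] that by simp
  qed
  have zero: "0\<^sub>m (r + 1) (r + 1) \<in> G"
    using subspace_0[OF U(1)] by (auto simp: G_def sl_def act_zero_mat[simplified] UV)
  have H: "chev_H r i \<in> G" if "i \<in> {1..r}" for i
    unfolding chev_H_def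
  proof (rule bracket)
    show "chev_E r i \<in> G" "chev_F r i \<in> G" using that E F chev_in_sl[OF that] by (auto simp: G_def)
    show "chev_E r i * chev_F r i - chev_F r i * chev_E r i \<in> sl r"
      using chev_in_sl(3)[OF that] by (simp add: chev_H_def)
  qed
  define off where "off S = mat (r + 1) (r + 1) (\<lambda>(a, b). if (a, b) \<in> S then X $$ (a, b) else 0)" for S
  have off: "off S \<in> G" if "finite S" "S \<subseteq> {(a, b). a \<noteq> b \<and> a \<le> r \<and> b \<le> r}" for S
    using that
  proof (induction S)
    case empty
    have "off {} = 0\<^sub>m (r + 1) (r + 1)" by (auto simp: off_def)
    then show ?case using zero by simp
  next
    case (insert x S)
    obtain a b where x: "x = (a, b)" by fastforce
    have "off (insert x S) = off S + X $$ (a, b) \<cdot>\<^sub>m mat_unit r a b"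
      using insert.hyps by (auto simp: off_def mat_unit_def x)
    then show ?case using insert add smult unit by (auto simp: x)
  qed
  \<comment> \<open>The diagonal of \<open>X\<close> cut off after \<open>k\<close> entries, with
    the next entry chosen to make the trace zero. Consecutive cut-offs differ by a multiple of one
    \<open>chev_H\<close>, and \<open>dg r\<close> is the whole diagonal since \<open>X\<close> has
    trace zero.\<close>
  define dg where "dg k = mat (r + 1) (r + 1) (\<lambda>(a, b). if a = b then
      if a < k then X $$ (a, a) else if a = k then - (\<Sum>y<k. X $$ (y, y)) else 0 else 0)" for k
  have dg: "dg k \<in> G" if "k \<le> r" for k
    using that
  proof (induction k)
    case 0
    have "dg 0 = 0\<^sub>m (r + 1) (r + 1)" by (auto simp: dg_def)
    then show ?case using zero by simp
  next
    case (Suc k)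
    have "dg (Suc k) = dg k + (\<Sum>y<Suc k. X $$ (y, y)) \<cdot>\<^sub>m chev_H r (Suc k)"
      using Suc.prems by (subst chev_H_eq) (auto simp: dg_def less_Suc_eq intro!: eq_matI)
    then show ?case using Suc add smult H[of "Suc k"] by simp
  qed
  have "X = off {(a, b). a \<noteq> b \<and> a \<le> r \<and> b \<le> r} + dg r"
  proof -
    have "X $$ (r, r) = - (\<Sum>y<r. X $$ (y, y))" using X by (simp add: sl_def eq_neg_iff_add_eq_0 add.commute)
    then show ?thesis using X by (intro eq_matI) (auto simp: off_def dg_def sl_def less_Suc_eq)
  qed
  moreover have "finite {(a, b). a \<noteq> b \<and> a \<le> r \<and> b \<le> r}"
    by (rule finite_subset[of _ "{..r} \<times> {..r}"]) auto
  ultimately have "X \<in> G" using add off dg by auto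
  then show ?thesis using u by (simp add: G_def)
qed

end

section \<open>Words in a highest weight module\<close>

context irreducible_hw_module
begin

definition F_word :: "nat list \<Rightarrow> 'v" where
  "F_word J = foldr (\<lambda>i. act (chev_F r i)) J v"

lemma F_word_simps [simp]: "F_word [] = v" "F_word (i # J) = act (chev_F r i) (F_word J)"
  by (simp_all add: F_word_def)

lemma F_word_in_V: "set J \<subseteq> {1..r} \<Longrightarrow> F_word J \<in> V"
  by (induction J) (simp_all add: act_closed chev_in_sl hw_vector)

lemma act_H_F_word:
  assumes "j \<in> {1..r}" "set J \<subseteq> {1..r}"
  shows "act (chev_H r j) (F_word J) = scaleV (\<mu> (chev_H r j) - (\<Sum>q\<leftarrow>J. simple_root q (chev_H r j))) (F_word J)"
  using assms(2)
proof (induction J)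
  case Nil
  then show ?case using H_hw_vector chev_in_sl[OF assms(1)] by simp
next
  case (Cons i J)
  let ?H = "chev_H r j" and ?F = "chev_F r i" and ?u = "F_word J"
  let ?c = "\<mu> ?H - (\<Sum>q\<leftarrow>J. simple_root q ?H)"
  have i: "i \<in> {1..r}" and u: "?u \<in> V" using Cons.prems F_word_in_V by auto
  note sl = chev_in_sl(2)[OF i] chev_in_sl(3)[OF assms(1)]
  have "act ?H (act ?F ?u) - act ?F (act ?H ?u) = act (?H * ?F - ?F * ?H) ?u"
    using bracket_act sl u by simp
  also have "\<dots> = scaleV (- simple_root i ?H) (act ?F ?u)"
    unfolding bracket_H_F[OF i assms(1)] by (rule smult_act[OF sl(1) u])
  finally have "act ?H (act ?F ?u) = scaleV (- simple_root i ?H) (act ?F ?u) + act ?F (act ?H ?u)"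
    by (simp add: algebra_simps)
  also have "act ?F (act ?H ?u) = scaleV ?c (act ?F ?u)"
    using Cons act_scale[OF sl(1) u] by simp
  also have "scaleV (- simple_root i ?H) (act ?F ?u) + scaleV ?c (act ?F ?u)
      = scaleV (\<mu> ?H - (\<Sum>q\<leftarrow>i # J. simple_root q ?H)) (act ?F ?u)"
    unfolding scale_left_distrib[symmetric] by (simp add: algebra_simps)
  finally show ?case by simp
qed

text \<open>\<open>chev_E r j\<close> commutes with every letter except \<open>chev_F r j\<close>,
  where the bracket leaves \<open>chev_H r j\<close> acting on the letters to the right by their
  weight; having passed all letters, it kills \<open>v\<close>.\<close>

lemma act_E_F_word:
  assumes "j \<in> {1..r}" "set J \<subseteq> {1..r}"
  shows "act (chev_E r j) (F_word J) = (\<Sum>k<length J. scaleV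
    (if J ! k = j then \<mu> (chev_H r j) - (\<Sum>q\<leftarrow>drop (Suc k) J. simple_root q (chev_H r j)) else 0)
    (F_word (delete_at k J)))"
  using assms(2)
proof (induction J)
  case Nil
  then show ?case using E_hw_vector[OF assms(1)] by simp
next
  case (Cons i J)
  let ?H = "chev_H r j" and ?E = "chev_E r j" and ?F = "chev_F r i" and ?u = "F_word J"
  let ?f = "\<lambda>J k. scaleV
    (if J ! k = j then \<mu> ?H - (\<Sum>q\<leftarrow>drop (Suc k) J. simple_root q ?H) else 0) (F_word (delete_at k J))"
  have i: "i \<in> {1..r}" and u: "?u \<in> V" and J: "set J \<subseteq> {1..r}" using Cons.prems F_word_in_V by auto
  note sl = chev_in_sl(2)[OF i] chev_in_sl(1)[OF assms(1)]
  have del: "F_word (delete_at k J) \<in> V" for k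
    using J set_take_subset[of k J] set_drop_subset[of "Suc k" J] by (intro F_word_in_V) (auto simp: delete_at_def)
  have "act ?E (act ?F ?u) - act ?F (act ?E ?u) = act (?E * ?F - ?F * ?E) ?u"
    using bracket_act sl u by simp
  also have "\<dots> = (if i = j then act ?H ?u else 0)"
    unfolding bracket_E_F[OF i assms(1)] using act_zero_mat[OF u] by simp
  also have "\<dots> = ?f (i # J) 0"
    using act_H_F_word[OF assms(1) J] by simp
  finally have "act ?E (act ?F ?u) = ?f (i # J) 0 + act ?F (act ?E ?u)"
    by (simp add: algebra_simps)
  also have "act ?F (act ?E ?u) = (\<Sum>k<length J. act ?F (?f J k))"
    using Cons.IH J del by (simp add: act_sum[OF sl(1)] subspace_scale[OF subspace_V])
  also have "\<dots> = (\<Sum>k<length J. ?f (i # J) (Suc k))"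
    using del by (intro sum.cong refl) (simp add: act_scale[OF sl(1)])
  also have "?f (i # J) 0 + (\<Sum>k<length J. ?f (i # J) (Suc k)) = (\<Sum>k<length (i # J). ?f (i # J) k)"
    by (simp only: length_Cons sum.lessThan_Suc_shift)
  finally show ?case by simp
qed

end

section \<open>Words paired by the Shapovalov form\<close>

locale shapovalov_module = irreducible_hw_module scaleV r V act \<mu> v
  for scaleV :: "complex \<Rightarrow> 'v::ab_group_add \<Rightarrow> 'v" and r V act \<mu> v +
  fixes B :: "'v \<Rightarrow> 'v \<Rightarrow> complex"
  assumes shapovalov: "shapovalov_form scaleV r V act v B"
begin

lemma
  shows B_add: "\<lbrakk>x \<in> V; y \<in> V; u \<in> V\<rbrakk> \<Longrightarrow> B (x + y) u = B x u + B y u"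
    and B_scale: "\<lbrakk>x \<in> V; u \<in> V\<rbrakk> \<Longrightarrow> B (scaleV a x) u = a * B x u"
    and B_sym: "\<lbrakk>x \<in> V; u \<in> V\<rbrakk> \<Longrightarrow> B x u = B u x"
    and B_vv: "B v v = 1"
    and B_act: "\<lbrakk>X \<in> sl r; x \<in> V; u \<in> V\<rbrakk> \<Longrightarrow> B (act X x) u = B x (act (tau X) u)"
  using shapovalov unfolding shapovalov_form_def bilinear_form_on_def by blast+

lemma B_0: "u \<in> V \<Longrightarrow> B 0 u = 0"
  using B_scale[of 0 u 0] subspace_0[OF subspace_V] by simp

lemma B_sum:
  assumes "\<And>k. k \<in> K \<Longrightarrow> f k \<in> V" "u \<in> V"
  shows "B (\<Sum>k\<in>K. f k) u = (\<Sum>k\<in>K. B (f k) u)"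
proof (cases "finite K")
  case True
  then show ?thesis using assms(1)
    by (induction K) (simp_all add: B_0 assms(2) B_add subspace_sum[OF subspace_V])
qed (simp add: B_0 assms(2))

lemma B_F_right:
  assumes "i \<in> {1..r}" "x \<in> V" "u \<in> V"
  shows "B x (act (chev_F r i) u) = B (act (chev_E r i) x) u"
  using B_act[OF chev_in_sl(1)[OF assms(1)] assms(2,3)] by (simp add: tau_chev)

lemma B_E_right:
  assumes "i \<in> {1..r}" "x \<in> V" "u \<in> V"
  shows "B x (act (chev_E r i) u) = B (act (chev_F r i) x) u"
  using B_act[OF chev_in_sl(2)[OF assms(1)] assms(2,3)] by (simp add: tau_chev)

text \<open>The vectors orthogonal to all words form a submodule: E_i moves across the form as one
  more letter, F_i as an E_i, which turns a word into a combination of shorter words. As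
  \<open>B v v = 1\<close>, the submodule misses \<open>v\<close>, and irreducibility makes it
  zero.\<close>

lemma F_words_separate:
  assumes "u \<in> V" "\<And>J. set J \<subseteq> {1..r} \<Longrightarrow> B u (F_word J) = 0"
  shows "u = 0"
proof -
  define R where "R = {u \<in> V. \<forall>J. set J \<subseteq> {1..r} \<longrightarrow> B u (F_word J) = 0}"
  have sub: "subspace R"
    by (rule subspaceI)
      (auto simp: R_def B_0 B_add B_scale F_word_in_V subspace_0[OF subspace_V]
        subspace_add[OF subspace_V] subspace_scale[OF subspace_V])
  have "act X u \<in> R" if "X \<in> sl r" "u \<in> R" for X u
  proof (rule act_closed_of_chevalley[OF sub _ _ _ that])
    show "R \<subseteq> V" by (auto simp: R_def)
    fix i u assume i: "i \<in> {1..r}" and u: "u \<in> R"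
    then have uV: "u \<in> V" and u0: "\<And>J. set J \<subseteq> {1..r} \<Longrightarrow> B u (F_word J) = 0" by (auto simp: R_def)
    have "B (act (chev_E r i) u) (F_word J) = 0" if "set J \<subseteq> {1..r}" for J
      using B_F_right[OF i uV F_word_in_V[OF that]] u0[of "i # J"] i that by simp
    then show "act (chev_E r i) u \<in> R" using uV chev_in_sl[OF i] by (simp add: R_def act_closed)
    have "B (act (chev_F r i) u) (F_word J) = 0" if J: "set J \<subseteq> {1..r}" for J
    proof -
      have del: "set (delete_at k J) \<subseteq> {1..r}" for k
        using J set_take_subset[of k J] set_drop_subset[of "Suc k" J] by (auto simp: delete_at_def)
      have EV: "act (chev_E r i) (F_word J) \<in> V" by (intro act_closed chev_in_sl(1)[OF i] F_word_in_V J)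
      have "B (act (chev_F r i) u) (F_word J) = B (act (chev_E r i) (F_word J)) u"
        using B_E_right[OF i uV F_word_in_V[OF J]] B_sym[OF uV EV] by simp
      also have "\<dots> = 0"
        unfolding act_E_F_word[OF i J] using del u0 uV
        by (subst B_sum) (auto simp: B_scale F_word_in_V subspace_scale[OF subspace_V] B_sym[of "F_word _" u]
            intro!: sum.neutral)
      finally show ?thesis .
    qed
    then show "act (chev_F r i) u \<in> R" using uV chev_in_sl[OF i] by (simp add: R_def act_closed)
  qed
  then have "R = {0} \<or> R = V" using irreducible[OF sub] by (auto simp: R_def)
  moreover have "v \<notin> R" using B_vv by (auto simp: R_def intro!: exI[of _ "[]"])
  ultimately have "R = {0}" using hw_vector by auto
  then show ?thesis using assms by (auto simp: R_def)
qed

text \<open>S(\<omega>, F_J v) for one slot. Taking the first letter \<open>j\<close> across the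
  form as E_j deletes a label \<open>i\<close> of colour \<open>j\<close> from \<open>a\<close>.
  Summed over the places that \<open>i\<close> may have had, \<open>omega_word_insert_sum\<close>
  gives a factor depending only on \<open>i\<close> and the set of remaining labels. It is the
  factor of \<open>i\<close> at the head of a word, so the induction builds \<open>b\<close> letter
  by letter.\<close>

theorem omega_shapovalov_sum:
  assumes "finite X" "inj_on t X" "w \<notin> t ` X" "\<And>i. i \<in> X \<Longrightarrow> c i \<in> {1..r}" "set J \<subseteq> {1..r}"
    and W: "\<And>i. i \<in> X \<Longrightarrow> W i (Inr s) = \<mu> (chev_H r (c i)) / (t i - w)"
      "\<And>i q. i \<in> X \<Longrightarrow> q \<in> X \<Longrightarrow> W i (Inl q) = - simple_root (c q) (chev_H r (c i)) / (t i - t q)"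
  shows "(\<Sum>a\<in>permutations_of_set X. omega_word t w a * B (F_word (map c a)) (F_word J))
    = (\<Sum>b\<in>{b \<in> permutations_of_set X. map c b = J}. chain_weight W s b)"
  using assms
proof (induction J arbitrary: X)
  case Nil
  \<comment> \<open>Only the empty word pairs with \<open>v\<close>: the leading F of a longer one
    moves across to an E, which kills \<open>v\<close>.\<close>
  have "omega_word t w a * B (F_word (map c a)) v = (if a = [] then 1 else 0)" if "a \<in> permutations_of_set X" for a
  proof (cases a)
    case (Cons i a')
    have a: "set a \<subseteq> X" using that by (auto simp: permutations_of_set_def)
    then have i: "c i \<in> {1..r}" and "\<And>q. q \<in> set a' \<Longrightarrow> c q \<in> {1..r}"
      using Nil.prems(4) Cons by auto
    then have V: "F_word (map c a') \<in> V" by (intro F_word_in_V) auto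
    have "B (F_word (map c a')) (act (chev_E r (c i)) v) = B (F_word (map c a)) v"
      using B_E_right[OF i V hw_vector(1)] Cons by simp
    moreover have "B (F_word (map c a')) (act (chev_E r (c i)) v) = 0"
      unfolding E_hw_vector[OF i] using B_sym[OF V, of 0] B_0[OF V] subspace_0[OF subspace_V] by simp
    ultimately show ?thesis using Cons by simp
  qed (simp add: B_vv)
  then have "(\<Sum>a\<in>permutations_of_set X. omega_word t w a * B (F_word (map c a)) (F_word []))
     = (\<Sum>a\<in>permutations_of_set X. if a = [] then 1 else 0)" by simp
  also have "\<dots> = (\<Sum>b\<in>{b \<in> permutations_of_set X. map c b = []}. chain_weight W s b)"
    by (subst sum.inter_filter) (auto intro!: sum.cong)
  finally show ?case .
next
  case (Cons j J)
  have j: "j \<in> {1..r}" and J: "set J \<subseteq> {1..r}" using Cons.prems by auto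
  define h where "h i k a = omega_word t w (insert_at k i a) *
     (\<mu> (chev_H r j) + (\<Sum>q\<in>set (drop k a). - simple_root (c q) (chev_H r j)))" for i k a
  have "omega_word t w a * B (F_word (map c a)) (F_word (j # J)) =
      (\<Sum>k<length a. if c (a ! k) = j then h (a ! k) k (delete_at k a) * B (F_word (map c (delete_at k a))) (F_word J) else 0)"
    if a: "a \<in> permutations_of_set X" for a
  proof -
    have "distinct a" "set a = X" using a by (auto simp: permutations_of_set_def)
    have ca: "set (map c a) \<subseteq> {1..r}" using \<open>set a = X\<close> Cons.prems(4) by auto
    have del: "set (map c (delete_at k a)) \<subseteq> {1..r}" for k
      using ca set_take_subset[of k a] set_drop_subset[of "Suc k" a] by (auto simp: delete_at_def)
    have drop: "drop k (delete_at k a) = drop (Suc k) a" if "k < length a" for k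
      using that by (simp add: delete_at_def)
    have "B (F_word (map c a)) (F_word (j # J)) = B (act (chev_E r j) (F_word (map c a))) (F_word J)"
      using B_F_right[OF j F_word_in_V[OF ca] F_word_in_V[OF J]] by simp
    also have "\<dots> = (\<Sum>k<length a. (if c (a ! k) = j then \<mu> (chev_H r j)
         - (\<Sum>q\<leftarrow>drop (Suc k) (map c a). simple_root q (chev_H r j)) else 0) * B (F_word (delete_at k (map c a))) (F_word J))"
      unfolding act_E_F_word[OF j ca] using del
      by (subst B_sum) (auto simp: B_scale F_word_in_V[OF J] F_word_in_V map_delete_at[symmetric] subspace_0[OF subspace_V]
          intro!: subspace_scale[OF subspace_V] sum.cong)
    finally have "omega_word t w a * B (F_word (map c a)) (F_word (j # J)) = omega_word t w a *
       (\<Sum>k<length a. (if c (a ! k) = j then \<mu> (chev_H r j)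
         - (\<Sum>q\<leftarrow>drop (Suc k) (map c a). simple_root q (chev_H r j)) else 0) * B (F_word (delete_at k (map c a))) (F_word J))"
      by simp
    also have "\<dots> = (\<Sum>k<length a. if c (a ! k) = j then h (a ! k) k (delete_at k a) * B (F_word (map c (delete_at k a))) (F_word J) else 0)"
      unfolding sum_distrib_left
    proof (intro sum.cong refl)
      fix k assume k: "k \<in> {..<length a}"
      have "(\<Sum>q\<leftarrow>drop (Suc k) (map c a). simple_root q (chev_H r j))
        = (\<Sum>q\<in>set (drop (Suc k) a). simple_root (c q) (chev_H r j))"
        unfolding drop_map map_map using \<open>distinct a\<close> by (subst sum_list_distinct_conv_sum_set) (auto simp: distinct_drop)
      then show "omega_word t w a * ((if c (a ! k) = j then \<mu> (chev_H r j)
         - (\<Sum>q\<leftarrow>drop (Suc k) (map c a). simple_root q (chev_H r j)) else 0) * B (F_word (delete_at k (map c a))) (F_word J))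
         = (if c (a ! k) = j then h (a ! k) k (delete_at k a) * B (F_word (map c (delete_at k a))) (F_word J) else 0)"
        using k by (simp add: h_def drop map_delete_at sum_negf)
    qed
    finally show ?thesis .
  qed
  then have "(\<Sum>a\<in>permutations_of_set X. omega_word t w a * B (F_word (map c a)) (F_word (j # J)))
     = (\<Sum>a\<in>permutations_of_set X. \<Sum>k<length a. if c (a ! k) = j then h (a ! k) k (delete_at k a) * B (F_word (map c (delete_at k a))) (F_word J) else 0)"
    by simp
  also have "\<dots> = (\<Sum>i\<in>X. \<Sum>a\<in>permutations_of_set (X - {i}). \<Sum>k\<le>length a.
      if c i = j then h i k a * B (F_word (map c a)) (F_word J) else 0)"
    unfolding sum_permutations_delete[OF Cons.prems(1)] by (intro sum.cong refl) simp
  also have "\<dots> = (\<Sum>i\<in>X. if c i = j then (W i (Inr s) + (\<Sum>q\<in>X - {i}. W i (Inl q))) *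
      (\<Sum>b\<in>{b \<in> permutations_of_set (X - {i}). map c b = J}. chain_weight W s b) else 0)"
  proof (intro sum.cong refl)
    fix i assume i: "i \<in> X"
    show "(\<Sum>a\<in>permutations_of_set (X - {i}). \<Sum>k\<le>length a.
      if c i = j then h i k a * B (F_word (map c a)) (F_word J) else 0) = (if c i = j then (W i (Inr s) + (\<Sum>q\<in>X - {i}. W i (Inl q))) *
      (\<Sum>b\<in>{b \<in> permutations_of_set (X - {i}). map c b = J}. chain_weight W s b) else 0)"
    proof (cases "c i = j")
      case True
      have "(\<Sum>k\<le>length a. h i k a) = omega_word t w a * (W i (Inr s) + (\<Sum>q\<in>X - {i}. W i (Inl q)))"
        if "a \<in> permutations_of_set (X - {i})" for a
      proof -
        have a: "distinct a" "set a = X - {i}" using that by (auto simp: permutations_of_set_def)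
        have ins: "insert i (set a) = X" using a(2) i by auto
        have "(\<Sum>k\<le>length a. h i k a) = omega_word t w a *
            (\<mu> (chev_H r j) / (t i - w) + (\<Sum>q\<in>set a. - simple_root (c q) (chev_H r j) / (t i - t q)))"
          unfolding h_def
        proof (rule omega_word_insert_sum)
          show "inj_on t (insert i (set a))" "w \<notin> t ` insert i (set a)"
            unfolding ins by (fact Cons.prems(2), fact Cons.prems(3))
        qed (use a in auto)
        then show ?thesis using a(2) Cons.prems(6)[OF i] Cons.prems(7)[OF i] True by simp
      qed
      then have "(\<Sum>a\<in>permutations_of_set (X - {i}). \<Sum>k\<le>length a. h i k a * B (F_word (map c a)) (F_word J))
         = (\<Sum>a\<in>permutations_of_set (X - {i}). (W i (Inr s) + (\<Sum>q\<in>X - {i}. W i (Inl q))) *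
             (omega_word t w a * B (F_word (map c a)) (F_word J)))"
        unfolding sum_distrib_right[symmetric] by (intro sum.cong refl) simp
      also have "\<dots> = (W i (Inr s) + (\<Sum>q\<in>X - {i}. W i (Inl q))) *
          (\<Sum>b\<in>{b \<in> permutations_of_set (X - {i}). map c b = J}. chain_weight W s b)"
        unfolding sum_distrib_left[symmetric] using Cons.prems
        by (subst Cons.IH) (auto intro: inj_on_subset)
      finally show ?thesis using True by simp
    qed simp
  qed
  \<comment> \<open>In whatever order \<open>b\<close> lists the remaining labels, all of them stand
    behind \<open>i\<close> in \<open>i # b\<close>, so the common factor is absorbed into the chain
    weight.\<close>
  also have "\<dots> = (\<Sum>i\<in>{i \<in> X. c i = j}. \<Sum>b\<in>{b \<in> permutations_of_set (X - {i}). map c b = J}. chain_weight W s (i # b))"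
    unfolding sum.inter_filter[OF Cons.prems(1)] sum_distrib_left
    by (intro sum.cong refl if_cong) (auto simp: permutations_of_set_def)
  also have "\<dots> = (\<Sum>x\<in>(SIGMA i:{i \<in> X. c i = j}. {b \<in> permutations_of_set (X - {i}). map c b = J}). chain_weight W s (fst x # snd x))"
    using Cons.prems(1) by (subst sum.Sigma) (auto simp: split_beta)
  also have "\<dots> = (\<Sum>b\<in>{b \<in> permutations_of_set X. map c b = j # J}. chain_weight W s b)"
  proof (rule sum.reindex_bij_witness[of _ "\<lambda>b. (hd b, tl b)" "\<lambda>x. fst x # snd x"])
    fix x assume A: "x \<in> (SIGMA i:{i \<in> X. c i = j}. {b \<in> permutations_of_set (X - {i}). map c b = J})"
    obtain i b where x: "x = (i, b)" by (cases x)
    then have "i \<in> X" "c i = j" "set b = X - {i}" "distinct b" "map c b = J"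
      using A unfolding x mem_Sigma_iff mem_Collect_eq permutations_of_set_def by blast+
    then show "fst x # snd x \<in> {b \<in> permutations_of_set X. map c b = j # J}"
      by (simp add: x permutations_of_set_def insert_absorb)
  next
    fix b assume "b \<in> {b \<in> permutations_of_set X. map c b = j # J}"
    then have "set b = X" "distinct b" "map c b = j # J" by (simp_all add: permutations_of_set_def)
    moreover from this obtain i b' where "b = i # b'" by (cases b) simp_all
    ultimately have b: "b = i # b'" "X = insert i (set b')" "i \<notin> set b'" "distinct b'" "c i = j" "map c b' = J"
      by simp_all
    then show "fst (hd b, tl b) # snd (hd b, tl b) = b" by simp
    show "(hd b, tl b) \<in> (SIGMA i:{i \<in> X. c i = j}. {b \<in> permutations_of_set (X - {i}). map c b = J})"
      using b by (simp add: permutations_of_set_def)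
  qed simp_all
  finally show ?case .
qed

end

section \<open>Dual expansions in tensor products\<close>

text \<open>Among separating functionals on a finite-dimensional space, finitely many suffice to
  reconstruct each vector. This writes vectors with pairings as coefficients, so that limits of
  pairings give limits of vectors. Linearity is asked on the span only, because the forms are
  bilinear only on the modules.\<close>

lemma (in vector_space) dual_expansion:
  fixes f :: "'i \<Rightarrow> 'b \<Rightarrow> 'a"
  assumes "finite S"
    and add: "\<And>J x y. x \<in> span S \<Longrightarrow> y \<in> span S \<Longrightarrow> f J (x + y) = f J x + f J y"
    and scale: "\<And>J a x. x \<in> span S \<Longrightarrow> f J (scale a x) = a * f J x"
    and sep: "\<And>u. u \<in> span S \<Longrightarrow> (\<And>J. J \<in> \<Phi> \<Longrightarrow> f J u = 0) \<Longrightarrow> u = 0"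
  shows "\<exists>D e. finite D \<and> D \<subseteq> \<Phi> \<and> (\<forall>J\<in>D. e J \<in> span S) \<and> (\<forall>u\<in>span S. u = (\<Sum>J\<in>D. scale (f J u) (e J)))"
  using assms
proof (induction S)
  case empty
  then show ?case by (intro exI[of _ "{}"]) auto
next
  case (insert x S)
  have sub: "u \<in> span (insert x S)" if "u \<in> span S" for u
    using that span_mono[of S "insert x S"] by auto
  have "\<exists>D e. finite D \<and> D \<subseteq> \<Phi> \<and> (\<forall>J\<in>D. e J \<in> span S) \<and> (\<forall>u\<in>span S. u = (\<Sum>J\<in>D. scale (f J u) (e J)))"
  proof (rule insert.IH)
    fix J a u w assume u: "u \<in> span S"
    show "f J (scale a u) = a * f J u" by (rule insert.prems(2)[OF sub[OF u]])
    show "w \<in> span S \<Longrightarrow> f J (u + w) = f J u + f J w" by (intro insert.prems(1) sub u)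
    show "(\<And>J. J \<in> \<Phi> \<Longrightarrow> f J u = 0) \<Longrightarrow> u = 0" by (rule insert.prems(3)[OF sub[OF u]])
  qed
  then obtain D e where D: "finite D" "D \<subseteq> \<Phi>" "\<And>J. J \<in> D \<Longrightarrow> e J \<in> span S"
    "\<And>u. u \<in> span S \<Longrightarrow> u = (\<Sum>J\<in>D. scale (f J u) (e J))"
    by blast
  define P where "P u = (\<Sum>J\<in>D. scale (f J u) (e J))" for u
  have P: "P u \<in> span S" for u unfolding P_def by (intro span_sum span_scale D)
  have Pid: "P u = u" if "u \<in> span S" for u using D(4)[OF that] by (simp add: P_def)
  have Padd: "P (u + w) = P u + P w" if "u \<in> span (insert x S)" "w \<in> span (insert x S)" for u w
    unfolding P_def using insert.prems(1)[OF that] by (simp add: scale_left_distrib sum.distrib)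
  have Pscale: "P (scale a u) = scale a (P u)" if "u \<in> span (insert x S)" for u a
    unfolding P_def using insert.prems(2)[OF that] by (simp add: scale_sum_right)
  have x: "x \<in> span (insert x S)" by (simp add: span_base)
  \<comment> \<open>\<open>P\<close> is a projection onto the span of \<open>S\<close>, so
    \<open>e0\<close> is the component of \<open>x\<close> in its kernel; a functional that does not
    vanish at \<open>e0\<close> is all that has to be added.\<close>
  define e0 where "e0 = x - P x"
  have e0: "e0 \<in> span (insert x S)" unfolding e0_def by (intro span_diff x sub P)
  have "P (x + scale (- 1) (P x)) = P x + scale (- 1) (P x)"
    by (simp only: Padd[OF x span_scale[OF sub[OF P]]] Pscale[OF sub[OF P]] Pid[OF P])
  then have Pe0: "P e0 = 0" by (simp add: e0_def)
  have decomp: "\<exists>k. u = P u + scale k e0" if u: "u \<in> span (insert x S)" for u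
  proof -
    obtain k where k: "u - scale k x \<in> span S" using u by (auto simp: span_insert)
    define s where "s = u - scale k x + scale k (P x)"
    have s: "s \<in> span S" unfolding s_def by (intro span_add k span_scale P)
    have us: "u = s + scale k e0" by (simp add: s_def e0_def scale_right_diff_distrib)
    have "P u = s + scale k (P e0)"
      by (subst us) (simp add: Padd[OF sub[OF s] span_scale[OF e0]] Pscale[OF e0] Pid[OF s])
    then show ?thesis using us Pe0 by (intro exI[of _ k]) simp
  qed
  show ?case
  proof (cases "e0 = 0")
    case True
    then have "u = (\<Sum>J\<in>D. scale (f J u) (e J))" if "u \<in> span (insert x S)" for u
      using decomp[OF that] by (simp add: P_def)
    then show ?thesis using D sub by (intro exI[of _ D] exI[of _ e]) auto
  next
    case False
    then obtain y where y: "y \<in> \<Phi>" "f y e0 \<noteq> 0" using insert.prems(3)[OF e0] by blast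
    \<comment> \<open>The coefficient of \<open>e0\<close> in \<open>u\<close> is
      \<open>(f y u - f y (P u)) / f y e0\<close>; its second part is distributed over the old dual
      vectors. The two summands are separate because \<open>y\<close> may already belong to
      \<open>D\<close>.\<close>
    define g where "g J = (if J \<in> D then e J - scale (f y (e J) / f y e0) e0 else 0)
        + (if J = y then scale (1 / f y e0) e0 else 0)" for J
    have g: "g J \<in> span (insert x S)" for J
      unfolding g_def using D(3)[THEN sub] e0 by (auto intro!: span_add span_diff span_scale span_zero)
    have "u = (\<Sum>J\<in>insert y D. scale (f J u) (g J))" if u: "u \<in> span (insert x S)" for u
    proof -
      obtain k where k: "u = P u + scale k e0" using decomp[OF u] by blast
      note addx = insert.prems(1) and scalex = insert.prems(2)
      have fyP: "f y (P w) = (\<Sum>J\<in>D. f J w * f y (e J))" for w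
      proof -
        have "f y (\<Sum>J\<in>E. scale (f J w) (e J)) = (\<Sum>J\<in>E. f J w * f y (e J))" if "finite E" "E \<subseteq> D" for E
          using that
        proof (induction E)
          case empty
          show ?case using insert.prems(2)[OF e0, of y 0] by simp
        next
          case (insert J E)
          have "(\<Sum>J\<in>E. scale (f J w) (e J)) \<in> span (insert x S)" "scale (f J w) (e J) \<in> span (insert x S)"
            "e J \<in> span (insert x S)"
            using insert.prems D(3) by (intro span_sum span_scale sub, auto)+
          then show ?case using insert by (simp add: addx scalex)
        qed
        from this[OF D(1) order_refl] show ?thesis by (simp add: P_def)
      qed
      have "f y u = f y (P u) + k * f y e0"
        by (subst k) (simp add: insert.prems(1)[OF sub[OF P] span_scale[OF e0]] insert.prems(2)[OF e0])
      then have k': "k = (f y u - f y (P u)) / f y e0" using y(2) by (simp add: field_simps)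
      have "(\<Sum>J\<in>insert y D. scale (f J u) (g J)) =
          (\<Sum>J\<in>insert y D. if J \<in> D then scale (f J u) (e J - scale (f y (e J) / f y e0) e0) else 0)
        + (\<Sum>J\<in>insert y D. if J = y then scale (f y u / f y e0) e0 else 0)"
        unfolding sum.distrib[symmetric] by (intro sum.cong refl) (auto simp: g_def scale_right_distrib)
      also have "(\<Sum>J\<in>insert y D. if J = y then scale (f y u / f y e0) e0 else 0) = scale (f y u / f y e0) e0"
        using D(1) by (subst sum.delta) auto
      also have "(\<Sum>J\<in>insert y D. if J \<in> D then scale (f J u) (e J - scale (f y (e J) / f y e0) e0) else 0)
          = (\<Sum>J\<in>D. scale (f J u) (e J - scale (f y (e J) / f y e0) e0))"
        using D(1) by (intro sum.mono_neutral_cong_right) auto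
      also have "\<dots> = P u - scale (f y (P u) / f y e0) e0"
        unfolding P_def fyP[unfolded P_def]
        by (simp add: scale_right_diff_distrib sum_subtractf scale_sum_left sum_divide_distrib)
      also have "P u - scale (f y (P u) / f y e0) e0 + scale (f y u / f y e0) e0 = P u + scale k e0"
        unfolding k' by (simp add: diff_divide_distrib scale_left_diff_distrib)
      finally show ?thesis using k by simp
    qed
    then show ?thesis using D y(1) g by (intro exI[of _ "insert y D"] exI[of _ g]) auto
  qed
qed

text \<open>The bound on the length leaves finitely many words, hence a finite-dimensional span; it
  will be the number of labels, which no word of the weight function exceeds.\<close>

lemma (in shapovalov_module) F_word_expansion:
  shows "\<exists>D e. finite D \<and> (\<forall>J\<in>D. set J \<subseteq> {1..r} \<and> e J \<in> V) \<and>
    (\<forall>I. set I \<subseteq> {1..r} \<and> length I \<le> m \<longrightarrow> F_word I = (\<Sum>J\<in>D. scaleV (B (F_word I) (F_word J)) (e J)))"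
proof -
  define S where "S = F_word ` {I. set I \<subseteq> {1..r} \<and> length I \<le> m}"
  have fin: "finite S" unfolding S_def by (intro finite_imageI finite_lists_length_le) simp
  have "S \<subseteq> V" unfolding S_def using F_word_in_V by auto
  then have SV: "span S \<subseteq> V" by (rule span_minimal[OF _ subspace_V])
  let ?\<Phi> = "{J. set J \<subseteq> {1..r}}"
  \<comment> \<open>Lists with other letters get the zero functional, since
    \<open>dual_expansion\<close> asks for linearity at every index.\<close>
  define f where "f J u = (if set J \<subseteq> {1..r} then B u (F_word J) else 0)" for J u
  have "\<exists>D e. finite D \<and> D \<subseteq> ?\<Phi> \<and> (\<forall>J\<in>D. e J \<in> span S) \<and> (\<forall>u\<in>span S. u = (\<Sum>J\<in>D. scaleV (f J u) (e J)))"
  proof (rule dual_expansion[OF fin])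
    fix J x y a assume "x \<in> span S"
    with SV have x: "x \<in> V" by auto
    show "f J (scaleV a x) = a * f J x" using x by (simp add: f_def B_scale F_word_in_V)
    assume "y \<in> span S"
    with SV have "y \<in> V" by auto
    then show "f J (x + y) = f J x + f J y" using x by (simp add: f_def B_add F_word_in_V)
  next
    fix u assume "u \<in> span S" and z: "\<And>J. J \<in> ?\<Phi> \<Longrightarrow> f J u = 0"
    then show "u = 0" using SV z by (intro F_words_separate) (auto simp: f_def)
  qed
  then obtain D e where De: "finite D" "D \<subseteq> ?\<Phi>" "\<forall>J\<in>D. e J \<in> span S"
    "\<forall>u\<in>span S. u = (\<Sum>J\<in>D. scaleV (f J u) (e J))" by blast
  have "F_word I = (\<Sum>J\<in>D. scaleV (B (F_word I) (F_word J)) (e J))" if "set I \<subseteq> {1..r}" "length I \<le> m" for I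
  proof -
    have "F_word I \<in> span S" using that by (intro span_base) (auto simp: S_def)
    then have "F_word I = (\<Sum>J\<in>D. scaleV (f J (F_word I)) (e J))" using De(4) by blast
    also have "\<dots> = (\<Sum>J\<in>D. scaleV (B (F_word I) (F_word J)) (e J))"
      using De(2) by (intro sum.cong) (auto simp: f_def)
    finally show ?thesis .
  qed
  then show ?thesis using De SV by (intro exI[of _ D] exI[of _ e]) auto
qed

section \<open>Expansion of multilinear maps slot by slot\<close>

lemma multilinear_slot_sum:
  assumes "vector_space scaleV" "vector_space scaleW" "multilinear_on scaleV scaleW n V f"
    and sub: "module.subspace scaleV (V s)" and s: "s \<in> {1..n}" and u: "u \<in> PiE {1..n} V"
    and "finite D" "\<And>J. J \<in> D \<Longrightarrow> e J \<in> V s"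
  shows "f (u(s := \<Sum>J\<in>D. scaleV (a J) (e J))) = (\<Sum>J\<in>D. scaleW (a J) (f (u(s := e J))))"
proof -
  interpret v: vector_space scaleV by fact
  interpret w: vector_space scaleW by fact
  have add: "f (u(s := x + y)) = f (u(s := x)) + f (u(s := y))" if "x \<in> V s" "y \<in> V s" for x y
    using assms(3) s u that unfolding multilinear_on_def by blast
  have scale: "f (u(s := scaleV a x)) = scaleW a (f (u(s := x)))" if "x \<in> V s" for x a
    using assms(3) s u that unfolding multilinear_on_def by blast
  have z: "f (u(s := 0)) = 0" using scale[OF v.subspace_0[OF sub], of 0] by simp
  show ?thesis using assms(7,8)
  proof (induction D)
    case (insert J D)
    have "(\<Sum>J\<in>D. scaleV (a J) (e J)) \<in> V s"
      using insert.prems by (intro v.subspace_sum[OF sub] v.subspace_scale[OF sub]) auto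
    moreover have "e J \<in> V s" "scaleV (a J) (e J) \<in> V s"
      using insert.prems by (auto intro: v.subspace_scale[OF sub])
    moreover have "f (u(s := \<Sum>J\<in>D. scaleV (a J) (e J))) = (\<Sum>J\<in>D. scaleW (a J) (f (u(s := e J))))"
      using insert by blast
    ultimately show ?case by (simp only: sum.insert[OF insert.hyps] add scale)
  qed (simp add: z)
qed

lemma sum_PiE_insert:
  assumes "s \<notin> M"
  shows "(\<Sum>K\<in>PiE (insert s M) D. h K) = (\<Sum>K\<in>PiE M D. \<Sum>J\<in>D s. h (K(s := J)))"
proof -
  have "(\<Sum>K\<in>PiE (insert s M) D. h K) = (\<Sum>x\<in>D s \<times> PiE M D. h ((snd x)(s := fst x)))"
    unfolding PiE_insert_eq using inj_combinator[OF assms, of D]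
    by (subst sum.reindex) (simp_all only: split_beta' o_def)
  also have "\<dots> = (\<Sum>J\<in>D s. \<Sum>K\<in>PiE M D. h (K(s := J)))"
    unfolding sum.cartesian_product by (intro sum.cong refl) (simp only: split_beta')
  finally show ?thesis by (simp only: sum.swap[of _ "D s"])
qed

lemma multilinear_expansion:
  fixes D :: "nat \<Rightarrow> 'i set" and scaleV :: "complex \<Rightarrow> 'v::ab_group_add \<Rightarrow> 'v"
  assumes "vector_space scaleV" "vector_space scaleW" "multilinear_on scaleV scaleW n V f"
    and sub: "\<And>s. s \<in> {1..n} \<Longrightarrow> module.subspace scaleV (V s)"
    and D: "\<And>s. s \<in> {1..n} \<Longrightarrow> finite (D s)"
    and e: "\<And>s J. s \<in> {1..n} \<Longrightarrow> J \<in> D s \<Longrightarrow> e s J \<in> V s"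
  shows "f (\<lambda>s\<in>{1..n}. \<Sum>J\<in>D s. scaleV (a s J) (e s J)) =
    (\<Sum>K\<in>PiE {1..n} D. scaleW (\<Prod>s\<in>{1..n}. a s (K s)) (f (\<lambda>s\<in>{1..n}. e s (K s))))"
proof -
  interpret v: vector_space scaleV by fact
  interpret w: vector_space scaleW by fact
  \<comment> \<open>Induction on the set \<open>M\<close> of expanded slots. The vectors
    \<open>x\<close> in the other slots stay arbitrary, because the induction hypothesis is used
    with a whole sum placed in the next slot.\<close>
  have "f (\<lambda>s\<in>{1..n}. if s \<in> M then \<Sum>J\<in>D s. scaleV (a s J) (e s J) else x s) =
    (\<Sum>K\<in>PiE M D. scaleW (\<Prod>s\<in>M. a s (K s)) (f (\<lambda>s\<in>{1..n}. if s \<in> M then e s (K s) else x s)))"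
    if "finite M" "M \<subseteq> {1..n}" "\<And>s. s \<in> {1..n} \<Longrightarrow> x s \<in> V s" for M x
    using that
  proof (induction M arbitrary: x)
    case (insert s M)
    let ?y = "\<Sum>J\<in>D s. scaleV (a s J) (e s J)"
    define h where "h K = scaleW (\<Prod>u\<in>insert s M. a u (K u))
        (f (\<lambda>u\<in>{1..n}. if u \<in> insert s M then e u (K u) else x u))" for K
    have s: "s \<in> {1..n}" "s \<notin> M" "M \<subseteq> {1..n}" using insert by auto
    have y: "?y \<in> V s" using s e by (intro v.subspace_sum[OF sub] v.subspace_scale[OF sub]) auto
    have "f (\<lambda>u\<in>{1..n}. if u \<in> insert s M then \<Sum>J\<in>D u. scaleV (a u J) (e u J) else x u)
        = f (\<lambda>u\<in>{1..n}. if u \<in> M then \<Sum>J\<in>D u. scaleV (a u J) (e u J) else (x(s := ?y)) u)"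
      by (intro arg_cong[of _ _ f] restrict_ext) auto
    also have "\<dots> = (\<Sum>K\<in>PiE M D. scaleW (\<Prod>s\<in>M. a s (K s))
        (f (\<lambda>u\<in>{1..n}. if u \<in> M then e u (K u) else (x(s := ?y)) u)))"
      using s insert.prems y by (intro insert.IH) auto
    also have "\<dots> = (\<Sum>K\<in>PiE M D. \<Sum>J\<in>D s. h (K(s := J)))"
    proof (intro sum.cong refl)
      fix K assume K: "K \<in> PiE M D"
      let ?u = "\<lambda>u\<in>{1..n}. if u \<in> M then e u (K u) else x u"
      have u: "?u \<in> PiE {1..n} V" using K insert.prems e by (auto simp: PiE_iff)
      have *: "(\<lambda>u\<in>{1..n}. if u \<in> M then e u (K u) else (x(s := z)) u) = ?u(s := z)" for z
        using s by (auto simp: restrict_def fun_eq_iff)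
      have "f (\<lambda>u\<in>{1..n}. if u \<in> M then e u (K u) else (x(s := ?y)) u) = (\<Sum>J\<in>D s. scaleW (a s J) (f (?u(s := e s J))))"
        unfolding * by (rule multilinear_slot_sum[OF assms(1-3) sub[OF s(1)] s(1) u D[OF s(1)] e[OF s(1)]])
      also have "scaleW (\<Prod>s\<in>M. a s (K s)) \<dots> = (\<Sum>J\<in>D s. h (K(s := J)))"
        unfolding w.scale_sum_right
      proof (intro sum.cong refl)
        fix J
        have "(\<lambda>u\<in>{1..n}. if u \<in> insert s M then e u ((K(s := J)) u) else x u) = ?u(s := e s J)"
          using s by (auto simp: restrict_def fun_eq_iff)
        moreover have "(\<Prod>u\<in>insert s M. a u ((K(s := J)) u)) = a s J * (\<Prod>s\<in>M. a s (K s))"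
          using s insert.hyps by (subst prod.insert) (auto intro!: prod.cong arg_cong2[of _ _ _ _ "(*)"])
        ultimately show "scaleW (\<Prod>s\<in>M. a s (K s)) (scaleW (a s J) (f (?u(s := e s J)))) = h (K(s := J))"
          by (simp only: h_def w.scale_scale mult.commute)
      qed
      finally show "scaleW (\<Prod>s\<in>M. a s (K s)) (f (\<lambda>u\<in>{1..n}. if u \<in> M then e u (K u) else (x(s := ?y)) u))
        = (\<Sum>J\<in>D s. h (K(s := J)))" .
    qed
    also have "\<dots> = (\<Sum>K\<in>PiE (insert s M) D. h K)"
      by (rule sum_PiE_insert[OF s(2), of h, symmetric])
    finally show ?case by (simp only: h_def)
  qed simp
  note gen = this
  have "f (\<lambda>s\<in>{1..n}. if s \<in> {1..n} then \<Sum>J\<in>D s. scaleV (a s J) (e s J) else 0) =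
    (\<Sum>K\<in>PiE {1..n} D. scaleW (\<Prod>s\<in>{1..n}. a s (K s)) (f (\<lambda>s\<in>{1..n}. if s \<in> {1..n} then e s (K s) else 0)))"
    using v.subspace_0[OF sub] by (intro gen) auto
  moreover have "(\<lambda>s\<in>{1..n}. if s \<in> {1..n} then h s else 0) = (\<lambda>s\<in>{1..n}. h s)" for h :: "nat \<Rightarrow> 'v"
    by (intro restrict_ext) simp
  ultimately show ?thesis by (simp only:)
qed

section \<open>The weight function as a sum over tuples of words\<close>

lemma bij_betw_label_tuples_map:
  assumes "inj_on g L"
  shows "bij_betw (\<lambda>b. \<lambda>s\<in>N. map g (b s)) (label_tuples N L) (label_tuples N (g ` L))"
proof (rule bij_betw_byWitness[where f' = "\<lambda>b. \<lambda>s\<in>N. map (inv_into L g) (b s)"])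
  have id: "map (inv_into L g) (map g (b s)) = b s" if "b \<in> label_tuples N L" "s \<in> N" for b s
    unfolding map_map using label_tuplesD(2)[OF that] assms by (intro map_idI) auto
  have id': "map g (map (inv_into L g) (b s)) = b s" if "b \<in> label_tuples N (g ` L)" "s \<in> N" for b s
    unfolding map_map using label_tuplesD(2)[OF that] by (intro map_idI) (auto simp: f_inv_into_f subset_iff)
  show "\<forall>b\<in>label_tuples N L. (\<lambda>s\<in>N. map (inv_into L g) ((\<lambda>s\<in>N. map g (b s)) s)) = b"
    by (intro ballI extensionalityI[of _ N]) (simp_all only: restrict_extensional label_tuplesD(5) restrict_apply' id)
  show "\<forall>b\<in>label_tuples N (g ` L). (\<lambda>s\<in>N. map g ((\<lambda>s\<in>N. map (inv_into L g) (b s)) s)) = b"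
    by (intro ballI extensionalityI[of _ N]) (simp_all only: restrict_extensional label_tuplesD(5) restrict_apply' id')
  show "(\<lambda>b. \<lambda>s\<in>N. map g (b s)) ` label_tuples N L \<subseteq> label_tuples N (g ` L)"
    using label_tuples_map[OF assms] by blast
  have "inv_into L g ` g ` L = L" by (rule inv_into_image_cancel[OF assms order_refl])
  then show "(\<lambda>b. \<lambda>s\<in>N. map (inv_into L g) (b s)) ` label_tuples N (g ` L) \<subseteq> label_tuples N L"
    using label_tuples_map[OF inj_on_inv_into[OF order_refl], of _ N g L] by auto
qed

lemma distinct_concat_upt:
  "distinct (concat (map b [1..<Suc n])) \<longleftrightarrow> (\<forall>s\<in>{1..n}. distinct (b s)) \<and>
    (\<forall>s\<in>{1..n}. \<forall>s'\<in>{1..n}. s \<noteq> s' \<longrightarrow> set (b s) \<inter> set (b s') = {})"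
proof (induction n)
  case (Suc n)
  define E where "E s s' \<longleftrightarrow> set (b s) \<inter> set (b s') = {}" for s s'
  have sym: "E s s' = E s' s" for s s' unfolding E_def by (simp add: Int_commute)
  have ins: "{1..Suc n} = insert (Suc n) {1..n}" "Suc n \<notin> {1..n}" by auto
  have "distinct (concat (map b [1..<Suc (Suc n)])) \<longleftrightarrow> distinct (concat (map b [1..<Suc n])) \<and> distinct (b (Suc n)) \<and>
      set (concat (map b [1..<Suc n])) \<inter> set (b (Suc n)) = {}"
    by (subst upt_Suc_append) (simp_all del: upt_Suc)
  also have "set (concat (map b [1..<Suc n])) \<inter> set (b (Suc n)) = {} \<longleftrightarrow> (\<forall>s\<in>{1..n}. E s (Suc n))"
    unfolding set_concat set_map set_upt atLeastLessThanSuc_atLeastAtMost E_def by blast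
  finally have "distinct (concat (map b [1..<Suc (Suc n)])) \<longleftrightarrow>
     ((\<forall>s\<in>{1..n}. distinct (b s)) \<and> (\<forall>s\<in>{1..n}. \<forall>s'\<in>{1..n}. s \<noteq> s' \<longrightarrow> E s s')) \<and> distinct (b (Suc n)) \<and>
     (\<forall>s\<in>{1..n}. E s (Suc n))"
    unfolding Suc.IH E_def .
  also have "\<dots> \<longleftrightarrow> (\<forall>s\<in>{1..Suc n}. distinct (b s)) \<and> (\<forall>s\<in>{1..Suc n}. \<forall>s'\<in>{1..Suc n}. s \<noteq> s' \<longrightarrow> E s s')"
  proof -
    have 1: "(\<forall>s'\<in>{1..n}. Suc n \<noteq> s' \<longrightarrow> E (Suc n) s') \<longleftrightarrow> (\<forall>s\<in>{1..n}. E s (Suc n))"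
    proof (intro ball_cong refl)
      fix s assume "s \<in> {1..n}"
      then have "Suc n \<noteq> s" using ins(2) by auto
      then show "(Suc n \<noteq> s \<longrightarrow> E (Suc n) s) \<longleftrightarrow> E s (Suc n)" using sym[of s "Suc n"] by simp
    qed
    have 2: "(\<forall>s\<in>{1..n}. (s \<noteq> Suc n \<longrightarrow> E s (Suc n)) \<and> (\<forall>s'\<in>{1..n}. s \<noteq> s' \<longrightarrow> E s s'))
      \<longleftrightarrow> (\<forall>s\<in>{1..n}. E s (Suc n)) \<and> (\<forall>s\<in>{1..n}. \<forall>s'\<in>{1..n}. s \<noteq> s' \<longrightarrow> E s s')"
      unfolding ball_conj_distrib[symmetric]
    proof (intro ball_cong refl)
      fix s assume "s \<in> {1..n}"
      then have "s \<noteq> Suc n" using ins(2) by auto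
      then show "((s \<noteq> Suc n \<longrightarrow> E s (Suc n)) \<and> (\<forall>s'\<in>{1..n}. s \<noteq> s' \<longrightarrow> E s s')) \<longleftrightarrow>
        (E s (Suc n) \<and> (\<forall>s'\<in>{1..n}. s \<noteq> s' \<longrightarrow> E s s'))" by simp
    qed
    show ?thesis unfolding ins(1) ball_insert 1 2 by argo
  qed
  finally show ?case unfolding E_def .
qed simp

text \<open>Reading the words one after another turns disjointness of the slots into distinctness of
  a single list, the form in which \<sigma> appears.\<close>

lemma label_tuples_concat:
  "b \<in> label_tuples {1..n} L \<longleftrightarrow> b \<in> extensional {1..n} \<and>
    distinct (concat (map b [1..<Suc n])) \<and> set (concat (map b [1..<Suc n])) = L"
proof -
  have "set (concat (map b [1..<Suc n])) = (\<Union>s\<in>{1..n}. set (b s))" by (auto simp: atLeastLessThanSuc_atLeastAtMost simp del: upt_Suc)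
  then show ?thesis unfolding distinct_concat_upt label_tuples_def by blast
qed

lemma concat_labels:
  "concat (map (labels I \<sigma>) [1..<Suc k]) = map \<sigma> [1..<Suc (\<Sum>u\<in>{1..k}. length (I u))]"
proof (induction k)
  case (Suc k)
  let ?S = "\<Sum>u\<in>{1..k}. length (I u)"
  have "labels I \<sigma> (Suc k) = map (\<lambda>j. \<sigma> (?S + j)) [1..<Suc (length (I (Suc k)))]"
    unfolding labels_def atLeastLessThanSuc_atLeastAtMost by simp
  also have "\<dots> = map \<sigma> [Suc ?S..<Suc (?S + length (I (Suc k)))]"
    by (rule nth_equalityI) (simp_all del: upt_Suc)
  finally have L: "labels I \<sigma> (Suc k) = map \<sigma> [Suc ?S..<Suc (?S + length (I (Suc k)))]" .
  have "[1..<Suc (?S + length (I (Suc k)))] = [1..<Suc ?S] @ [Suc ?S..<Suc (?S + length (I (Suc k)))]"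
    using upt_add_eq_append[of 1 "Suc ?S" "length (I (Suc k))"] by (simp del: upt_Suc)
  then show ?case using Suc L by (simp del: upt_Suc add: upt_Suc_append)
qed simp

lemma length_labels [simp]: "length (labels I \<sigma> s) = length (I s)"
  by (simp add: labels_def del: upt_Suc)

lemma sum_count_list_color:
  assumes "b \<in> label_tuples {1..n} L"
  shows "(\<Sum>s\<in>{1..n}. count_list (map c (b s)) i) = card {a \<in> L. c a = i}"
proof -
  let ?xs = "concat (map b [1..<Suc n])"
  have cl: "count_list (map c xs) i = length (filter (\<lambda>a. c a = i) xs)" for xs
    by (induction xs) auto
  have "(\<Sum>s\<in>{1..k}. count_list (map c (b s)) i) = length (filter (\<lambda>a. c a = i) (concat (map b [1..<Suc k])))" for k
    by (induction k) (simp_all add: cl)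
  moreover have "length (filter (\<lambda>a. c a = i) ?xs) = card {a \<in> L. c a = i}"
    using assms unfolding label_tuples_concat by (metis distinct_card distinct_filter set_filter)
  ultimately show ?thesis by simp
qed

text \<open>The inverse takes the colours of the words for I and their concatenation for \<sigma>;
  cutting the latter into blocks of the right lengths gives the words back.\<close>

lemma bij_betw_labels:
  fixes r n :: nat and l :: "nat \<Rightarrow> nat"
  defines "m \<equiv> total_mult r l"
  shows "bij_betw (\<lambda>(I, \<sigma>). \<lambda>s\<in>{1..n}. labels I \<sigma> s)
    (SIGMA I:word_seqs r n l. labelings r n l I) (label_tuples {1..n} {1..m})"
proof (rule bij_betw_imageI)
  let ?A = "SIGMA I:word_seqs r n l. labelings r n l I"
  let ?F = "\<lambda>(I, \<sigma>). \<lambda>s\<in>{1..n}. labels I \<sigma> s"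
  have cat: "concat (map (\<lambda>s\<in>{1..n}. h s) [1..<Suc n]) = concat (map h [1..<Suc n])" for h :: "nat \<Rightarrow> nat list"
    by (intro arg_cong[of _ _ concat] map_cong refl) auto
  have len: "(\<Sum>s\<in>{1..n}. length (I s)) = m" if "I \<in> word_seqs r n l" for I
  proof -
    have "length (I s) = (\<Sum>i\<in>{1..r}. count_list (I s) i)" if "s \<in> {1..n}" for s
    proof -
      have "I s \<in> lists {1..r}" using \<open>I \<in> word_seqs r n l\<close> that by (auto simp: word_seqs_def PiE_iff)
      then have "set (I s) \<subseteq> {1..r}" by (auto simp: lists_eq_set)
      then show ?thesis by (simp add: sum_count_set)
    qed
    then have "(\<Sum>s\<in>{1..n}. length (I s)) = (\<Sum>i\<in>{1..r}. \<Sum>s\<in>{1..n}. count_list (I s) i)"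
      by (subst sum.swap) simp
    then show ?thesis using that by (simp add: word_seqs_def m_def total_mult_def)
  qed
  have A: "I \<in> word_seqs r n l \<and> \<sigma> permutes {1..m} \<and> (\<forall>s\<in>{1..n}. map (color l) (labels I \<sigma> s) = I s)
      \<and> concat (map (labels I \<sigma>) [1..<Suc n]) = map \<sigma> [1..<Suc m]" if "(I, \<sigma>) \<in> ?A" for I \<sigma>
    using that len[of I] concat_labels[of I \<sigma> n] by (auto simp: labelings_def m_def)
  show "inj_on ?F ?A"
  proof (rule inj_onI)
    fix x y assume xy: "x \<in> ?A" "y \<in> ?A" "?F x = ?F y"
    obtain I \<sigma> J \<tau> where x: "x = (I, \<sigma>)" and y: "y = (J, \<tau>)" by (metis surj_pair)
    note Ax = A[OF xy(1)[unfolded x]] and Ay = A[OF xy(2)[unfolded y]]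
    have e: "labels I \<sigma> s = labels J \<tau> s" if "s \<in> {1..n}" for s
      using fun_cong[OF xy(3), of s] that by (simp add: x y)
    have "I s = J s" if "s \<in> {1..n}" for s using e[OF that] Ax Ay that by metis
    then have "I = J"
      using Ax Ay by (intro extensionalityI[of I "{1..n}" J]) (auto simp: word_seqs_def PiE_iff)
    have "concat (map (labels I \<sigma>) [1..<Suc n]) = concat (map (labels J \<tau>) [1..<Suc n])"
      using e by (intro arg_cong[of _ _ concat] map_cong refl) auto
    then have "map \<sigma> [1..<Suc m] = map \<tau> [1..<Suc m]" using Ax Ay by simp
    then have on: "\<sigma> k = \<tau> k" if "k \<in> {1..m}" for k
      using that by (simp only: map_eq_conv set_upt atLeastLessThanSuc_atLeastAtMost)
    have "\<sigma> k = \<tau> k" for k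
    proof (cases "k \<in> {1..m}")
      case False
      then show ?thesis using Ax Ay permutes_not_in[of \<sigma> "{1..m}" k] permutes_not_in[of \<tau> "{1..m}" k] by metis
    qed (rule on)
    then show "x = y" using \<open>I = J\<close> by (simp add: x y fun_eq_iff)
  qed
  show "?F ` ?A = label_tuples {1..n} {1..m}"
  proof (intro equalityI subsetI)
    fix y assume "y \<in> ?F ` ?A"
    then obtain I \<sigma> where y: "y = (\<lambda>s\<in>{1..n}. labels I \<sigma> s)" and IA: "(I, \<sigma>) \<in> ?A" by auto
    note A' = A[OF IA]
    have "concat (map y [1..<Suc n]) = map \<sigma> [1..<Suc m]" unfolding y cat using A' by simp
    moreover have "distinct (map \<sigma> [1..<Suc m])"
      using A' permutes_inj_on[of \<sigma> "{1..m}"] by (simp add: distinct_map del: upt_Suc)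
    moreover have "set (map \<sigma> [1..<Suc m]) = {1..m}"
      using A' permutes_image[of \<sigma> "{1..m}"] by (simp add: atLeastLessThanSuc_atLeastAtMost del: upt_Suc)
    ultimately show "y \<in> label_tuples {1..n} {1..m}"
      unfolding label_tuples_concat by (simp add: y del: upt_Suc)
  next
    fix b assume b: "b \<in> label_tuples {1..n} {1..m}"
    define xs where "xs = concat (map b [1..<Suc n])"
    have xs: "distinct xs" "set xs = {1..m}" and be: "b \<in> extensional {1..n}"
      using b unfolding label_tuples_concat xs_def by auto
    have lxs: "length xs = m" using distinct_card[OF xs(1)] xs(2) by simp
    define I where "I = (\<lambda>s\<in>{1..n}. map (color l) (b s))"
    \<comment> \<open>List positions start at 0, labels at 1. Outside the labels \<sigma> has to be
      the identity to be a permutation of them.\<close>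
    define \<sigma> where "\<sigma> k = (if k \<in> {1..m} then xs ! (k - 1) else k)" for k
    have map\<sigma>: "map \<sigma> [1..<Suc m] = xs"
      by (rule nth_equalityI) (auto simp: lxs \<sigma>_def simp del: upt_Suc)
    have "\<sigma> ` {1..m} = {1..m}"
    proof -
      have "\<sigma> ` set [1..<Suc m] = set xs" using map\<sigma> by (metis set_map)
      then show ?thesis using xs(2) by (simp add: atLeastLessThanSuc_atLeastAtMost del: upt_Suc)
    qed
    moreover from this have "inj_on \<sigma> {1..m}" by (metis eq_card_imp_inj_on finite_atLeastAtMost)
    ultimately have perm: "\<sigma> permutes {1..m}"
      by (intro bij_imp_permutes) (auto simp: bij_betw_def \<sigma>_def)
    have lenI: "length (I s) = length (b s)" if "s \<in> {1..n}" for s using that by (simp add: I_def)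
    have I: "I \<in> word_seqs r n l"
    proof -
      have "I s \<in> lists {1..r}" if "s \<in> {1..n}" for s
        using label_tuplesD(2)[OF b that] color_in[of _ r l] that by (auto simp: I_def m_def lists_eq_set)
      moreover have "(\<Sum>s\<in>{1..n}. count_list (I s) i) = l i" if "i \<in> {1..r}" for i
        using sum_count_list_color[OF b, of "color l" i] card_color_fibre[OF that, of l] by (simp add: I_def m_def)
      ultimately show ?thesis by (auto simp: word_seqs_def PiE_iff I_def)
    qed
    have "concat (map (labels I \<sigma>) [1..<Suc n]) = concat (map b [1..<Suc n])"
      unfolding concat_labels len[OF I] map\<sigma> xs_def ..
    then have "map (labels I \<sigma>) [1..<Suc n] = map b [1..<Suc n]"
    proof (rule concat_injective)
      show "\<forall>(x, y)\<in>set (zip (map (labels I \<sigma>) [1..<Suc n]) (map b [1..<Suc n])). length x = length y"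
        using lenI unfolding zip_map_map by (auto simp: zip_same_conv_map simp del: upt_Suc)
    qed simp
    then have lab: "labels I \<sigma> s = b s" if "s \<in> {1..n}" for s
      using that by (simp only: map_eq_conv set_upt atLeastLessThanSuc_atLeastAtMost)
    have "(I, \<sigma>) \<in> ?A" using I perm lab by (auto simp: labelings_def m_def I_def)
    moreover have "?F (I, \<sigma>) = b" using lab be by (auto simp: extensional_def restrict_def fun_eq_iff)
    ultimately show "b \<in> ?F ` ?A" by (rule rev_image_eqI[OF _ sym])
  qed
qed

text \<open>Labels are shifted to start at 0, the first index of a matrix; this is the origin of
  \<open>t \<circ> Suc\<close> and \<open>color l \<circ> Suc\<close>.\<close>

theorem weight_function_label_tuples:
  fixes r n :: nat and l :: "nat \<Rightarrow> nat"
  shows "weight_function scaleW r n act v T l z t =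
    (\<Sum>b\<in>label_tuples {1..n} {0..<total_mult r l}.
       scaleW (\<Prod>s\<in>{1..n}. omega_word (t \<circ> Suc) (z s) (b s))
         (F_vector r n act v T (\<lambda>s. map (color l \<circ> Suc) (b s))))"
proof -
  let ?m = "total_mult r l"
  let ?h = "\<lambda>b. scaleW (\<Prod>s\<in>{1..n}. omega_word t (z s) (b s)) (F_vector r n act v T (\<lambda>s. map (color l) (b s)))"
  have cong: "F_vector r n act v T I = F_vector r n act v T J" if "\<And>s. s \<in> {1..n} \<Longrightarrow> I s = J s" for I J
    unfolding F_vector_def using that by (intro arg_cong[of _ _ T] restrict_ext) simp
  have fin: "finite (labelings r n l I)" for I
    unfolding labelings_def using finite_permutations[of "{1..?m}"] by (rule rev_finite_subset) auto
  have "weight_function scaleW r n act v T l z t =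
      (\<Sum>x\<in>(SIGMA I:word_seqs r n l. labelings r n l I).
         ?h ((\<lambda>(I, \<sigma>). \<lambda>s\<in>{1..n}. labels I \<sigma> s) x))"
    unfolding weight_function_def
  proof (subst sum.Sigma)
    show "finite (word_seqs r n l)" by (rule finite_word_seqs)
    show "\<forall>I\<in>word_seqs r n l. finite (labelings r n l I)" using fin by blast
    show "(\<Sum>(I, \<sigma>)\<in>Sigma (word_seqs r n l) (labelings r n l).
        scaleW (\<Prod>s\<in>{1..n}. omega_word t (z s) (labels I \<sigma> s)) (F_vector r n act v T I)) =
      (\<Sum>x\<in>(SIGMA I:word_seqs r n l. labelings r n l I).
         ?h ((\<lambda>(I, \<sigma>). \<lambda>s\<in>{1..n}. labels I \<sigma> s) x))"
    proof (intro sum.cong refl)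
      fix x assume "x \<in> Sigma (word_seqs r n l) (labelings r n l)"
      then obtain I \<sigma> where x: "x = (I, \<sigma>)" and s: "\<sigma> \<in> labelings r n l I" by auto
      have "F_vector r n act v T (\<lambda>s. map (color l) ((\<lambda>s\<in>{1..n}. labels I \<sigma> s) s)) = F_vector r n act v T I"
        using s by (intro cong) (simp add: labelings_def)
      then show "(case x of (I, \<sigma>) \<Rightarrow> scaleW (\<Prod>s\<in>{1..n}. omega_word t (z s) (labels I \<sigma> s)) (F_vector r n act v T I))
         = ?h ((\<lambda>(I, \<sigma>). \<lambda>s\<in>{1..n}. labels I \<sigma> s) x)" by (simp add: x)
    qed
  qed
  also have "\<dots> = (\<Sum>b\<in>label_tuples {1..n} {1..?m}. ?h b)"
    by (rule sum.reindex_bij_betw[OF bij_betw_labels])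
  also have "{1..?m} = Suc ` {0..<?m}" by (simp add: image_Suc_atLeastLessThan atLeastLessThanSuc_atLeastAtMost)
  also have "(\<Sum>b\<in>label_tuples {1..n} (Suc ` {0..<?m}). ?h b)
     = (\<Sum>b\<in>label_tuples {1..n} {0..<?m}. ?h (\<lambda>s\<in>{1..n}. map Suc (b s)))"
    by (rule sum.reindex_bij_betw[OF bij_betw_label_tuples_map, symmetric]) simp
  also have "\<dots> = (\<Sum>b\<in>label_tuples {1..n} {0..<?m}.
       scaleW (\<Prod>s\<in>{1..n}. omega_word (t \<circ> Suc) (z s) (b s))
         (F_vector r n act v T (\<lambda>s. map (color l \<circ> Suc) (b s))))"
    by (intro sum.cong refl arg_cong2[of _ _ _ _ scaleW] prod.cong cong) (simp_all add: omega_word_map)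
  finally show ?thesis .
qed

section \<open>The Hessian of the master function\<close>

text \<open>With an integral exponent \<open>powr\<close> is differentiable at every nonzero point,
  also on the branch cut. With exponent 0 the factor is the constant 1, and the claimed derivative
  is 0 even where \<open>f x\<close> vanishes.\<close>

lemma has_field_derivative_factor_pow:
  assumes f: "(f has_field_derivative d) (at x)" and "a \<in> \<int>" "a \<noteq> 0 \<Longrightarrow> f x \<noteq> 0"
  shows "((\<lambda>x. factor_pow (f x) a) has_field_derivative factor_pow (f x) a * (a * d / f x)) (at x)"
proof (cases "a = 0")
  case False
  then have nz: "f x \<noteq> 0" using assms by simp
  obtain k where k: "a = of_int k" using assms(2) by (auto elim: Ints_cases)
  have "of_int k * f x powr (of_int k - 1) * d = f x powr a * (a * d / f x)"
    using nz by (simp add: k powr_diff)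
  then show ?thesis
    using has_field_derivative_powr_of_int[OF f nz, of k] False by (simp add: factor_pow_def k)
qed (simp add: factor_pow_def)

text \<open>The logarithmic derivative of a product is the sum of those of its factors, written
  without division by the factors.\<close>

lemma has_field_derivative_prod_log:
  fixes g :: "'k \<Rightarrow> complex \<Rightarrow> complex"
  assumes "\<And>k. k \<in> K \<Longrightarrow> (g k has_field_derivative g k x * d k) (at x)"
  shows "((\<lambda>x. \<Prod>k\<in>K. g k x) has_field_derivative (\<Prod>k\<in>K. g k x) * (\<Sum>k\<in>K. d k)) (at x)"
proof (cases "finite K")
  case True
  then show ?thesis using assms
  proof (induction K)
    case (insert k K)
    have "((\<lambda>x. g k x * (\<Prod>k\<in>K. g k x)) has_field_derivative
       (g k x * d k) * (\<Prod>k\<in>K. g k x) + (\<Prod>k\<in>K. g k x) * (\<Sum>k\<in>K. d k) * g k x) (at x)"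
      using insert by (intro DERIV_mult) auto
    then show ?case using insert.hyps by (simp add: algebra_simps)
  qed simp
qed simp

lemma has_field_derivative_fun_upd:
  "((\<lambda>x. (t(j := x)) i) has_field_derivative (if i = j then 1 else 0)) (at y)"
  by (cases "i = j") auto

text \<open>With numerator 0 the quotient is constantly 0, which covers the omitted terms, whose
  denominators may vanish.\<close>

lemma has_field_derivative_const_divide:
  fixes a :: complex
  assumes f: "(f has_field_derivative d) (at x)" and "a \<noteq> 0 \<Longrightarrow> f x \<noteq> 0"
  shows "((\<lambda>x. a / f x) has_field_derivative - a * d / (f x)\<^sup>2) (at x)"
proof (cases "a = 0")
  case False
  have "((\<lambda>x. a / f x) has_field_derivative (0 * f x - a * d) / (f x * f x)) (at x)"
    using False assms(2) by (intro DERIV_divide f) auto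
  then show ?thesis by (simp add: power2_eq_square)
qed simp

text \<open>The master function as a function of \<open>t\<close>, with its exponents
  \<open>- p\<close> and \<open>q\<close> as parameters and the factors in \<open>z\<close> alone
  collected in \<open>C\<close>.\<close>

locale arrangement_product =
  fixes m n :: nat and p q :: "nat \<Rightarrow> nat \<Rightarrow> complex" and z :: "nat \<Rightarrow> complex" and C :: complex
  assumes p_int: "\<And>i s. i \<in> {1..m} \<Longrightarrow> s \<in> {1..n} \<Longrightarrow> p i s \<in> \<int>"
    and q_int: "\<And>i j. i \<in> {1..m} \<Longrightarrow> j \<in> {1..m} \<Longrightarrow> q i j \<in> \<int>"
    and q_sym: "\<And>i j. i \<in> {1..m} \<Longrightarrow> j \<in> {1..m} \<Longrightarrow> q i j = q j i"
    and C: "C \<noteq> 0"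
begin

definition \<Phi> :: "(nat \<Rightarrow> complex) \<Rightarrow> complex" where
  "\<Phi> t = C * (\<Prod>i\<in>{1..m}. \<Prod>s\<in>{1..n}. factor_pow (t i - z s) (- p i s)) *
     (\<Prod>(i, j)\<in>{(i, j). 1 \<le> i \<and> i < j \<and> j \<le> m}. factor_pow (t i - t j) (q i j))"

definition admissible :: "(nat \<Rightarrow> complex) \<Rightarrow> bool" where
  "admissible t \<longleftrightarrow> (\<forall>i\<in>{1..m}. (\<forall>s\<in>{1..n}. p i s \<noteq> 0 \<longrightarrow> t i \<noteq> z s) \<and>
     (\<forall>j\<in>{1..m} - {i}. q i j \<noteq> 0 \<longrightarrow> t i \<noteq> t j))"

definition log_deriv :: "nat \<Rightarrow> (nat \<Rightarrow> complex) \<Rightarrow> complex" where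
  "log_deriv j t = (\<Sum>s\<in>{1..n}. - p j s / (t j - z s)) + (\<Sum>k\<in>{1..m} - {j}. q j k / (t j - t k))"

text \<open>A derivative in the variable \<open>j\<close> meets only the pairs that contain
  \<open>j\<close>; these are numbered by their other member.\<close>

lemma pair_sum:
  fixes h :: "nat \<times> nat \<Rightarrow> complex"
  assumes j: "j \<in> {1..m}" and h: "\<And>i k. i \<noteq> j \<Longrightarrow> k \<noteq> j \<Longrightarrow> h (i, k) = 0"
  shows "(\<Sum>x\<in>{(i, k). 1 \<le> i \<and> i < k \<and> k \<le> m}. h x) = (\<Sum>k\<in>{1..m} - {j}. h (if k < j then (k, j) else (j, k)))"
proof -
  let ?P = "{(i, k). 1 \<le> i \<and> i < k \<and> k \<le> m}"
  have fin: "finite ?P" by (rule finite_subset[of _ "{..m} \<times> {..m}"]) auto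
  let ?g = "\<lambda>k. if k < j then (k, j) else (j, k)"
  have inj: "inj_on ?g ({1..m} - {j})" by (auto simp: inj_on_def)
  have "(\<Sum>x\<in>?P. h x) = (\<Sum>x\<in>?g ` ({1..m} - {j}). h x)"
  proof (rule sum.mono_neutral_right[OF fin])
    show "?g ` ({1..m} - {j}) \<subseteq> ?P" using j by auto
    show "\<forall>x\<in>?P - ?g ` ({1..m} - {j}). h x = 0"
    proof
      fix x assume x: "x \<in> ?P - ?g ` ({1..m} - {j})"
      obtain i k where ik: "x = (i, k)" by (cases x)
      have "1 \<le> i" "i < k" "k \<le> m" using x by (auto simp: ik)
      have "i \<noteq> j"
      proof
        assume "i = j"
        then have "x = ?g k" "k \<in> {1..m} - {j}" using \<open>i < k\<close> \<open>k \<le> m\<close> by (auto simp: ik)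
        then show False using x by blast
      qed
      moreover have "k \<noteq> j"
      proof
        assume "k = j"
        then have "x = ?g i" "i \<in> {1..m} - {j}" using \<open>i < k\<close> \<open>1 \<le> i\<close> \<open>k \<le> m\<close> by (auto simp: ik)
        then show False using x by blast
      qed
      ultimately show "h x = 0" unfolding ik by (rule h)
    qed
  qed
  then show ?thesis using sum.reindex[OF inj, of h] by (simp add: o_def)
qed

lemma partial_deriv_\<Phi>:
  assumes t: "admissible t" and j: "j \<in> {1..m}"
  shows "partial_deriv j \<Phi> t = \<Phi> t * log_deriv j t"
proof -
  let ?P = "{(i, k). 1 \<le> i \<and> i < k \<and> k \<le> m}"
  let ?e = "\<lambda>i. if i = j then 1 else 0 :: complex"
  let ?u = "\<lambda>x. t(j := x)"
  have u: "?u (t j) = t" by simp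
  have D1: "((\<lambda>x. factor_pow (?u x i - z s) (- p i s)) has_field_derivative
      factor_pow (t i - z s) (- p i s) * (- p i s * ?e i / (t i - z s))) (at (t j))"
    if "i \<in> {1..m}" "s \<in> {1..n}" for i s
  proof -
    have "((\<lambda>x. ?u x i - z s) has_field_derivative ?e i) (at (t j))"
      using DERIV_diff[OF has_field_derivative_fun_upd DERIV_const] by (metis diff_zero)
    from has_field_derivative_factor_pow[OF this, of "- p i s"] show ?thesis
      unfolding u using p_int[OF that] t that by (auto simp: admissible_def)
  qed
  have D2: "((\<lambda>x. factor_pow (?u x i - ?u x k) (q i k)) has_field_derivative
      factor_pow (t i - t k) (q i k) * (q i k * (?e i - ?e k) / (t i - t k))) (at (t j))"
    if "(i, k) \<in> ?P" for i k
  proof -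
    have ik: "i \<in> {1..m}" "k \<in> {1..m} - {i}" using that by auto
    have "((\<lambda>x. ?u x i - ?u x k) has_field_derivative ?e i - ?e k) (at (t j))"
      by (intro DERIV_diff has_field_derivative_fun_upd)
    from has_field_derivative_factor_pow[OF this, of "q i k"] show ?thesis
      unfolding u using q_int[of i k] t ik by (auto simp: admissible_def)
  qed
  have "((\<lambda>x. \<Phi> (?u x)) has_field_derivative
     (C * ((\<Prod>i\<in>{1..m}. \<Prod>s\<in>{1..n}. factor_pow (t i - z s) (- p i s)) * (\<Sum>i\<in>{1..m}. \<Sum>s\<in>{1..n}. - p i s * ?e i / (t i - z s)))) *
       (\<Prod>(i, k)\<in>?P. factor_pow (t i - t k) (q i k)) +
     ((\<Prod>(i, k)\<in>?P. factor_pow (t i - t k) (q i k)) * (\<Sum>(i, k)\<in>?P. q i k * (?e i - ?e k) / (t i - t k))) *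
       (C * (\<Prod>i\<in>{1..m}. \<Prod>s\<in>{1..n}. factor_pow (t i - z s) (- p i s)))) (at (t j))"
  proof -
    have A: "((\<lambda>x. \<Prod>i\<in>{1..m}. \<Prod>s\<in>{1..n}. factor_pow (?u x i - z s) (- p i s)) has_field_derivative
      (\<Prod>i\<in>{1..m}. \<Prod>s\<in>{1..n}. factor_pow (?u (t j) i - z s) (- p i s)) * (\<Sum>i\<in>{1..m}. \<Sum>s\<in>{1..n}. - p i s * ?e i / (t i - z s))) (at (t j))"
      using D1 by (intro has_field_derivative_prod_log) (simp only: u)
    have B: "((\<lambda>x. \<Prod>y\<in>?P. (case y of (i, k) \<Rightarrow> factor_pow (?u x i - ?u x k) (q i k))) has_field_derivative
      (\<Prod>y\<in>?P. (case y of (i, k) \<Rightarrow> factor_pow (?u (t j) i - ?u (t j) k) (q i k))) *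
      (\<Sum>y\<in>?P. (case y of (i, k) \<Rightarrow> q i k * (?e i - ?e k) / (t i - t k)))) (at (t j))"
    proof (intro has_field_derivative_prod_log)
      fix y assume y: "y \<in> ?P"
      obtain i k where ik: "y = (i, k)" by (cases y)
      show "((\<lambda>x. (case y of (i, k) \<Rightarrow> factor_pow (?u x i - ?u x k) (q i k))) has_field_derivative
        (case y of (i, k) \<Rightarrow> factor_pow (?u (t j) i - ?u (t j) k) (q i k)) *
        (case y of (i, k) \<Rightarrow> q i k * (?e i - ?e k) / (t i - t k))) (at (t j))"
        using D2[of i k] y unfolding ik u by simp
    qed
    show ?thesis
      unfolding \<Phi>_def using DERIV_mult[OF DERIV_cmult[OF A, of C] B] unfolding u .
  qed
  moreover have "(\<Sum>i\<in>{1..m}. \<Sum>s\<in>{1..n}. - p i s * ?e i / (t i - z s)) = (\<Sum>s\<in>{1..n}. - p j s / (t j - z s))"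
    using j by (subst sum.mono_neutral_right[of _ "{j}"]) auto
  moreover have "(\<Sum>(i, k)\<in>?P. q i k * (?e i - ?e k) / (t i - t k)) = (\<Sum>k\<in>{1..m} - {j}. q j k / (t j - t k))"
  proof (subst pair_sum[OF j])
    show "(\<Sum>k\<in>{1..m} - {j}. case if k < j then (k, j) else (j, k) of (i, k) \<Rightarrow> q i k * (?e i - ?e k) / (t i - t k))
      = (\<Sum>k\<in>{1..m} - {j}. q j k / (t j - t k))"
    proof (intro sum.cong refl)
      fix k assume k: "k \<in> {1..m} - {j}"
      \<comment> \<open>For \<open>k < j\<close> the inner derivative has the opposite sign, which
        reversing the denominator absorbs.\<close>
      have "- q k j / (t k - t j) = q j k / (t j - t k)"
        using q_sym[of j k] k j by (metis DiffD1 minus_diff_eq minus_divide_right minus_divide_left)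
      then show "(case if k < j then (k, j) else (j, k) of (i, k) \<Rightarrow> q i k * (?e i - ?e k) / (t i - t k))
        = q j k / (t j - t k)" using k by auto
    qed
  qed auto
  ultimately have "((\<lambda>x. \<Phi> (?u x)) has_field_derivative \<Phi> t * log_deriv j t) (at (t j))"
    by (simp only: \<Phi>_def log_deriv_def) (simp only: algebra_simps)
  then show ?thesis unfolding partial_deriv_def by (rule DERIV_imp_deriv)
qed

lemma factor_pow_nonzero: "(a \<noteq> 0 \<Longrightarrow> x \<noteq> 0) \<Longrightarrow> factor_pow x a \<noteq> 0"
  by (simp add: factor_pow_def)

lemma \<Phi>_nonzero:
  assumes "admissible t"
  shows "\<Phi> t \<noteq> 0"
proof -
  have fin: "finite {(i, j). 1 \<le> i \<and> i < j \<and> j \<le> m}" by (rule finite_subset[of _ "{..m} \<times> {..m}"]) auto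
  have "factor_pow (t i - t j) (q i j) \<noteq> 0" if "1 \<le> i" "i < j" "j \<le> m" for i j
    using assms that by (intro factor_pow_nonzero) (auto simp: admissible_def)
  moreover have "factor_pow (t i - z s) (- p i s) \<noteq> 0" if "i \<in> {1..m}" "s \<in> {1..n}" for i s
    using assms that by (intro factor_pow_nonzero) (auto simp: admissible_def)
  ultimately show ?thesis unfolding \<Phi>_def using C fin by auto
qed

text \<open>The formula for the logarithmic derivative is to be differentiated once more, so it has
  to hold near \<open>t\<close> and not only at \<open>t\<close>.\<close>

lemma eventually_admissible:
  assumes "admissible t"
  shows "\<forall>\<^sub>F x in nhds (t i). admissible (t(i := x))"
proof -
  have lim: "((\<lambda>x. (t(i := x)) k) \<longlongrightarrow> t k) (nhds (t i))" for k
    by (cases "k = i") (auto intro: filterlim_ident)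
  have ne: "\<forall>\<^sub>F x in nhds (t i). a \<noteq> 0 \<longrightarrow> f x \<noteq> g x"
    if "(f \<longlongrightarrow> y) (nhds (t i))" "(g \<longlongrightarrow> y') (nhds (t i))" "a \<noteq> 0 \<longrightarrow> y \<noteq> y'" for f g :: "complex \<Rightarrow> complex" and y y' a :: complex
  proof (cases "a = 0")
    case False
    have "((\<lambda>x. f x - g x) \<longlongrightarrow> y - y') (nhds (t i))" using that by (intro tendsto_diff)
    then have "\<forall>\<^sub>F x in nhds (t i). f x - g x \<noteq> 0"
      by (rule tendsto_imp_eventually_ne) (use that False in auto)
    then show ?thesis by (elim eventually_mono) auto
  qed simp
  show ?thesis unfolding admissible_def
  proof (intro eventually_ball_finite ballI eventually_conj)
    fix k s assume ks: "k \<in> {1..m}" "s \<in> {1..n}"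
    show "\<forall>\<^sub>F x in nhds (t i). p k s \<noteq> 0 \<longrightarrow> (t(i := x)) k \<noteq> z s"
      using assms ks by (intro ne[OF lim tendsto_const]) (auto simp: admissible_def)
  next
    fix k j assume kj: "k \<in> {1..m}" "j \<in> {1..m} - {k}"
    show "\<forall>\<^sub>F x in nhds (t i). q k j \<noteq> 0 \<longrightarrow> (t(i := x)) k \<noteq> (t(i := x)) j"
      using assms kj by (intro ne[OF lim lim]) (auto simp: admissible_def)
  qed auto
qed

lemma second_log_deriv:
  assumes t: "admissible t" and i: "i \<in> {1..m}" and j: "j \<in> {1..m}"
  shows "partial_deriv i (\<lambda>t'. partial_deriv j \<Phi> t' / \<Phi> t') t =
    (if i = j then (\<Sum>s\<in>{1..n}. p i s / (t i - z s)\<^sup>2) - (\<Sum>k\<in>{1..m} - {i}. q i k / (t i - t k)\<^sup>2)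
     else q i j / (t i - t j)\<^sup>2)"
proof -
  let ?e = "\<lambda>k. if k = i then 1 else 0 :: complex"
  let ?u = "\<lambda>x. t(i := x)"
  have u: "?u (t i) = t" by simp
  have ev: "\<forall>\<^sub>F x in nhds (t i). partial_deriv j \<Phi> (?u x) / \<Phi> (?u x) = log_deriv j (?u x)"
    using eventually_admissible[OF t, of i]
    by (elim eventually_mono) (simp add: partial_deriv_\<Phi>[OF _ j] \<Phi>_nonzero)
  have "((\<lambda>x. log_deriv j (?u x)) has_field_derivative
     (\<Sum>s\<in>{1..n}. p j s * ?e j / (t j - z s)\<^sup>2) + (\<Sum>k\<in>{1..m} - {j}. - q j k * (?e j - ?e k) / (t j - t k)\<^sup>2)) (at (t i))"
    unfolding log_deriv_def
  proof (intro DERIV_add DERIV_sum)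
    fix s assume s: "s \<in> {1..n}"
    have "((\<lambda>x. ?u x j - z s) has_field_derivative ?e j) (at (t i))"
      using DERIV_diff[OF has_field_derivative_fun_upd DERIV_const] by (metis diff_zero)
    from has_field_derivative_const_divide[OF this, of "- p j s"]
    show "((\<lambda>x. - p j s / (?u x j - z s)) has_field_derivative p j s * ?e j / (t j - z s)\<^sup>2) (at (t i))"
      unfolding u using t j s by (auto simp: admissible_def)
  next
    fix k assume k: "k \<in> {1..m} - {j}"
    have "((\<lambda>x. ?u x j - ?u x k) has_field_derivative ?e j - ?e k) (at (t i))"
      by (intro DERIV_diff has_field_derivative_fun_upd)
    from has_field_derivative_const_divide[OF this, of "q j k"]
    show "((\<lambda>x. q j k / (?u x j - ?u x k)) has_field_derivative - q j k * (?e j - ?e k) / (t j - t k)\<^sup>2) (at (t i))"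
      unfolding u using t j k by (auto simp: admissible_def)
  qed
  then have "partial_deriv i (\<lambda>t'. partial_deriv j \<Phi> t' / \<Phi> t') t =
     (\<Sum>s\<in>{1..n}. p j s * ?e j / (t j - z s)\<^sup>2) + (\<Sum>k\<in>{1..m} - {j}. - q j k * (?e j - ?e k) / (t j - t k)\<^sup>2)"
    unfolding partial_deriv_def[of i] deriv_cong_ev[OF ev refl] by (rule DERIV_imp_deriv)
  also have "\<dots> = (if i = j then (\<Sum>s\<in>{1..n}. p i s / (t i - z s)\<^sup>2) - (\<Sum>k\<in>{1..m} - {i}. q i k / (t i - t k)\<^sup>2)
     else q i j / (t i - t j)\<^sup>2)"
  proof (cases "i = j")
    case True
    have "(\<Sum>k\<in>{1..m} - {j}. - q j k * (?e j - ?e k) / (t j - t k)\<^sup>2) = (\<Sum>k\<in>{1..m} - {j}. - (q j k / (t j - t k)\<^sup>2))"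
      using True by (intro sum.cong) auto
    then show ?thesis using True by (simp add: sum_negf)
  next
    case False
    have "(\<Sum>k\<in>{1..m} - {j}. - q j k * (?e j - ?e k) / (t j - t k)\<^sup>2) = (\<Sum>k\<in>{i}. q j k / (t j - t k)\<^sup>2)"
      using False i by (intro sum.mono_neutral_cong_right) auto
    then show ?thesis using False q_sym[OF i j] by (simp add: power2_commute)
  qed
  finally show ?thesis .
qed

text \<open>Each factor depends on one difference of coordinates, so its logarithm contributes to
  the second derivatives a value on the diagonal and its negative off the diagonal. The edge weights
  are - q between labels and p to the slots, each divided by the square of the difference.\<close>

lemma hess_log_eq_laplacian:
  assumes t: "admissible t"
  shows "hess_log \<Phi> m t = Determinant.det (laplacian {1..n} m
    (\<lambda>i x. case x of Inl k \<Rightarrow> - q (Suc i) (Suc k) | Inr s \<Rightarrow> p (Suc i) s) z (t \<circ> Suc) (t \<circ> Suc))"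
  unfolding hess_log_def laplacian_def
proof (intro arg_cong[of _ _ Determinant.det] cong_mat refl)
  fix i j assume ij: "i < m" "j < m"
  let ?w = "\<lambda>i x. case x of Inl k \<Rightarrow> - q (Suc i) (Suc k) | Inr s \<Rightarrow> p (Suc i) s"
  let ?t = "t \<circ> Suc"
  have shift: "(\<Sum>k\<in>{1..m} - {Suc i}. q (Suc i) k / (t (Suc i) - t k)\<^sup>2)
      = (\<Sum>k = 0..<m. q (Suc i) (Suc k) / (t (Suc i) - t (Suc k))\<^sup>2)"
  proof -
    have "(\<Sum>k = 0..<m. q (Suc i) (Suc k) / (t (Suc i) - t (Suc k))\<^sup>2) = (\<Sum>k\<in>Suc ` {0..<m}. q (Suc i) k / (t (Suc i) - t k)\<^sup>2)"
      by (subst sum.reindex) auto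
    also have "Suc ` {0..<m} = {1..m}" by (simp add: image_Suc_atLeastLessThan atLeastLessThanSuc_atLeastAtMost)
    also have "(\<Sum>k\<in>{1..m}. q (Suc i) k / (t (Suc i) - t k)\<^sup>2) = (\<Sum>k\<in>{1..m} - {Suc i}. q (Suc i) k / (t (Suc i) - t k)\<^sup>2)"
      by (intro sum.mono_neutral_right) auto
    finally show ?thesis by simp
  qed
  have diag: "(\<Sum>x\<in>targets {1..n} {0..<m}. ?w i x / ((?t i - target_val ?t z x) * (?t i - target_val ?t z x)))
     = (\<Sum>s\<in>{1..n}. p (Suc i) s / (t (Suc i) - z s)\<^sup>2) - (\<Sum>k\<in>{1..m} - {Suc i}. q (Suc i) k / (t (Suc i) - t k)\<^sup>2)"
    unfolding shift by (simp add: sum_targets power2_eq_square sum_negf)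
  have "Suc i \<in> {1..m}" "Suc j \<in> {1..m}" using ij by auto
  from second_log_deriv[OF t this]
  show "(case (i, j) of (i, j) \<Rightarrow> partial_deriv (Suc i) (\<lambda>t'. partial_deriv (Suc j) \<Phi> t' / \<Phi> t') t) =
    (case (i, j) of (i, j) \<Rightarrow> (if i = j then \<Sum>x\<in>targets {1..n} {0..<m}. ?w i x / ((?t i - target_val ?t z x) * (?t i - target_val ?t z x)) else 0)
      - ?w i (Inl j) / ((?t i - ?t j) * (?t i - ?t j)))"
    unfolding prod.case diag by (simp add: power2_eq_square)
qed

end

section \<open>The Laplacian at a critical point\<close>

text \<open>The terms with \<open>x = Inl i\<close> vanish because their denominators do.\<close>

definition regular_point :: "nat set \<Rightarrow> nat \<Rightarrow> (nat \<Rightarrow> nat + nat \<Rightarrow> complex) \<Rightarrow> (nat \<Rightarrow> complex)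
    \<Rightarrow> (nat \<Rightarrow> complex) \<Rightarrow> bool" where
  "regular_point N m w z t \<longleftrightarrow> (\<forall>i<m. \<forall>x\<in>targets N {0..<m}. w i x \<noteq> 0 \<longrightarrow> x \<noteq> Inl i \<longrightarrow> t i \<noteq> target_val t z x)"

locale weighted_points =
  fixes N :: "nat set" and m :: nat and w :: "nat \<Rightarrow> nat + nat \<Rightarrow> complex" and z t0 :: "nat \<Rightarrow> complex"
  assumes fin: "finite N" and regular: "regular_point N m w z t0"
begin

lemma tendsto_target_val:
  assumes "\<And>i. i < m \<Longrightarrow> ((\<lambda>y. f y i) \<longlongrightarrow> u i) F" "x \<in> targets N {0..<m}"
  shows "((\<lambda>y. target_val (f y) z x) \<longlongrightarrow> target_val u z x) F"
  using assms by (auto simp: targets_def)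

lemma tendsto_weight:
  assumes lim: "\<And>i. i < m \<Longrightarrow> ((\<lambda>y. f y i) \<longlongrightarrow> t0 i) F" and i: "i < m" and x: "x \<in> targets N {0..<m}"
  shows "((\<lambda>y. w i x / (f y i - target_val (f y) z x)) \<longlongrightarrow> w i x / (t0 i - target_val t0 z x)) F"
\<comment> \<open>In these two cases both quotients are 0, whether or not coordinates collide;
  otherwise regularity makes the limit of the denominators nonzero.\<close>
proof (cases "w i x = 0 \<or> x = Inl i")
  case False
  then have "t0 i - target_val t0 z x \<noteq> 0" using regular i x by (auto simp: regular_point_def)
  then show ?thesis by (intro tendsto_divide tendsto_const tendsto_diff lim i tendsto_target_val x)
qed auto

lemma tendsto_chain_weight:
  assumes lim: "\<And>i. i < m \<Longrightarrow> ((\<lambda>y. f y i) \<longlongrightarrow> t0 i) F" and s: "s \<in> N" and "set b \<subseteq> {0..<m}"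
  shows "((\<lambda>y. chain_weight (\<lambda>i x. w i x / (f y i - target_val (f y) z x)) s b) \<longlongrightarrow>
    chain_weight (\<lambda>i x. w i x / (t0 i - target_val t0 z x)) s b) F"
  using assms(3)
proof (induction b)
  case (Cons i b)
  have tg: "Inr s \<in> targets N {0..<m}" "\<And>q. q \<in> set b \<Longrightarrow> Inl q \<in> targets N {0..<m}"
    using Cons.prems s by (auto simp: targets_def)
  show ?case unfolding chain_weight.simps
  proof (intro tendsto_mult tendsto_add tendsto_sum)
    show "((\<lambda>y. w i (Inr s) / (f y i - target_val (f y) z (Inr s))) \<longlongrightarrow> w i (Inr s) / (t0 i - target_val t0 z (Inr s))) F"
      using Cons.prems by (intro tendsto_weight[OF lim _ tg(1)]) auto
    show "((\<lambda>y. w i (Inl q) / (f y i - target_val (f y) z (Inl q))) \<longlongrightarrow> w i (Inl q) / (t0 i - target_val t0 z (Inl q))) F"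
      if "q \<in> set b" for q
      using Cons.prems by (intro tendsto_weight[OF lim _ tg(2)[OF that]]) auto
  qed (use Cons in auto)
qed simp

end

text \<open>For a colour preserving permutation these equations hold because the weights depend on
  the labels only through their colours.\<close>

locale weight_symmetry = weighted_points +
  fixes \<pi> :: "nat \<Rightarrow> nat"
  assumes perm: "\<pi> permutes {0..<m}"
    and sym: "\<And>i s. i < m \<Longrightarrow> w (\<pi> i) (Inr s) = w i (Inr s)"
      "\<And>i k. i < m \<Longrightarrow> k < m \<Longrightarrow> w (\<pi> i) (Inl (\<pi> k)) = w i (Inl k)"
begin

lemma perm_lt: "i < m \<Longrightarrow> \<pi> i < m"
  using permutes_in_image[OF perm, of i] by simp

lemma perm_eq [simp]: "\<pi> i = \<pi> k \<longleftrightarrow> i = k"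
  using permutes_inj[OF perm] by (simp add: inj_eq)

lemma regular_perm:
  assumes "i < m" "x \<in> targets N {0..<m}" "w i x \<noteq> 0" "x \<noteq> Inl i"
  shows "t0 (\<pi> i) \<noteq> target_val (t0 \<circ> \<pi>) z x"
proof (cases x)
  case (Inl k)
  then have k: "k < m" using assms(2) by (auto simp: targets_def)
  then have "Inl (\<pi> k) \<in> targets N {0..<m}" using perm_lt by (simp add: targets_def)
  then show ?thesis
    using regular assms Inl k sym(2)[of i k] perm_lt[of i] unfolding regular_point_def by fastforce
next
  case (Inr s)
  then show ?thesis
    using regular assms sym(1)[of i s] perm_lt[of i] unfolding regular_point_def by fastforce
qed

lemma tendsto_det_laplacian:
  assumes lim: "\<And>i. i < m \<Longrightarrow> ((\<lambda>y. f y i) \<longlongrightarrow> t0 i) F"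
  shows "((\<lambda>y. Determinant.det (laplacian N m w z (f y) (f y \<circ> \<pi>))) \<longlongrightarrow>
    Determinant.det (laplacian N m w z t0 (t0 \<circ> \<pi>))) F"
proof -
  have lim': "((\<lambda>y. (f y \<circ> \<pi>) i) \<longlongrightarrow> (t0 \<circ> \<pi>) i) F" if "i < m" for i
    using lim[OF perm_lt[OF that]] by simp
  have trm: "((\<lambda>y. w i x / ((f y i - target_val (f y) z x) * ((f y \<circ> \<pi>) i - target_val (f y \<circ> \<pi>) z x))) \<longlongrightarrow>
      w i x / ((t0 i - target_val t0 z x) * ((t0 \<circ> \<pi>) i - target_val (t0 \<circ> \<pi>) z x))) F"
    if i: "i < m" and x: "x \<in> targets N {0..<m}" for i x
  proof (cases "w i x = 0 \<or> x = Inl i")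
    case False
    then have "t0 i - target_val t0 z x \<noteq> 0" "(t0 \<circ> \<pi>) i - target_val (t0 \<circ> \<pi>) z x \<noteq> 0"
      using regular i x regular_perm[OF i x] by (auto simp: regular_point_def)
    then have "(t0 i - target_val t0 z x) * ((t0 \<circ> \<pi>) i - target_val (t0 \<circ> \<pi>) z x) \<noteq> 0" by simp
    then show ?thesis
      by (intro tendsto_divide tendsto_const tendsto_mult tendsto_diff lim lim' i tendsto_target_val x)
  qed auto
  have entry: "((\<lambda>y. laplacian N m w z (f y) (f y \<circ> \<pi>) $$ (i, j)) \<longlongrightarrow> laplacian N m w z t0 (t0 \<circ> \<pi>) $$ (i, j)) F"
    if ij: "i < m" "j < m" for i j
  proof -
    have "Inl j \<in> targets N {0..<m}" using ij by (simp add: targets_def)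
    from trm[OF ij(1) this] have
      "((\<lambda>y. w i (Inl j) / ((f y i - f y j) * ((f y \<circ> \<pi>) i - (f y \<circ> \<pi>) j))) \<longlongrightarrow>
        w i (Inl j) / ((t0 i - t0 j) * ((t0 \<circ> \<pi>) i - (t0 \<circ> \<pi>) j))) F" by simp
    moreover have "((\<lambda>y. if i = j then \<Sum>x\<in>targets N {0..<m}. w i x /
        ((f y i - target_val (f y) z x) * ((f y \<circ> \<pi>) i - target_val (f y \<circ> \<pi>) z x)) else 0) \<longlongrightarrow>
      (if i = j then \<Sum>x\<in>targets N {0..<m}. w i x /
        ((t0 i - target_val t0 z x) * ((t0 \<circ> \<pi>) i - target_val (t0 \<circ> \<pi>) z x)) else 0)) F"
      using trm[OF ij(1)] by (cases "i = j") (auto simp del: comp_apply intro!: tendsto_sum)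
    ultimately show ?thesis
      unfolding laplacian_def index_mat(1)[OF ij] prod.case by (rule tendsto_diff[rotated])
  qed
  have car: "laplacian N m w z t u \<in> carrier_mat m m" for t u by (simp add: laplacian_def)
  show ?thesis unfolding det_def'[OF car]
  proof (intro tendsto_sum tendsto_mult tendsto_const tendsto_prod)
    fix \<sigma> i assume "\<sigma> \<in> {\<sigma>. \<sigma> permutes {0..<m}}" and i: "i \<in> {0..<m}"
    then have "\<sigma> i < m" using permutes_in_image[of \<sigma> "{0..<m}" i] by simp
    then show "((\<lambda>y. laplacian N m w z (f y) (f y \<circ> \<pi>) $$ (i, \<sigma> i)) \<longlongrightarrow> laplacian N m w z t0 (t0 \<circ> \<pi>) $$ (i, \<sigma> i)) F"
      using i by (intro entry) auto
  qed
qed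

text \<open>The vector \<open>t0 - t0 \<circ> \<pi>\<close> is in the kernel, since \<open>(t - u) / ((t - z) (u - z)) = 1 / (u - z) - 1 / (t - z)\<close>
  turns its image into a difference of two systems of critical point equations.\<close>

lemma det_laplacian_perm:
  assumes crit: "\<And>i. i < m \<Longrightarrow> (\<Sum>x\<in>targets N {0..<m}. w i x / (t0 i - target_val t0 z x)) = 0"
    and nz: "\<And>i. i < m \<Longrightarrow> w i (Inl (\<pi> i)) \<noteq> 0" and "\<pi> \<noteq> id"
  shows "Determinant.det (laplacian N m w z t0 (t0 \<circ> \<pi>)) = 0"
proof -
  let ?u = "t0 \<circ> \<pi>"
  let ?X = "targets N {0..<m}"
  let ?L = "laplacian N m w z t0 ?u"
  define v where "v = vec m (\<lambda>i. t0 i - ?u i)"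
  \<comment> \<open>Both points have the same roots \<open>z s\<close>, so the difference vanishes
    there, and a sum over labels extends to all targets.\<close>
  define tv where "tv x = (case x of Inl k \<Rightarrow> t0 k - ?u k | Inr s \<Rightarrow> 0)" for x :: "nat + nat"
  have tv: "tv x = target_val t0 z x - target_val ?u z x" for x by (cases x) (simp_all add: tv_def)
  define M where "M i x = w i x / ((t0 i - target_val t0 z x) * (?u i - target_val ?u z x))" for i x
  obtain i0 where i0: "\<pi> i0 \<noteq> i0" using \<open>\<pi> \<noteq> id\<close> by (auto simp: fun_eq_iff)
  then have i0m: "i0 < m" using permutes_not_in[OF perm, of i0] by (cases "i0 < m") auto
  \<comment> \<open>The critical point equation of the label \<open>\<pi> i\<close>, renumbered by
    \<open>\<pi>\<close> with the help of the invariance of the weights.\<close>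
  have crit': "(\<Sum>x\<in>?X. w i x / (?u i - target_val ?u z x)) = 0" if i: "i < m" for i
  proof -
    have "(\<Sum>k\<in>{0..<m}. w (\<pi> i) (Inl k) / (t0 (\<pi> i) - t0 k)) = (\<Sum>k\<in>{0..<m}. w (\<pi> i) (Inl (\<pi> k)) / (t0 (\<pi> i) - t0 (\<pi> k)))"
      by (rule sum.reindex_bij_betw[OF permutes_imp_bij[OF perm], symmetric])
    then show ?thesis
      using crit[OF perm_lt[OF i]] i sym by (simp add: sum_targets fin)
  qed
  have mul: "M i x * (t0 i - ?u i - tv x) = w i x / (?u i - target_val ?u z x) - w i x / (t0 i - target_val t0 z x)"
    if i: "i < m" and x: "x \<in> ?X" for i x
  proof (cases "w i x = 0 \<or> x = Inl i")
    case False
    then have "t0 i - target_val t0 z x \<noteq> 0" "?u i - target_val ?u z x \<noteq> 0"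
      using regular i x regular_perm[OF i x] by (auto simp: regular_point_def)
    moreover have "w * (a - b) / (a * b) = w / b - w / a" if "a \<noteq> 0" "b \<noteq> 0" for w a b :: complex
      using that by (simp add: field_simps)
    ultimately have "w i x * ((t0 i - target_val t0 z x) - (?u i - target_val ?u z x)) /
        ((t0 i - target_val t0 z x) * (?u i - target_val ?u z x))
      = w i x / (?u i - target_val ?u z x) - w i x / (t0 i - target_val t0 z x)" by blast
    moreover have "t0 i - ?u i - tv x = (t0 i - target_val t0 z x) - (?u i - target_val ?u z x)" by (simp add: tv)
    ultimately show ?thesis unfolding M_def by (simp only: times_divide_eq_left)
  qed (auto simp: M_def)
  have "?L *\<^sub>v v = 0\<^sub>v m"
  proof (rule eq_vecI)
    fix i assume "i < dim_vec (0\<^sub>v m :: complex vec)"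
    then have i: "i < m" by simp
    have "(?L *\<^sub>v v) $ i = (\<Sum>j = 0..<m. (if i = j then (\<Sum>x\<in>?X. M i x) * (t0 j - ?u j) else 0) - M i (Inl j) * (t0 j - ?u j))"
      using i by (auto simp: laplacian_def v_def scalar_prod_def M_def algebra_simps intro!: sum.cong)
    also have "\<dots> = (\<Sum>x\<in>?X. M i x) * (t0 i - ?u i) - (\<Sum>j = 0..<m. M i (Inl j) * (t0 j - ?u j))"
      unfolding sum_subtractf using i by (subst sum.delta') auto
    also have "(\<Sum>j = 0..<m. M i (Inl j) * (t0 j - ?u j)) = (\<Sum>x\<in>?X. M i x * tv x)"
      by (simp add: sum_targets fin tv_def)
    also have "(\<Sum>x\<in>?X. M i x) * (t0 i - ?u i) - (\<Sum>x\<in>?X. M i x * tv x) = (\<Sum>x\<in>?X. M i x * (t0 i - ?u i - tv x))"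
      by (simp only: sum_distrib_right sum_subtractf[symmetric] right_diff_distrib)
    also have "\<dots> = (\<Sum>x\<in>?X. w i x / (?u i - target_val ?u z x) - w i x / (t0 i - target_val t0 z x))"
      by (intro sum.cong refl mul i)
    also have "\<dots> = 0" unfolding sum_subtractf crit'[OF i] crit[OF i] by simp
    finally show "(?L *\<^sub>v v) $ i = 0\<^sub>v m $ i" unfolding index_zero_vec(1)[OF i] .
  qed (simp add: laplacian_def)
  moreover have "v \<noteq> 0\<^sub>v m"
  proof
    assume "v = 0\<^sub>v m"
    then have "v $ i0 = 0" using i0m by simp
    \<comment> \<open>Regularity forbids this coincidence, since the edge from \<open>i0\<close> to
      \<open>\<pi> i0\<close> has a nonzero weight.\<close>
    then have "t0 i0 = t0 (\<pi> i0)" using i0m by (simp add: v_def)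
    moreover have "Inl (\<pi> i0) \<in> ?X" using perm_lt[OF i0m] by (simp add: targets_def)
    ultimately show False using regular nz[OF i0m] i0 i0m unfolding regular_point_def by fastforce
  qed
  ultimately show ?thesis
    by (subst det_0_iff_vec_prod_zero[of _ m]) (auto simp: laplacian_def v_def intro!: exI[of _ v])
qed

end

section \<open>The norm of the Bethe vector\<close>

lemma simple_root_cartan_dual: "i \<in> {1..r} \<Longrightarrow> simple_root i \<in> cartan_dual r"
  by (auto simp: cartan_dual_def simple_root_def cartan_def sl_def algebra_simps)

section \<open>From single slots to the tensor product\<close>

locale bethe_setting =
  fixes r n :: nat and \<Lambda> :: "nat \<Rightarrow> weight" and l :: "nat \<Rightarrow> nat" and z :: "nat \<Rightarrow> complex"
    and scaleV :: "complex \<Rightarrow> 'v::ab_group_add \<Rightarrow> 'v" and V :: "nat \<Rightarrow> 'v set"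
    and act :: "nat \<Rightarrow> complex mat \<Rightarrow> 'v \<Rightarrow> 'v" and v :: "nat \<Rightarrow> 'v"
    and scaleW :: "complex \<Rightarrow> 'w::ab_group_add \<Rightarrow> 'w" and W :: "'w set" and T :: "(nat \<Rightarrow> 'v) \<Rightarrow> 'w"
    and B :: "nat \<Rightarrow> 'v \<Rightarrow> 'v \<Rightarrow> complex" and S :: "'w \<Rightarrow> 'w \<Rightarrow> complex"
  assumes dominant: "\<And>s. s \<in> {1..n} \<Longrightarrow> integral_dominant r (\<Lambda> s)"
    and modules: "\<And>s. s \<in> {1..n} \<Longrightarrow> shapovalov_module scaleV r (V s) (act s) (\<Lambda> s) (v s) (B s)"
    and tensor: "is_tensor_product scaleV scaleW n V W T"
    and form: "tensor_form scaleW n V W T B S"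
begin

abbreviation "N \<equiv> {1..n}"
abbreviation "m \<equiv> total_mult r l"
abbreviation "c i \<equiv> color l (Suc i)"
abbreviation "Tup \<equiv> label_tuples N {0..<m}"
abbreviation "Fw s J \<equiv> foldr (\<lambda>i. act s (chev_F r i)) J (v s)"
abbreviation "wfun \<equiv> weight_function scaleW r n act v T l z"

text \<open>The signs are such that the sum of \<open>wt i x / (t i - target_val t z x)\<close> over
  all targets is minus the left side of the critical point equation.\<close>

definition wt :: "nat \<Rightarrow> nat + nat \<Rightarrow> complex" where
  "wt i x = (case x of Inl k \<Rightarrow> - weight_form r (root_of l (Suc i)) (root_of l (Suc k))
     | Inr s \<Rightarrow> weight_form r (root_of l (Suc i)) (\<Lambda> s))"

text \<open>The pairing of \<omega>(t) with the tensor of the words \<open>K s\<close>, in a form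
  that remains continuous at a critical point.\<close>

definition chain_sum :: "(nat \<Rightarrow> nat list) \<Rightarrow> (nat \<Rightarrow> complex) \<Rightarrow> complex" where
  "chain_sum K t = (\<Sum>b\<in>{b \<in> Tup. \<forall>s\<in>N. map c (b s) = K s}.
     \<Prod>s\<in>N. chain_weight (\<lambda>i x. wt i x / (t i - target_val t z x)) s (b s))"

lemma color_range: "i < m \<Longrightarrow> c i \<in> {1..r}"
  using color_in[of "Suc i" r l] by auto

lemma V_scale: "vector_space scaleV" and W_scale: "vector_space scaleW"
  and V_subspace: "s \<in> N \<Longrightarrow> module.subspace scaleV (V s)"
  and T_multilinear: "multilinear_on scaleV scaleW n V T"
  and W_span: "module.span scaleW (T ` PiE N V) = W"
  using tensor by (auto simp: is_tensor_product_def)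

sublocale wsp: vector_space scaleW by (rule W_scale)

lemma T_in_W: "x \<in> PiE N V \<Longrightarrow> T x \<in> W"
  unfolding W_span[symmetric] by (intro wsp.span_base) simp

lemma Fw_in_V:
  assumes "s \<in> N" "set J \<subseteq> {1..r}"
  shows "Fw s J \<in> V s"
proof -
  interpret shapovalov_module scaleV r "V s" "act s" "\<Lambda> s" "v s" "B s" by (rule modules[OF assms(1)])
  show ?thesis using F_word_in_V[OF assms(2)] by (simp add: F_word_def)
qed

lemma tuple_word:
  assumes "b \<in> Tup" "s \<in> N"
  shows "set (map c (b s)) \<subseteq> {1..r}" "length (map c (b s)) \<le> m"
proof -
  have sub: "set (b s) \<subseteq> {0..<m}" by (rule label_tuplesD(2)[OF assms])
  then show "set (map c (b s)) \<subseteq> {1..r}" using color_range by fastforce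
  show "length (map c (b s)) \<le> m"
    using card_mono[OF _ sub] distinct_card[OF label_tuplesD(1)[OF assms]] by simp
qed

lemma S_sum_left:
  assumes "\<And>k. k \<in> I \<Longrightarrow> y k \<in> W" "u \<in> W"
  shows "S (\<Sum>k\<in>I. scaleW (a k) (y k)) u = (\<Sum>k\<in>I. a k * S (y k) u)"
proof -
  have W: "wsp.subspace W" using wsp.subspace_span W_span by metis
  have add: "S (x + y) u = S x u + S y u" and scale: "S (scaleW b x) u = b * S x u" if "x \<in> W" "y \<in> W" for x y b
    using form that assms(2) unfolding tensor_form_def bilinear_form_on_def by blast+
  have 0: "S 0 u = 0" using scale[OF wsp.subspace_0[OF W] wsp.subspace_0[OF W], of 0] by simp
  show ?thesis
  proof (cases "finite I")
    case True
    then show ?thesis using assms(1)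
    proof (induction I)
      case (insert k I)
      have "(\<Sum>k\<in>I. scaleW (a k) (y k)) \<in> W" "y k \<in> W" "scaleW (a k) (y k) \<in> W"
        using insert.prems by (auto intro!: wsp.subspace_sum[OF W] wsp.subspace_scale[OF W])
      then show ?case using insert by (simp add: add scale)
    qed (simp add: 0)
  qed (simp add: 0)
qed

lemma S_sum_right:
  assumes "\<And>k. k \<in> I \<Longrightarrow> y k \<in> W" "u \<in> W"
  shows "S u (\<Sum>k\<in>I. scaleW (a k) (y k)) = (\<Sum>k\<in>I. a k * S u (y k))"
proof -
  have W: "wsp.subspace W" using wsp.subspace_span W_span by metis
  have add: "S u (x + y) = S u x + S u y" and scale: "S u (scaleW b x) = b * S u x" if "x \<in> W" "y \<in> W" for x y b
    using form that assms(2) unfolding tensor_form_def bilinear_form_on_def by blast+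
  have 0: "S u 0 = 0" using scale[OF wsp.subspace_0[OF W] wsp.subspace_0[OF W], of 0] by simp
  show ?thesis
  proof (cases "finite I")
    case True
    then show ?thesis using assms(1)
    proof (induction I)
      case (insert k I)
      have "(\<Sum>k\<in>I. scaleW (a k) (y k)) \<in> W" "y k \<in> W" "scaleW (a k) (y k) \<in> W"
        using insert.prems by (auto intro!: wsp.subspace_sum[OF W] wsp.subspace_scale[OF W])
      then show ?case using insert by (simp add: add scale)
    qed (simp add: 0)
  qed (simp add: 0)
qed

lemma S_sums:
  assumes "\<And>k. k \<in> I \<Longrightarrow> y k \<in> W"
  shows "S (\<Sum>k\<in>I. scaleW (a k) (y k)) (\<Sum>k\<in>I. scaleW (a k) (y k)) = (\<Sum>j\<in>I. a j * (\<Sum>k\<in>I. a k * S (y k) (y j)))"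
proof -
  have W: "wsp.subspace W" using wsp.subspace_span W_span by metis
  have "(\<Sum>k\<in>I. scaleW (a k) (y k)) \<in> W"
    using assms by (intro wsp.subspace_sum[OF W] wsp.subspace_scale[OF W])
  then show ?thesis
    using S_sum_right[of I y "\<Sum>k\<in>I. scaleW (a k) (y k)" a] S_sum_left[of I y _ a] assms by simp
qed

text \<open>Once each label has been given a slot, both sides factor over the slots, and
  \<open>omega_shapovalov_sum\<close> applies to the labels of each slot.\<close>

lemma omega_pairing:
  assumes t: "inj_on t {0..<m}" "\<And>s. s \<in> N \<Longrightarrow> z s \<notin> t ` {0..<m}"
    and K: "\<And>s. s \<in> N \<Longrightarrow> set (K s) \<subseteq> {1..r}"
  shows "(\<Sum>b\<in>Tup. (\<Prod>s\<in>N. omega_word t (z s) (b s)) * (\<Prod>s\<in>N. B s (Fw s (map c (b s))) (Fw s (K s)))) = chain_sum K t"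
proof -
  let ?G = "\<lambda>s b. chain_weight (\<lambda>i x. wt i x / (t i - target_val t z x)) s b"
  let ?fib = "\<lambda>g s. {i \<in> {0..<m}. g i = s}"
  let ?perms = "\<lambda>g s. permutations_of_set (?fib g s)"
  have slot: "(\<Sum>a\<in>?perms g s. omega_word t (z s) a * B s (Fw s (map c a)) (Fw s (K s)))
      = (\<Sum>a\<in>?perms g s. if map c a = K s then ?G s a else 0)" if s: "s \<in> N" for g s
  proof -
    interpret shapovalov_module scaleV r "V s" "act s" "\<Lambda> s" "v s" "B s" by (rule modules[OF s])
    let ?X = "?fib g s"
    have X: "?X \<subseteq> {0..<m}" by auto
    have dual: "\<Lambda> s \<in> cartan_dual r" using dominant[OF s] by (simp add: integral_dominant_def)
    have "(\<Sum>a\<in>permutations_of_set ?X. omega_word t (z s) a * B s (F_word (map c a)) (F_word (K s)))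
      = (\<Sum>b\<in>{b \<in> permutations_of_set ?X. map c b = K s}. ?G s b)"
    proof (rule omega_shapovalov_sum)
      show "finite ?X" by simp
      show "inj_on t ?X" by (rule inj_on_subset[OF t(1) X])
      show "z s \<notin> t ` ?X" using t(2)[OF s] X by auto
      show "set (K s) \<subseteq> {1..r}" by (rule K[OF s])
      fix i assume i: "i \<in> ?X"
      then have ci: "c i \<in> {1..r}" using color_range[of i] by simp
      then show "c i \<in> {1..r}" .
      show "wt i (Inr s) / (t i - target_val t z (Inr s)) = \<Lambda> s (chev_H r (c i)) / (t i - z s)"
        using weight_form_simple_root_left[OF ci dual] by (simp add: wt_def)
      fix q assume q: "q \<in> ?X"
      then have cq: "c q \<in> {1..r}" using color_range[of q] by simp
      show "wt i (Inl q) / (t i - target_val t z (Inl q)) = - simple_root (c q) (chev_H r (c i)) / (t i - t q)"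
        using weight_form_simple_root_left[OF ci simple_root_cartan_dual[OF cq]] by (simp add: wt_def)
    qed
    then show ?thesis by (simp add: F_word_def sum.inter_filter)
  qed
  have "(\<Sum>b\<in>Tup. (\<Prod>s\<in>N. omega_word t (z s) (b s)) * (\<Prod>s\<in>N. B s (Fw s (map c (b s))) (Fw s (K s))))
    = (\<Sum>g\<in>PiE {0..<m} (\<lambda>_. N). \<Sum>b\<in>PiE N (?perms g). \<Prod>s\<in>N. omega_word t (z s) (b s) * B s (Fw s (map c (b s))) (Fw s (K s)))"
    unfolding prod.distrib[symmetric] by (rule sum_label_tuples) auto
  also have "\<dots> = (\<Sum>g\<in>PiE {0..<m} (\<lambda>_. N). \<Prod>s\<in>N. \<Sum>a\<in>?perms g s. omega_word t (z s) a * B s (Fw s (map c a)) (Fw s (K s)))"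
    by (intro sum.cong refl prod_sum_PiE[symmetric]) auto
  also have "\<dots> = (\<Sum>g\<in>PiE {0..<m} (\<lambda>_. N). \<Prod>s\<in>N. \<Sum>a\<in>?perms g s. if map c a = K s then ?G s a else 0)"
    by (intro sum.cong prod.cong refl slot)
  also have "\<dots> = (\<Sum>g\<in>PiE {0..<m} (\<lambda>_. N). \<Sum>b\<in>PiE N (?perms g). \<Prod>s\<in>N. if map c (b s) = K s then ?G s (b s) else 0)"
    by (intro sum.cong refl prod_sum_PiE) auto
  also have "\<dots> = (\<Sum>b\<in>Tup. \<Prod>s\<in>N. if map c (b s) = K s then ?G s (b s) else 0)"
    by (rule sum_label_tuples[symmetric]) auto
  also have "\<dots> = (\<Sum>b\<in>Tup. if \<forall>s\<in>N. map c (b s) = K s then \<Prod>s\<in>N. ?G s (b s) else 0)"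
  proof (intro sum.cong refl)
    fix b
    show "(\<Prod>s\<in>N. if map c (b s) = K s then ?G s (b s) else 0) =
      (if \<forall>s\<in>N. map c (b s) = K s then \<Prod>s\<in>N. ?G s (b s) else 0)"
    proof (cases "\<forall>s\<in>N. map c (b s) = K s")
      case True
      then have "(\<Prod>s\<in>N. if map c (b s) = K s then ?G s (b s) else 0) = (\<Prod>s\<in>N. ?G s (b s))"
        by (intro prod.cong refl) simp
      then show ?thesis unfolding if_P[OF True] .
    next
      case False
      then obtain s where "s \<in> N" "map c (b s) \<noteq> K s" by blast
      then have "(\<Prod>s\<in>N. if map c (b s) = K s then ?G s (b s) else 0) = 0"
        by (intro prod_zero) auto
      then show ?thesis unfolding if_not_P[OF False] .
    qed
  qed
  also have "\<dots> = chain_sum K t" unfolding chain_sum_def by (subst sum.inter_filter) auto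
  finally show ?thesis .
qed

lemma wfun_eq:
  "wfun t = (\<Sum>b\<in>Tup. scaleW (\<Prod>s\<in>N. omega_word (t \<circ> Suc) (z s) (b s)) (T (\<lambda>s\<in>N. Fw s (map c (b s)))))"
  unfolding weight_function_label_tuples F_vector_def comp_def ..

lemma generic_shift:
  assumes "t \<in> generic_points m n z"
  shows "inj_on (t \<circ> Suc) {0..<m}" "\<And>s. s \<in> N \<Longrightarrow> z s \<notin> (t \<circ> Suc) ` {0..<m}"
proof -
  have Suc: "Suc ` {0..<m} = {1..m}" by (simp add: image_Suc_atLeastLessThan atLeastLessThanSuc_atLeastAtMost)
  have "inj_on t (Suc ` {0..<m})" using assms unfolding generic_points_def Suc by blast
  then show "inj_on (t \<circ> Suc) {0..<m}" by (intro comp_inj_on) simp_all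
  show "z s \<notin> (t \<circ> Suc) ` {0..<m}" if "s \<in> N" for s
    unfolding image_comp[symmetric] Suc
  proof
    assume "z s \<in> t ` {1..m}"
    then obtain a where a: "z s = t a" "a \<in> {1..m}" by (rule imageE)
    moreover have "t a \<noteq> z s" using assms that a(2) unfolding generic_points_def by blast
    ultimately show False by simp
  qed
qed

text \<open>Only the first argument is turned into chain sums; the second stays a sum of chains, and
  the pairs of tuples with equal colours produce the permutations.\<close>

lemma S_wfun:
  assumes t: "t \<in> generic_points m n z"
  shows "S (wfun t) (wfun t) = (\<Sum>\<pi>\<in>color_perms c {0..<m}.
    Determinant.det (laplacian N m wt z (t \<circ> Suc) ((t \<circ> Suc) \<circ> \<pi>)))"
proof -
  let ?t = "t \<circ> Suc"
  let ?om = "\<lambda>b. \<Prod>s\<in>N. omega_word ?t (z s) (b s)"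
  let ?x = "\<lambda>b. \<lambda>s\<in>N. Fw s (map c (b s))"
  have x: "?x b \<in> PiE N V" if "b \<in> Tup" for b
    using Fw_in_V tuple_word(1)[OF that] by (auto simp del: set_map)
  have "S (wfun t) (wfun t) = (\<Sum>b'\<in>Tup. ?om b' * (\<Sum>b\<in>Tup. ?om b * S (T (?x b)) (T (?x b'))))"
    unfolding wfun_eq by (intro S_sums T_in_W x)
  also have "\<dots> = (\<Sum>b'\<in>Tup. ?om b' * chain_sum (\<lambda>s. map c (b' s)) ?t)"
  proof (intro sum.cong refl arg_cong2[of _ _ _ _ "(*)"])
    fix b' assume b': "b' \<in> Tup"
    have "(\<Sum>b\<in>Tup. ?om b * S (T (?x b)) (T (?x b'))) =
       (\<Sum>b\<in>Tup. ?om b * (\<Prod>s\<in>N. B s (Fw s (map c (b s))) (Fw s (map c (b' s)))))"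
    proof (intro sum.cong refl arg_cong2[of _ _ _ _ "(*)"])
      fix b assume b: "b \<in> Tup"
      have "S (T (?x b)) (T (?x b')) = (\<Prod>s\<in>N. B s (?x b s) (?x b' s))"
        using form x[OF b] x[OF b'] unfolding tensor_form_def by blast
      then show "S (T (?x b)) (T (?x b')) = (\<Prod>s\<in>N. B s (Fw s (map c (b s))) (Fw s (map c (b' s))))"
        by simp
    qed
    also have "\<dots> = chain_sum (\<lambda>s. map c (b' s)) ?t"
      using tuple_word(1)[OF b'] by (intro omega_pairing generic_shift[OF t])
    finally show "(\<Sum>b\<in>Tup. ?om b * S (T (?x b)) (T (?x b'))) = chain_sum (\<lambda>s. map c (b' s)) ?t" .
  qed
  also have "\<dots> = (\<Sum>\<pi>\<in>color_perms c {0..<m}. Determinant.det (laplacian N m wt z ?t (?t \<circ> \<pi>)))"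
    unfolding chain_sum_def using generic_shift[OF t]
    by (intro omega_chain_color_sum_eq_det) auto
  finally show ?thesis .
qed

text \<open>Each word is expanded in vectors dual to words, with Shapovalov pairings as
  coefficients; collected over all tuples, these become pairings of the whole weight function. The
  vectors \<open>y K\<close> do not depend on \<open>t\<close>, and the chain sums that carry
  \<open>t\<close> have no poles at a critical point.\<close>

lemma wfun_expansion:
  shows "\<exists>P y. finite P \<and> (\<forall>K\<in>P. y K \<in> W) \<and>
    (\<forall>t\<in>generic_points m n z. wfun t = (\<Sum>K\<in>P. scaleW (chain_sum K (t \<circ> Suc)) (y K)))"
proof -
  have "\<forall>s\<in>N. \<exists>De. finite (fst De) \<and> (\<forall>J\<in>fst De. set J \<subseteq> {1..r} \<and> snd De J \<in> V s) \<and>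
    (\<forall>I. set I \<subseteq> {1..r} \<and> length I \<le> m \<longrightarrow> Fw s I = (\<Sum>J\<in>fst De. scaleV (B s (Fw s I) (Fw s J)) (snd De J)))"
  proof
    fix s assume s: "s \<in> N"
    interpret shapovalov_module scaleV r "V s" "act s" "\<Lambda> s" "v s" "B s" by (rule modules[OF s])
    obtain D e where "finite D" "\<forall>J\<in>D. set J \<subseteq> {1..r} \<and> e J \<in> V s"
      "\<forall>I. set I \<subseteq> {1..r} \<and> length I \<le> m \<longrightarrow> F_word I = (\<Sum>J\<in>D. scaleV (B s (F_word I) (F_word J)) (e J))"
      using F_word_expansion[of m] by blast
    then show "\<exists>De. finite (fst De) \<and> (\<forall>J\<in>fst De. set J \<subseteq> {1..r} \<and> snd De J \<in> V s) \<and>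
      (\<forall>I. set I \<subseteq> {1..r} \<and> length I \<le> m \<longrightarrow> Fw s I = (\<Sum>J\<in>fst De. scaleV (B s (Fw s I) (Fw s J)) (snd De J)))"
      by (intro exI[of _ "(D, e)"]) (simp add: F_word_def)
  qed
  from bchoice[OF this] obtain De where De: "\<And>s. s \<in> N \<Longrightarrow> finite (fst (De s))"
    "\<And>s J. s \<in> N \<Longrightarrow> J \<in> fst (De s) \<Longrightarrow> set J \<subseteq> {1..r} \<and> snd (De s) J \<in> V s"
    "\<And>s I. s \<in> N \<Longrightarrow> set I \<subseteq> {1..r} \<Longrightarrow> length I \<le> m \<Longrightarrow>
       Fw s I = (\<Sum>J\<in>fst (De s). scaleV (B s (Fw s I) (Fw s J)) (snd (De s) J))" by blast
  define D where "D s = fst (De s)" for s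
  define e where "e s = snd (De s)" for s
  define y where "y K = T (\<lambda>s\<in>N. e s (K s))" for K
  let ?P = "PiE N D"
  have "finite ?P" using De(1) by (intro finite_PiE) (auto simp: D_def)
  moreover have "y K \<in> W" if "K \<in> ?P" for K
    unfolding y_def using De(2) that by (intro T_in_W) (auto simp: D_def e_def PiE_iff)
  moreover have "wfun t = (\<Sum>K\<in>?P. scaleW (chain_sum K (t \<circ> Suc)) (y K))" if t: "t \<in> generic_points m n z" for t
  proof -
    let ?om = "\<lambda>b. \<Prod>s\<in>N. omega_word (t \<circ> Suc) (z s) (b s)"
    let ?B = "\<lambda>b K. \<Prod>s\<in>N. B s (Fw s (map c (b s))) (Fw s (K s))"
    have exp: "T (\<lambda>s\<in>N. Fw s (map c (b s))) = (\<Sum>K\<in>?P. scaleW (?B b K) (y K))" if b: "b \<in> Tup" for b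
    proof -
      have "(\<lambda>s\<in>N. Fw s (map c (b s))) = (\<lambda>s\<in>N. \<Sum>J\<in>D s. scaleV (B s (Fw s (map c (b s))) (Fw s J)) (e s J))"
        using De(3) tuple_word[OF b] by (intro restrict_ext) (simp only: D_def e_def)
      then show ?thesis
        unfolding y_def
        using multilinear_expansion[OF V_scale W_scale T_multilinear V_subspace, of D e
            "\<lambda>s J. B s (Fw s (map c (b s))) (Fw s J)"] De(1,2)
        by (simp only: D_def e_def)
    qed
    have "wfun t = (\<Sum>b\<in>Tup. \<Sum>K\<in>?P. scaleW (?om b * ?B b K) (y K))"
      unfolding wfun_eq by (intro sum.cong refl) (simp only: exp wsp.scale_sum_right wsp.scale_scale)
    also have "\<dots> = (\<Sum>K\<in>?P. scaleW (\<Sum>b\<in>Tup. ?om b * ?B b K) (y K))"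
      by (subst sum.swap) (simp only: wsp.scale_sum_left)
    also have "\<dots> = (\<Sum>K\<in>?P. scaleW (chain_sum K (t \<circ> Suc)) (y K))"
    proof (intro sum.cong refl arg_cong2[of _ _ _ _ scaleW] omega_pairing generic_shift[OF t])
      fix K s assume "K \<in> ?P" "s \<in> N"
      then have "K s \<in> fst (De s)" by (auto simp: D_def)
      then show "set (K s) \<subseteq> {1..r}" using De(2)[OF \<open>s \<in> N\<close>] by blast
    qed
    finally show ?thesis .
  qed
  ultimately show ?thesis by blast
qed

end

text \<open>A line through \<open>t0\<close> with direction (1, 2, 3, ...) meets each hyperplane t_a
  = t_b or t_a = z_s at most once, so its points close to \<open>t0\<close> and different from it
  are generic.\<close>

lemma generic_points_limit:
  fixes t0 :: "nat \<Rightarrow> complex"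
  shows "at t0 within generic_points m n z \<noteq> bot"
proof
  assume bot: "at t0 within generic_points m n z = bot"
  \<comment> \<open>Distinct slopes separate the coordinates. They are nonzero at every index,
    including 0, so \<open>f e\<close> differs from \<open>t0\<close> for small nonzero
    \<open>e\<close> even if there are no labels.\<close>
  define f :: "complex \<Rightarrow> nat \<Rightarrow> complex" where "f e i = t0 i + e * of_nat (Suc i)" for e i
  have ne: "\<forall>\<^sub>F e in at (0::complex). f e a \<noteq> f e b" if "a \<noteq> b" for a b
  proof -
    have d: "of_nat (Suc a) - of_nat (Suc b) \<noteq> (0 :: complex)" using that by (metis eq_iff_diff_eq_0 nat.inject of_nat_eq_iff)
    have alg: "e * (p - q) = y - x" if "x + e * p = y + e * q" for x y e p q :: complex
    proof -
      have "e * (p - q) = (x + e * p) - e * q - x" by (simp add: algebra_simps)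
      then show ?thesis unfolding that by simp
    qed
    show ?thesis using eventually_neq_at_within[of "(t0 b - t0 a) / (of_nat (Suc a) - of_nat (Suc b))" 0 UNIV]
    proof (rule eventually_mono)
      fix e assume e: "e \<noteq> (t0 b - t0 a) / (of_nat (Suc a) - of_nat (Suc b))"
      show "f e a \<noteq> f e b"
      proof
        assume "f e a = f e b"
        then have "t0 a + e * of_nat (Suc a) = t0 b + e * of_nat (Suc b)" by (simp only: f_def)
        then have "e * (of_nat (Suc a) - of_nat (Suc b)) = t0 b - t0 a" by (rule alg)
        then show False using e d by (simp only: nonzero_eq_divide_eq not_False_eq_True)
      qed
    qed
  qed
  have nz: "\<forall>\<^sub>F e in at (0::complex). f e a \<noteq> w" for a w
    using eventually_neq_at_within[of "(w - t0 a) / of_nat (Suc a)" 0 UNIV]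
  proof (rule eventually_mono)
    fix e assume e: "e \<noteq> (w - t0 a) / of_nat (Suc a)"
    have d: "of_nat (Suc a) \<noteq> (0 :: complex)" by (simp only: of_nat_eq_0_iff)
    show "f e a \<noteq> w"
    proof
      assume "f e a = w"
      then have "t0 a + e * of_nat (Suc a) = w" by (simp only: f_def)
      then have "e * of_nat (Suc a) = w - t0 a" by (metis add_diff_cancel_left')
      then show False using e d by (simp only: nonzero_eq_divide_eq not_False_eq_True)
    qed
  qed
  have "\<forall>\<^sub>F e in at 0. f e \<in> generic_points m n z"
  proof -
    have "\<forall>\<^sub>F e in at 0. (\<forall>a\<in>{1..m}. \<forall>b\<in>{1..m} - {a}. f e a \<noteq> f e b) \<and> (\<forall>a\<in>{1..m}. \<forall>s\<in>{1..n}. f e a \<noteq> z s)"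
      by (intro eventually_conj eventually_ball_finite ballI ne nz) auto
    then show ?thesis
    proof (rule eventually_mono)
      fix e assume "(\<forall>a\<in>{1..m}. \<forall>b\<in>{1..m} - {a}. f e a \<noteq> f e b) \<and> (\<forall>a\<in>{1..m}. \<forall>s\<in>{1..n}. f e a \<noteq> z s)"
      then show "f e \<in> generic_points m n z" unfolding generic_points_def inj_on_def by blast
    qed
  qed
  moreover have "\<forall>\<^sub>F e in at 0. f e \<noteq> t0"
    using nz[of 0 "t0 0"] by (rule eventually_mono) auto
  moreover have "(f \<longlongrightarrow> t0) (at 0)"
  proof -
    have "continuous_on UNIV f"
      unfolding f_def by (intro continuous_on_coordinatewise_then_product continuous_intros)
    then have "(f \<longlongrightarrow> f 0) (at 0)" by (simp add: continuous_on_eq_continuous_at isCont_def)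
    moreover have "f 0 = t0" by (simp add: f_def fun_eq_iff)
    ultimately show ?thesis by simp
  qed
  ultimately have "filterlim f (at t0 within generic_points m n z) (at 0)"
    by (simp add: filterlim_at eventually_conj)
  then have "filtermap f (at 0) \<le> bot" unfolding bot filterlim_def .
  then have "eventually (\<lambda>_. False) (filtermap f (at 0))" unfolding le_filter_def by simp
  then have "at (0 :: complex) = bot" unfolding eventually_filtermap by (simp only: eventually_False)
  then show False using at_neq_bot by blast
qed

context bethe_setting
begin

text \<open>Functionals separate vectors, and limits of their values along a nontrivial filter are
  unique; hence a weak limit in \<open>W\<close> is the only one.\<close>

lemma bethe_vector_eqI:
  assumes "w \<in> W" "\<And>\<phi>. Vector_Spaces.linear scaleW (*) \<phi> \<Longrightarrow>
    ((\<lambda>t. \<phi> (wfun t)) \<longlongrightarrow> \<phi> w) (at t0 within generic_points m n z)"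
  shows "bethe_vector scaleW W r n act v T l z t0 = w"
  unfolding bethe_vector_def
proof (rule the_equality)
  show "w \<in> W \<and> (\<forall>\<phi>. Vector_Spaces.linear scaleW (*) \<phi> \<longrightarrow>
    ((\<lambda>t. \<phi> (wfun t)) \<longlongrightarrow> \<phi> w) (at t0 within generic_points m n z))" using assms by blast
  fix u assume u: "u \<in> W \<and> (\<forall>\<phi>. Vector_Spaces.linear scaleW (*) \<phi> \<longrightarrow>
    ((\<lambda>t. \<phi> (wfun t)) \<longlongrightarrow> \<phi> u) (at t0 within generic_points m n z))"
  interpret cv: vector_space "(*) :: complex \<Rightarrow> complex \<Rightarrow> complex"
    by unfold_locales (auto simp: algebra_simps)
  interpret wc: vector_space_pair scaleW "(*) :: complex \<Rightarrow> complex \<Rightarrow> complex" ..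
  show "u = w"
  proof (rule ccontr)
    assume "u \<noteq> w"
    then have "wsp.independent {u - w}" by simp
    then obtain \<psi> where \<psi>: "Vector_Spaces.linear scaleW (*) \<psi>" "\<psi> (u - w) = (1 :: complex)"
      using wc.linear_independent_extend[of "{u - w}" "\<lambda>_. 1"] by auto
    interpret \<psi>: Vector_Spaces.linear scaleW "(*)" \<psi> by fact
    have "\<psi> u = \<psi> w"
      using tendsto_unique[OF generic_points_limit] u assms(2)[OF \<psi>(1)] \<psi>(1) by blast
    then show False using \<psi>(2) by (simp add: \<psi>.diff)
  qed
qed

theorem shapovalov_norm_bethe_vector:
  assumes z: "inj_on z N" and crit: "critical_point r n \<Lambda> l z t0"
  shows "S (bethe_vector scaleW W r n act v T l z t0) (bethe_vector scaleW W r n act v T l z t0) =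
    hess_log (master r n \<Lambda> l z) m t0"
proof -
  let ?p = "\<lambda>i s. weight_form r (root_of l i) (\<Lambda> s)"
  let ?q = "\<lambda>i j. weight_form r (root_of l i) (root_of l j)"
  let ?C = "\<Prod>(i, j)\<in>{(i, j). 1 \<le> i \<and> i < j \<and> j \<le> n}. factor_pow (z i - z j) (weight_form r (\<Lambda> i) (\<Lambda> j))"
  let ?u = "t0 \<circ> Suc"
  let ?F = "at t0 within generic_points m n z"
  have q: "?q i j = (if color l i = color l j then 2 else if color l i = color l j + 1 \<or> color l j = color l i + 1 then - 1 else 0)"
    if "i \<in> {1..m}" "j \<in> {1..m}" for i j
    by (rule weight_form_simple_root[OF color_in[OF that(1)] color_in[OF that(2)]])
  interpret A: arrangement_product m n ?p ?q z ?C
  proof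
    fix i s assume i: "i \<in> {1..m}" and s: "s \<in> {1..n}"
    have "\<Lambda> s \<in> cartan_dual r" "\<Lambda> s (chev_H r (color l i)) \<in> \<nat>"
      using dominant[OF s] color_in[OF i] by (auto simp: integral_dominant_def)
    then show "?p i s \<in> \<int>"
      using weight_form_simple_root_left[OF color_in[OF i]] Nats_subset_Ints by auto
  next
    fix i j assume ij: "i \<in> {1..m}" "j \<in> {1..m}"
    show "?q i j \<in> \<int>" unfolding q[OF ij] by simp
    show "?q i j = ?q j i" unfolding q[OF ij] q[OF ij(2,1)] by auto
  next
    have "finite {(i, j). 1 \<le> i \<and> i < j \<and> j \<le> n}" by (rule finite_subset[of _ "{..n} \<times> {..n}"]) auto
    moreover have "factor_pow (z i - z j) a \<noteq> 0" if "1 \<le> i" "i < j" "j \<le> n" for i j a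
    proof -
      have "z i \<noteq> z j" using inj_onD[OF z, of i j] that by auto
      then show ?thesis by (simp add: factor_pow_def)
    qed
    ultimately show "?C \<noteq> 0" by (subst prod_zero_iff) auto
  qed
  have \<Phi>: "A.\<Phi> = master r n \<Lambda> l z" by (rule ext) (simp only: A.\<Phi>_def master_def)
  have adm: "A.admissible t0" using crit unfolding critical_point_def A.admissible_def by blast
  have wt: "wt = (\<lambda>i x. case x of Inl k \<Rightarrow> - ?q (Suc i) (Suc k) | Inr s \<Rightarrow> ?p (Suc i) s)"
    by (intro ext) (simp add: wt_def)
  have hess: "hess_log (master r n \<Lambda> l z) m t0 = Determinant.det (laplacian N m wt z ?u ?u)"
    using A.hess_log_eq_laplacian[OF adm] unfolding \<Phi> wt .
  have Suc_m: "Suc i \<in> {1..m}" if "i < m" for i using that by simp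
  interpret P: weighted_points N m wt z ?u
  proof
    show "regular_point N m wt z ?u"
      unfolding regular_point_def
    proof (intro allI impI ballI)
      fix i x assume i: "i < m" and x: "x \<in> targets N {0..<m}" "wt i x \<noteq> 0" "x \<noteq> Inl i"
      show "?u i \<noteq> target_val ?u z x"
      proof (cases x)
        case (Inl k)
        then have "Suc k \<in> {1..m} - {Suc i}" "?q (Suc i) (Suc k) \<noteq> 0" using x by (auto simp: targets_def wt_def)
        then show ?thesis using adm Suc_m[OF i] Inl unfolding A.admissible_def by auto
      next
        case (Inr s)
        then have "s \<in> N" "?p (Suc i) s \<noteq> 0" using x by (auto simp: targets_def wt_def)
        then show ?thesis using adm Suc_m[OF i] Inr unfolding A.admissible_def by auto
      qed
    qed
  qed simp
  have crit_sum: "(\<Sum>x\<in>targets N {0..<m}. wt i x / (?u i - target_val ?u z x)) = 0" if i: "i < m" for i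
  proof -
    have "(\<Sum>k\<in>{0..<m}. ?q (Suc i) (Suc k) / (t0 (Suc i) - t0 (Suc k))) = (\<Sum>k\<in>Suc ` {0..<m}. ?q (Suc i) k / (t0 (Suc i) - t0 k))"
      by (subst sum.reindex) auto
    also have "Suc ` {0..<m} = {1..m}" by (simp add: image_Suc_atLeastLessThan atLeastLessThanSuc_atLeastAtMost)
    also have "(\<Sum>k\<in>{1..m}. ?q (Suc i) k / (t0 (Suc i) - t0 k)) = (\<Sum>k\<in>{1..m} - {Suc i}. ?q (Suc i) k / (t0 (Suc i) - t0 k))"
      by (intro sum.mono_neutral_right) auto
    finally have "(\<Sum>x\<in>targets N {0..<m}. wt i x / (?u i - target_val ?u z x)) =
      - (\<Sum>k\<in>{1..m} - {Suc i}. ?q (Suc i) k / (t0 (Suc i) - t0 k)) + (\<Sum>s\<in>N. ?p (Suc i) s / (t0 (Suc i) - z s))"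
      by (simp add: sum_targets wt_def sum_negf)
    moreover have "- (\<Sum>s\<in>N. ?p (Suc i) s / (t0 (Suc i) - z s)) + (\<Sum>k\<in>{1..m} - {Suc i}. ?q (Suc i) k / (t0 (Suc i) - t0 k)) = 0"
      using crit Suc_m[OF i] unfolding critical_point_def by blast
    ultimately show ?thesis by (simp add: algebra_simps)
  qed
  have sym: "weight_symmetry N m wt z ?u \<pi>" if "\<pi> \<in> color_perms c {0..<m}" for \<pi>
  proof
    have ci: "c (\<pi> i) = c i" if "i < m" for i using \<open>\<pi> \<in> _\<close> that by (auto simp: color_perms_def)
    show "\<pi> permutes {0..<m}" using that by (simp add: color_perms_def)
    show "wt (\<pi> i) (Inr s) = wt i (Inr s)" if "i < m" for i s using ci[OF that] by (simp add: wt_def)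
    show "wt (\<pi> i) (Inl (\<pi> k)) = wt i (Inl k)" if "i < m" "k < m" for i k
      using ci[OF that(1)] ci[OF that(2)] by (simp add: wt_def)
  qed
  have coord: "((\<lambda>t. t i) \<longlongrightarrow> t0 i) ?F" for i
  proof -
    have "continuous_on UNIV (\<lambda>t :: nat \<Rightarrow> complex. t i)" by simp
    then have "((\<lambda>t. t i) \<longlongrightarrow> t0 i) (at t0)" by (simp only: continuous_on_def) blast
    then show ?thesis by (rule tendsto_mono[OF at_le[OF subset_UNIV]])
  qed
  then have lim: "((\<lambda>t. (t \<circ> Suc) i) \<longlongrightarrow> ?u i) ?F" for i by simp
  have gen: "\<forall>\<^sub>F t in ?F. t \<in> generic_points m n z" by (auto simp: eventually_at_filter)
  have chain_lim: "((\<lambda>t. chain_sum K (t \<circ> Suc)) \<longlongrightarrow> chain_sum K ?u) ?F" for K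
    unfolding chain_sum_def
  proof (intro tendsto_sum tendsto_prod)
    fix b s assume b: "b \<in> {b \<in> Tup. \<forall>s\<in>N. map c (b s) = K s}" and s: "s \<in> N"
    then have "set (b s) \<subseteq> {0..<m}" using label_tuplesD(2)[of b N "{0..<m}" s] by blast
    then show "((\<lambda>t. chain_weight (\<lambda>i x. wt i x / ((t \<circ> Suc) i - target_val (t \<circ> Suc) z x)) s (b s)) \<longlongrightarrow>
      chain_weight (\<lambda>i x. wt i x / (?u i - target_val ?u z x)) s (b s)) ?F"
      by (intro P.tendsto_chain_weight lim s)
  qed
  obtain Ks y where fin: "finite Ks" and y: "\<And>K. K \<in> Ks \<Longrightarrow> y K \<in> W"
    and exp: "\<And>t. t \<in> generic_points m n z \<Longrightarrow> wfun t = (\<Sum>K\<in>Ks. scaleW (chain_sum K (t \<circ> Suc)) (y K))"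
    using wfun_expansion by blast
  define w0 where "w0 = (\<Sum>K\<in>Ks. scaleW (chain_sum K ?u) (y K))"
  have bethe: "bethe_vector scaleW W r n act v T l z t0 = w0"
  proof (rule bethe_vector_eqI)
    have "wsp.subspace W" using wsp.subspace_span W_span by metis
    then show "w0 \<in> W" unfolding w0_def using y by (intro wsp.subspace_sum wsp.subspace_scale) auto
    fix \<phi> :: "'w \<Rightarrow> complex" assume "Vector_Spaces.linear scaleW (*) \<phi>"
    then interpret \<phi>: Vector_Spaces.linear scaleW "(*)" \<phi> .
    have L: "((\<lambda>t. \<Sum>K\<in>Ks. chain_sum K (t \<circ> Suc) * \<phi> (y K)) \<longlongrightarrow> (\<Sum>K\<in>Ks. chain_sum K ?u * \<phi> (y K))) ?F"
      by (intro tendsto_sum tendsto_mult chain_lim tendsto_const)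
    have w0: "\<phi> w0 = (\<Sum>K\<in>Ks. chain_sum K ?u * \<phi> (y K))" by (simp only: w0_def \<phi>.sum \<phi>.scale)
    have ev: "\<forall>\<^sub>F t in ?F. (\<Sum>K\<in>Ks. chain_sum K (t \<circ> Suc) * \<phi> (y K)) = \<phi> (wfun t)"
      using gen by (rule eventually_mono) (simp only: exp \<phi>.sum \<phi>.scale)
    show "((\<lambda>t. \<phi> (wfun t)) \<longlongrightarrow> \<phi> w0) ?F"
      using Lim_transform_eventually[OF L ev] unfolding w0 .
  qed
  \<comment> \<open>\<open>Q\<close> and \<open>R\<close> both express the norm at generic points.
    \<open>Q\<close> is quadratic in the chain sums, \<open>R\<close> is the sum of determinants;
    each converges to its own value at \<open>t0\<close>, so these values agree although single
    terms of the weight function may have poles there.\<close>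
  define Q where "Q t = (\<Sum>j\<in>Ks. chain_sum j t * (\<Sum>k\<in>Ks. chain_sum k t * S (y k) (y j)))" for t
  define R where "R t = (\<Sum>\<pi>\<in>color_perms c {0..<m}. Determinant.det (laplacian N m wt z t (t \<circ> \<pi>)))" for t
  have Q: "((\<lambda>t. Q (t \<circ> Suc)) \<longlongrightarrow> Q ?u) ?F"
    unfolding Q_def by (intro tendsto_sum tendsto_mult chain_lim tendsto_const)
  have R: "((\<lambda>t. R (t \<circ> Suc)) \<longlongrightarrow> R ?u) ?F"
    unfolding R_def
  proof (intro tendsto_sum)
    fix \<pi> assume "\<pi> \<in> color_perms c {0..<m}"
    then interpret weight_symmetry N m wt z ?u \<pi> by (rule sym)
    show "((\<lambda>t. Determinant.det (laplacian N m wt z (t \<circ> Suc) ((t \<circ> Suc) \<circ> \<pi>))) \<longlongrightarrow>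
      Determinant.det (laplacian N m wt z ?u (?u \<circ> \<pi>))) ?F"
      by (rule tendsto_det_laplacian[OF lim])
  qed
  have QR: "\<forall>\<^sub>F t in ?F. Q (t \<circ> Suc) = R (t \<circ> Suc)"
    using gen
  proof (rule eventually_mono)
    fix t assume t: "t \<in> generic_points m n z"
    have "S (wfun t) (wfun t) = Q (t \<circ> Suc)" unfolding exp[OF t] Q_def by (rule S_sums[OF y])
    then show "Q (t \<circ> Suc) = R (t \<circ> Suc)" using S_wfun[OF t] unfolding R_def by simp
  qed
  have "Q ?u = R ?u"
    by (rule tendsto_unique[OF generic_points_limit Lim_transform_eventually[OF Q QR] R])
  moreover have "S w0 w0 = Q ?u" unfolding w0_def Q_def by (rule S_sums[OF y])
  moreover have "R ?u = Determinant.det (laplacian N m wt z ?u ?u)"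
  proof -
    have "Determinant.det (laplacian N m wt z ?u (?u \<circ> \<pi>)) = (if \<pi> = id then Determinant.det (laplacian N m wt z ?u ?u) else 0)"
      if \<pi>: "\<pi> \<in> color_perms c {0..<m}" for \<pi>
    proof (cases "\<pi> = id")
      case False
      interpret weight_symmetry N m wt z ?u \<pi> by (rule sym[OF \<pi>])
      \<comment> \<open>The label and its image have the same colour, so this weight is - 2.\<close>
      have "wt i (Inl (\<pi> i)) \<noteq> 0" if i: "i < m" for i
      proof -
        have "c (\<pi> i) = c i" using \<pi> i by (auto simp: color_perms_def)
        then show ?thesis using q[OF Suc_m[OF i] Suc_m[OF i]] by (simp add: wt_def)
      qed
      then show ?thesis using det_laplacian_perm[OF crit_sum _ False] False by simp
    qed simp
    moreover have "id \<in> color_perms c {0..<m}" by (simp add: color_perms_def permutes_id)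
    ultimately show ?thesis unfolding R_def by (simp add: sum.delta)
  qed
  ultimately show ?thesis unfolding bethe hess by simp
qed

end

theorem theorem7p1:
  fixes r n :: nat
    and \<Lambda> :: "nat \<Rightarrow> weight"
    and l :: "nat \<Rightarrow> nat"
    and z t0 :: "nat \<Rightarrow> complex"
    and scaleV :: "complex \<Rightarrow> 'v::ab_group_add \<Rightarrow> 'v"
    and V :: "nat \<Rightarrow> 'v set"
    and act :: "nat \<Rightarrow> complex mat \<Rightarrow> 'v \<Rightarrow> 'v"
    and v :: "nat \<Rightarrow> 'v"
    and scaleW :: "complex \<Rightarrow> 'w::ab_group_add \<Rightarrow> 'w"
    and W :: "'w set"
    and T :: "(nat \<Rightarrow> 'v) \<Rightarrow> 'w"
    and B :: "nat \<Rightarrow> 'v \<Rightarrow> 'v \<Rightarrow> complex"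
    and S :: "'w \<Rightarrow> 'w \<Rightarrow> complex"
  assumes "\<And>s. s \<in> {1..n} \<Longrightarrow> integral_dominant r (\<Lambda> s)"
    and "integral_dominant r
           (\<lambda>X. (\<Sum>s\<in>{1..n}. \<Lambda> s X) - (\<Sum>i\<in>{1..r}. of_nat (l i) * simple_root i X))"
    and "\<And>s. s \<in> {1..n} \<Longrightarrow> irreducible_hw_module scaleV r (V s) (act s) (\<Lambda> s) (v s)"
    and "is_tensor_product scaleV scaleW n V W T"
    and "\<And>s. s \<in> {1..n} \<Longrightarrow> shapovalov_form scaleV r (V s) (act s) (v s) (B s)"
    and "tensor_form scaleW n V W T B S"
    and "inj_on z {1..n}"
    and "nondegenerate_critical_point r n \<Lambda> l z t0"
  shows "S (bethe_vector scaleW W r n act v T l z t0) (bethe_vector scaleW W r n act v T l z t0) =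
           hess_log (master r n \<Lambda> l z) (total_mult r l) t0"
proof -
  have modules: "shapovalov_module scaleV r (V s) (act s) (\<Lambda> s) (v s) (B s)" if "s \<in> {1..n}" for s
    using assms(3)[OF that] assms(5)[OF that]
    by (simp add: shapovalov_module_def shapovalov_module_axioms_def)
  interpret bethe_setting r n \<Lambda> l z scaleV V act v scaleW W T B S
    by (rule bethe_setting.intro) (fact assms modules)+
  show ?thesis
    using assms(7,8) by (intro shapovalov_norm_bethe_vector) (simp_all add: nondegenerate_critical_point_def)
qed

end
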